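(* Let $n\ge 1$ and let $Q(z)=(z-a_1)(z-a_2)\cdots(z-a_n)\in\mathbb{C}[z]$ be a monic strong uniqueness polynomial with pairwise distinct roots $a_1,\dots,a_n$, and put $S=\{a_1,\dots,a_n\}$. Let $m_1$ and $m_2$ denote, respectively, the number of distinct simple zeros and the number of distinct multiple zeros of the polynomial $Q(z)-Q(0)$, and let $k$ denote the number of distinct zeros of $Q'(z)$. Suppose that $n>\max\{2k+2,\, m_1+m_2\}$, $m_1+m_2>2$ and $k\ge 2$. Let $\mathfrak{f}$ be a transcendental entire function with hyper-order $\rho_2(\mathfrak{f})<1$, and let $c\in\mathbb{C}\setminus\{0\}$. If $\mathfrak{f}(z)$ and $\mathfrak{f}(z+c)$ share the set $S$ with weak weight $3$, i.e. $E_{3)}(S;\mathfrak{f}(z))=E_{3)}(S;\mathfrak{f}(z+c))$, then $\mathfrak{f}(z)\equiv\mathfrak{f}(z+c)$.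
   Context: A non-constant monic polynomial $P(z)$ is called a strong uniqueness polynomial (for meromorphic functions) if, whenever $\mathfrak{f},\mathfrak{g}$ are non-constant meromorphic functions on $\mathbb{C}$ and $\alpha$ is a non-zero constant with $P(\mathfrak{f})\equiv\alpha P(\mathfrak{g})$, it follows that $\mathfrak{f}\equiv\mathfrak{g}$. The hyper-order of a meromorphic function $\mathfrak{f}$ is $\rho_2(\mathfrak{f})=\limsup_{r\to\infty}\frac{\log\log T(r,\mathfrak{f})}{\log r}$, where $T(r,\mathfrak{f})$ is the Nevanlinna characteristic function. Weak weighted sharing: for a positive integer $l$ (or $\infty$) and $a\in\mathbb{C}$, $E_{l)}(a;\mathfrak{f})$ denotes the set of those $a$-points of $\mathfrak{f}$ whose multiplicity is at most $l$, each counted according to its multiplicity. For a set $S\subset\mathbb{C}$, $E_{l)}(S;\mathfrak{f})=\bigcup_{a\in S}E_{l)}(a;\mathfrak{f})$ (as a multiset of points), and $\mathfrak{f}$, $\mathfrak{g}$ share $S$ with weak weight $l$ if $E_{l)}(S;\mathfrak{f})=E_{l)}(S;\mathfrak{g})$. *)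

theory Defs
  imports "HOL-Complex_Analysis.Complex_Analysis" "HOL-Computational_Algebra.Polynomial"
begin

text \<open>Strong uniqueness polynomial. Meromorphic functions on the whole plane are
  represented as functions meromorphic on UNIV; identities between meromorphic
  functions are understood up to a discrete (sparse) exceptional set, since the
  values of such a representation at poles are irrelevant.\<close>
definition strong_uniqueness_poly :: "complex poly \<Rightarrow> bool" where
  "strong_uniqueness_poly P \<longleftrightarrow>
     degree P \<ge> 1 \<and> lead_coeff P = 1 \<and>
     (\<forall>f g (\<alpha>::complex).
        f meromorphic_on UNIV \<longrightarrow> g meromorphic_on UNIV \<longrightarrow>
        \<not> (\<exists>a. \<forall>\<^sub>\<approx>z. f z = a) \<longrightarrow> \<not> (\<exists>a. \<forall>\<^sub>\<approx>z. g z = a) \<longrightarrow>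
        \<alpha> \<noteq> 0 \<longrightarrow>
        (\<forall>\<^sub>\<approx>z. poly P (f z) = \<alpha> * poly P (g z)) \<longrightarrow>
        (\<forall>\<^sub>\<approx>z. f z = g z))"

text \<open>Nevanlinna characteristic of an entire function (N(r,f) = 0, so T = m):
  T(r,f) = (1/2pi) * integral over [0,2pi] of log^+ |f(r e^{i t})|.\<close>
definition nev_char :: "(complex \<Rightarrow> complex) \<Rightarrow> real \<Rightarrow> real" where
  "nev_char f r = (1 / (2 * pi)) *
     integral {0..2*pi} (\<lambda>t. max 0 (ln (cmod (f (of_real r * exp (\<i> * of_real t))))))"

definition hyper_order :: "(complex \<Rightarrow> complex) \<Rightarrow> ereal" where
  "hyper_order f = Limsup at_top (\<lambda>r::real. ereal (ln (ln (nev_char f r)) / ln r))"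

definition apoint_mult :: "(complex \<Rightarrow> complex) \<Rightarrow> complex \<Rightarrow> complex \<Rightarrow> nat" where
  "apoint_mult f a z = nat (zorder (\<lambda>w. f w - a) z)"

text \<open>E_{l)}(S;f) as a multiset of points, represented by its multiplicity function:
  a point z is counted with multiplicity m if f z = a for some a in S and the a-point z
  has multiplicity m \<le> l; otherwise it is counted 0 times.\<close>
definition E_weak :: "nat \<Rightarrow> complex set \<Rightarrow> (complex \<Rightarrow> complex) \<Rightarrow> complex \<Rightarrow> nat" where
  "E_weak l S f z =
     (\<Sum>a\<in>S. if f z = a \<and> apoint_mult f a z \<le> l then apoint_mult f a z else 0)"

definition transcendental_entire :: "(complex \<Rightarrow> complex) \<Rightarrow> bool" where
  "transcendental_entire f \<longleftrightarrow> f holomorphic_on UNIV \<and> \<not> (\<exists>p. \<forall>z. f z = poly p z)"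

end

theory Submission
  imports Defs "HOL-Computational_Algebra.Fundamental_Theorem_Algebra"
begin

text \<open>
  Put \<open>g(z) = f(z + c)\<close>, \<open>F = Q(f)\<close>, \<open>G = Q(g)\<close>, and let \<open>R\<close> be the product of \<open>z - b\<close> over the
  distinct zeros \<open>b\<close> of \<open>Q'\<close>. With \<open>H = F''/F' - G''/G' - 2F'/F + 2G'/G\<close>, the function
  \<open>E = F G f' R(f) g' R(g) H\<close> is entire.

  If \<open>E\<close> vanishes identically, integrating twice gives \<open>G - A F = B F G\<close> with \<open>A \<noteq> 0\<close>. For \<open>B \<noteq> 0\<close> the
  function \<open>Q(g)\<close> omits \<open>-A/B\<close>, so by Picard \<open>Q + A/B\<close> has a single zero and \<open>k \<le> 1\<close>; for \<open>B = 0\<close>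
  strong uniqueness yields \<open>f = g\<close>.

  If \<open>E\<close> does not vanish identically, sharing with weak weight 3 makes \<open>W = E\<^sup>2 / (F G)\<^sup>3\<close> entire, so the mean
  of \<open>log |W|\<close> over \<open>|z| = r\<close> is bounded below. On the other hand, since \<open>n \<ge> 2k + 3\<close>, the product
  \<open>|W| (1 + |f|) (1 + |g|)\<close> is at most the sixth power of a sum of logarithmic derivatives, up to a constant,
  and the lemma on the logarithmic derivative gives \<open>T(r) = O(log T(R) + log R + log 1/(R - r))\<close> for the mean \<open>T\<close> of
  \<open>log (1 + |f|) (1 + |g|)\<close>. By Borel's growth lemma \<open>T(r) = O(log r)\<close> for arbitrarily large \<open>r\<close>, and
  \<open>f\<close> is a polynomial.
\<close>

section \<open>Blaschke products and the Poisson--Jensen inequality\<close>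

text \<open>\<open>H\<close> is the logarithmic derivative of \<open>(F'/F^2) / (G'/G^2)\<close>,
  that is of \<open>(1/F)' / (1/G)'\<close>; hence \<open>H = 0\<close> makes \<open>1/F\<close> an
  affine function of \<open>1/G\<close>. The poles of \<open>H\<close> are simple and lie at zeros
  of \<open>F\<close>, \<open>G\<close>, \<open>F'\<close>, \<open>G'\<close>. Those coming from
  \<open>Q'(f)\<close> are cleared by \<open>R(f)\<close>, which counts each zero of
  \<open>Q'\<close> once: its degree is only \<open>k\<close>, and this is why
  \<open>n \<ge> 2k + 3\<close> is enough.

  The exponents in \<open>E^2 / (F G)^3\<close> balance orders. Where only \<open>F\<close>
  vanishes, to order \<open>p\<close>, \<open>E\<close> has order at least \<open>2p - 2\<close>,
  and \<open>2(2p - 2) \<ge> 3p\<close> means \<open>p \<ge> 4\<close>: exactly the points that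
  weight 3 leaves unshared. At a common zero of orders \<open>p\<close> and \<open>s\<close> the
  order of \<open>E\<close> is at least \<open>2(p + s) - 3\<close>, so small equal orders need
  extra cancellation inside \<open>E\<close>.

  No counting functions occur; Jensen's inequality for \<open>W\<close> is the only lower bound. The
  obstacle in the upper bound is that \<open>h'/h\<close> may have poles arbitrarily close to the
  circle, so its mean has no uniform bound. Square roots of logarithmic derivatives are averaged
  instead, and by concavity the mean of a logarithm is at most the logarithm of the mean.\<close>

lemma entire_subset: "f holomorphic_on UNIV \<Longrightarrow> f holomorphic_on A"
  by (rule holomorphic_on_subset) auto

lemma finite_zeros_entire:
  assumes h: "h holomorphic_on UNIV" and w: "h w \<noteq> 0" and K: "compact K"
  shows "finite {z \<in> K. h z = 0}"
proof (cases "h constant_on UNIV")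
  case True
  then have "{z \<in> K. h z = 0} = {}"
    using w by (auto simp: constant_on_def)
  then show ?thesis by (metis finite.emptyI)
next
  case False
  then show ?thesis
    using holomorphic_compact_finite_zeros[OF h _ _ K] by auto
qed

lemma countable_zeros_entire:
  assumes h: "h holomorphic_on UNIV" and w: "h w \<noteq> 0"
  shows "countable {z. h z = 0}"
proof -
  have "{z. h z = 0} = (\<Union>i::nat. {z \<in> cball 0 (real i). h z = 0})"
    by (auto intro: real_arch_simple)
  moreover have "countable \<dots>"
    by (intro countable_UN countable_finite finite_zeros_entire[OF h w] countableI_type compact_cball)
  ultimately show ?thesis by simp
qed

lemma entire_divide_zero:
  assumes h: "h holomorphic_on UNIV" and w: "h w \<noteq> 0" and a: "h a = 0"
  obtains m g where "m > 0" "g holomorphic_on UNIV" "g a \<noteq> 0"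
    "\<And>z. h z = (z - a) ^ m * g z"
proof -
  define m where "m = nat (zorder h a)"
  define p where "p = zor_poly h a"
  have "(if h a = 0 then zorder h a > 0 else zorder h a = 0) \<and>
     (\<exists>r. r>0 \<and> cball a r \<subseteq> UNIV \<and> p holomorphic_on cball a r
        \<and> (\<forall>w\<in>cball a r. h w = p w * (w-a) ^ m \<and> p w \<noteq> 0))"
    unfolding m_def p_def by (rule zorder_exist_zero) (use h w in auto)
  then obtain r where m: "m > 0" and r: "r > 0" "p holomorphic_on cball a r"
      "\<And>w. w\<in>cball a r \<Longrightarrow> h w = p w * (w-a) ^ m \<and> p w \<noteq> 0"
    using a by (auto simp: m_def)
  define g where "g z = (if z = a then p a else h z / (z - a) ^ m)" for z
  have eq: "h z = (z - a) ^ m * g z" for z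
    using a m by (auto simp: g_def)
  have 1: "g holomorphic_on ball a r"
  proof (rule holomorphic_transform)
    show "p holomorphic_on ball a r"
      using r(2) ball_subset_cball by (rule holomorphic_on_subset)
    show "p z = g z" if "z \<in> ball a r" for z
      using r(3)[of z] that by (auto simp: g_def)
  qed
  have 2: "g holomorphic_on (UNIV - {a})"
  proof (rule holomorphic_transform)
    show "(\<lambda>z. h z / (z - a) ^ m) holomorphic_on (UNIV - {a})"
      by (intro holomorphic_intros entire_subset[OF h]) auto
  qed (auto simp: g_def)
  have "g holomorphic_on (ball a r \<union> (UNIV - {a}))"
    using 1 2 by (intro holomorphic_on_Un) auto
  moreover have "ball a r \<union> (UNIV - {a}) = UNIV"
    using r(1) by auto
  ultimately have "g holomorphic_on UNIV" by simp
  moreover have "g a \<noteq> 0"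
    using r(1) r(3)[of a] by (simp add: g_def)
  ultimately show ?thesis
    using that m eq by blast
qed

text \<open>Induction on the number of distinct zeros in the disc: dividing out a zero with its full
  multiplicity makes this number drop. The list \<open>as\<close> repeats each zero according to
  multiplicity.\<close>

lemma entire_divide_zeros_cball:
  assumes h: "h holomorphic_on UNIV" and w: "h w \<noteq> 0"
  shows "\<exists>as u. u holomorphic_on UNIV \<and> (\<forall>a\<in>set as. norm a \<le> R \<and> h a = 0) \<and>
    (\<forall>z\<in>cball 0 R. u z \<noteq> 0) \<and> (\<forall>z. h z = (\<Prod>a\<leftarrow>as. z - a) * u z)"
  using h w
proof (induction "card {z\<in>cball 0 R. h z = 0}" arbitrary: h rule: less_induct)
  case (less h)
  have fin: "finite {z\<in>cball 0 R. h z = 0}"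
    by (rule finite_zeros_entire[OF less.prems]) auto
  show ?case
  proof (cases "\<exists>a\<in>cball 0 R. h a = 0")
    case False
    then show ?thesis
      using less.prems by (intro exI[of _ "[]"] exI[of _ h]) auto
  next
    case True
    then obtain a where a: "a \<in> cball 0 R" "h a = 0" by blast
    obtain m g where g: "m > 0" "g holomorphic_on UNIV" "g a \<noteq> 0"
        "\<And>z. h z = (z - a) ^ m * g z"
      using entire_divide_zero[OF less.prems a(2)] by metis
    have gw: "g w \<noteq> 0" using g(4)[of w] less.prems by auto
    have "{z\<in>cball 0 R. g z = 0} \<subset> {z\<in>cball 0 R. h z = 0}"
      using a g by auto
    then have "card {z\<in>cball 0 R. g z = 0} < card {z\<in>cball 0 R. h z = 0}"
      using fin psubset_card_mono by blast
    from less.hyps[OF this g(2) gw]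
    obtain as u where u: "u holomorphic_on UNIV" "\<forall>a\<in>set as. norm a \<le> R \<and> g a = 0"
      "\<forall>z\<in>cball 0 R. u z \<noteq> 0" "\<forall>z. g z = (\<Prod>a\<leftarrow>as. z - a) * u z"
      by blast
    show ?thesis
      using u a g
      by (intro exI[of _ "replicate m a @ as"] exI[of _ u])
         (auto simp: prod_list_replicate map_replicate_const)
  qed
qed

section \<open>Blaschke factors\<close>

lemma norm_prod_list_mono:
  fixes f g :: "'a \<Rightarrow> complex"
  assumes "\<And>a. a \<in> set as \<Longrightarrow> norm (f a) \<le> norm (g a)"
  shows "norm (\<Prod>a\<leftarrow>as. f a) \<le> norm (\<Prod>a\<leftarrow>as. g a)"
  using assms by (induction as) (auto simp: norm_mult intro!: mult_mono)

lemma norm_prod_list_cong: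
  fixes f g :: "'a \<Rightarrow> complex"
  assumes "\<And>a. a \<in> set as \<Longrightarrow> norm (f a) = norm (g a)"
  shows "norm (\<Prod>a\<leftarrow>as. f a) = norm (\<Prod>a\<leftarrow>as. g a)"
  using assms by (induction as) (auto simp: norm_mult)

lemma holomorphic_on_prod_list [holomorphic_intros]:
  assumes "\<And>a. a \<in> set as \<Longrightarrow> f a holomorphic_on A"
  shows "(\<lambda>z. \<Prod>a\<leftarrow>as. f a z) holomorphic_on A"
  using assms by (induction as) (auto intro!: holomorphic_intros)

text \<open>The sign of the right-hand side decides everything about a Blaschke factor: it is
  nonnegative inside the disc of radius \<open>R\<close> and zero on the circle.\<close>

lemma blaschke_norm_diff:
  fixes a z :: complex
  shows "(norm (of_real R ^ 2 - cnj a * z))\<^sup>2 - (R * norm (z - a))\<^sup>2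
     = (R^2 - (norm a)^2) * (R^2 - (norm z)^2)"
proof -
  have "(R^2 - (p * x + q * y))^2 + (q * x - p * y)^2 - R^2 * ((x - p)^2 + (y - q)^2)
      = (R^2 - (p^2 + q^2)) * (R^2 - (x^2 + y^2))" for p q x y :: real
    by algebra
  from this[of "Re a" "Re z" "Im a" "Im z"] show ?thesis
    unfolding power_mult_distrib cmod_power2 by (simp add: power2_commute flip: of_real_power)
qed

lemma blaschke_le:
  fixes a z :: complex
  assumes "norm a \<le> R" "norm z \<le> R"
  shows "R * norm (z - a) \<le> norm (of_real R ^ 2 - cnj a * z)"
proof -
  have "0 \<le> (R^2 - (norm a)^2) * (R^2 - (norm z)^2)"
    using assms by (intro mult_nonneg_nonneg) (auto intro!: power_mono)
  then have "(R * norm (z - a))\<^sup>2 \<le> (norm (of_real R ^ 2 - cnj a * z))\<^sup>2"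
    using blaschke_norm_diff[of R a z] by linarith
  then show ?thesis by (rule power2_le_imp_le) auto
qed

lemma blaschke_eq:
  fixes a z :: complex
  assumes "norm z = R"
  shows "R * norm (z - a) = norm (of_real R ^ 2 - cnj a * z)"
proof -
  have "(R * norm (z - a))\<^sup>2 = (norm (of_real R ^ 2 - cnj a * z))\<^sup>2"
    using blaschke_norm_diff[of R a z] assms by simp
  then show ?thesis
    using assms by (metis norm_ge_zero mult_nonneg_nonneg power2_eq_imp_eq)
qed

lemma blaschke_denominator_nonzero:
  fixes a z :: complex
  assumes "norm a < R" "norm z \<le> R"
  shows "of_real R ^ 2 - cnj a * z \<noteq> 0"
proof
  assume "of_real R ^ 2 - cnj a * z = 0"
  then have "norm (of_real R ^ 2 :: complex) = norm (cnj a * z)" by simp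
  then have "R^2 = norm a * norm z" by (simp add: norm_mult norm_power)
  moreover have "norm a * norm z < R * R"
    using assms by (smt (verit) mult_strict_right_mono mult_left_mono norm_ge_zero)
  ultimately show False by (simp add: power2_eq_square)
qed

text \<open>The zeros in \<open>|z| \<le> R\<close> are traded for their reflections in the circle
  of the possibly larger radius \<open>R'\<close>. The result \<open>v\<close> is zero-free in the
  smaller disc, dominates \<open>h\<close> in the larger one and has the same modulus on its
  boundary. Equal radii serve the Poisson-Jensen inequality, distinct radii the lemma on the
  logarithmic derivative.\<close>

lemma blaschke_decomposition:
  assumes h: "h holomorphic_on UNIV" and w: "h w \<noteq> 0" and R: "0 < R'"
    and lt: "\<And>a. norm a \<le> R \<Longrightarrow> h a = 0 \<Longrightarrow> norm a < R'" and le: "R \<le> R'"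
  obtains as u v where "u holomorphic_on UNIV" "v holomorphic_on UNIV"
    "\<And>a. a \<in> set as \<Longrightarrow> norm a \<le> R \<and> norm a < R' \<and> h a = 0"
    "\<And>z. norm z \<le> R \<Longrightarrow> v z \<noteq> 0"
    "\<And>z. h z = (\<Prod>a\<leftarrow>as. z - a) * u z"
    "\<And>z. v z = (\<Prod>a\<leftarrow>as. (of_real R' ^ 2 - cnj a * z) / of_real R') * u z"
    "\<And>z. norm z = R' \<Longrightarrow> norm (v z) = norm (h z)"
    "\<And>z. norm z \<le> R' \<Longrightarrow> norm (h z) \<le> norm (v z)"
proof -
  obtain as u where u: "u holomorphic_on UNIV" "\<forall>a\<in>set as. norm a \<le> R \<and> h a = 0"
     "\<forall>z\<in>cball 0 R. u z \<noteq> 0" "\<forall>z. h z = (\<Prod>a\<leftarrow>as. z - a) * u z"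
    using entire_divide_zeros_cball[OF h w] by blast
  define v where "v z = (\<Prod>a\<leftarrow>as. (of_real R' ^ 2 - cnj a * z) / of_real R') * u z" for z
  have as: "norm a \<le> R \<and> norm a < R' \<and> h a = 0" if "a \<in> set as" for a
    using that u(2) lt by auto
  show ?thesis
  proof (rule that[of u v as])
    show "v holomorphic_on UNIV"
      unfolding v_def using R by (intro holomorphic_intros u) auto
    show "v z \<noteq> 0" if "norm z \<le> R" for z
    proof -
      have "of_real R' ^ 2 - cnj a * z \<noteq> 0" if "a \<in> set as" for a
        using blaschke_denominator_nonzero[of a R' z] as[OF that] \<open>norm z \<le> R\<close> le by auto
      then show ?thesis
        using u(3) that R by (auto simp: v_def prod_list_zero_iff)
    qed
    show "norm (v z) = norm (h z)" if "norm z = R'" for z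
    proof -
      have "norm (\<Prod>a\<leftarrow>as. (of_real R' ^ 2 - cnj a * z) / of_real R') = norm (\<Prod>a\<leftarrow>as. z - a)"
        using R by (intro norm_prod_list_cong)
          (simp add: norm_divide blaschke_eq[OF that, symmetric])
      then show ?thesis using u(4) by (simp add: v_def norm_mult)
    qed
    show "norm (h z) \<le> norm (v z)" if "norm z \<le> R'" for z
    proof -
      have "norm (\<Prod>a\<leftarrow>as. z - a) \<le> norm (\<Prod>a\<leftarrow>as. (of_real R' ^ 2 - cnj a * z) / of_real R')"
      proof (rule norm_prod_list_mono)
        fix a assume "a \<in> set as"
        then have "norm a \<le> R'" using as less_imp_le by blast
        from blaschke_le[OF this that] show "norm (z - a) \<le> norm ((of_real R' ^ 2 - cnj a * z) / of_real R')"
          using R by (simp add: norm_divide field_simps)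
      qed
      then show ?thesis using u(4) by (simp add: v_def norm_mult mult_right_mono)
    qed
  qed (use u as v_def in auto)
qed

section \<open>Poisson's formula on circles\<close>

lemma norm_circlepath [simp]: "r \<ge> 0 \<Longrightarrow> norm (circlepath 0 r t) = r"
  by (simp add: circlepath norm_mult)

lemma continuous_on_circlepath_param: "continuous_on A (\<lambda>t. circlepath 0 r t)"
  by (simp add: circlepath) (intro continuous_intros)

lemma poisson_integral_formula:
  assumes l: "l holomorphic_on cball 0 R" and z: "norm z < R"
  shows "((\<lambda>t. of_real ((R^2 - (norm z)^2) / (norm (circlepath 0 R t - z))^2) * l (circlepath 0 R t))
           has_integral l z) {0..1}"
proof -
  \<comment> \<open>On the circle, \<open>R\<^sup>2 - cnj z * w = w * cnj (w - z)\<close>, so Cauchy's formula for \<open>k\<close> has the Poisson kernel.\<close>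
  define k where "k w = l w * (of_real (R^2 - (norm z)^2) / (of_real R ^ 2 - cnj z * w))" for w
  have nz: "of_real R ^ 2 - cnj z * w \<noteq> 0" if "w \<in> cball 0 R" for w
    using blaschke_denominator_nonzero[OF z] that by auto
  have R: "R > 0" using z norm_ge_zero[of z] by linarith
  have "k holomorphic_on cball 0 R"
    unfolding k_def by (intro holomorphic_intros l nz)
  then have "((\<lambda>u. k u/(u-z)) has_contour_integral (2 * of_real pi * \<i> * k z)) (circlepath 0 R)"
    by (rule Cauchy_integral_circlepath_simple) (use z in auto)
  moreover have "k z = l z"
  proof -
    have "(of_real R ^ 2 :: complex) - cnj z * z = of_real (R^2 - (norm z)^2)"
      by (simp add: mult.commute flip: complex_norm_square)
    then show ?thesis using nz[of z] z by (simp add: k_def)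
  qed
  ultimately have "((\<lambda>u. k u/(u-z)) has_contour_integral (2 * of_real pi * \<i> * l z)) (circlepath 0 R)"
    by simp
  then have "((\<lambda>t. k (circlepath 0 R t)/(circlepath 0 R t-z) * vector_derivative (circlepath 0 R) (at t within {0..1}))
     has_integral (2 * of_real pi * \<i> * l z)) {0..1}"
    by (simp add: has_contour_integral_def)
  from has_integral_mult_right[OF this, of "1 / (2 * of_real pi * \<i>)"]
  have 1: "((\<lambda>t. 1 / (2 * of_real pi * \<i>) * (k (circlepath 0 R t)/(circlepath 0 R t-z) *
      vector_derivative (circlepath 0 R) (at t within {0..1})))
     has_integral l z) {0..1}"
    by simp
  show ?thesis
  proof (rule has_integral_eq[OF _ 1])
    fix t :: real assume t: "t \<in> {0..1}"
    define w where "w = circlepath 0 R t"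
    have nw: "norm w = R" using R by (simp add: w_def)
    have "vector_derivative (circlepath 0 R) (at t within {0..1}) = 2 * of_real pi * \<i> * w"
      using t vector_derivative_circlepath01[of t 0 R] by (simp add: w_def) (simp add: circlepath)
    moreover have "1 / (2 * of_real pi * \<i>) * (k w/(w-z) * (2 * of_real pi * \<i> * w)) = k w * w / (w - z)"
      by (simp add: field_simps)
    moreover have "k w * w / (w - z) = of_real ((R^2 - (norm z)^2) / (norm (w - z))^2) * l w"
    proof -
      have w0: "w \<noteq> 0" using nw R by auto
      have wz: "w - z \<noteq> 0" using nw z by auto
      have e: "of_real R ^ 2 - cnj z * w = w * cnj (w - z)"
        using nw complex_norm_square[of w] by (simp add: algebra_simps)
      have "k w * w / (w - z) = l w * of_real (R^2 - (norm z)^2) * w / (w * cnj (w - z) * (w - z))"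
        unfolding k_def e by simp
      also have "\<dots> = l w * of_real (R^2 - (norm z)^2) / (cnj (w - z) * (w - z))"
        using w0 by simp
      also have "cnj (w - z) * (w - z) = of_real ((norm (w - z))^2)"
        by (metis complex_norm_square mult.commute)
      finally show ?thesis by simp
    qed
    ultimately show "1 / (2 * of_real pi * \<i>) * (k (circlepath 0 R t)/(circlepath 0 R t-z) *
      vector_derivative (circlepath 0 R) (at t within {0..1}))
      = of_real ((R^2 - (norm z)^2) / (norm (circlepath 0 R t - z))^2) * l (circlepath 0 R t)"
      by (simp add: w_def)
  qed
qed

lemma nonzero_cball_extend:
  assumes v: "v holomorphic_on UNIV" and nz: "\<And>z. norm z \<le> R \<Longrightarrow> v z \<noteq> 0" and R: "R > 0"
  obtains l where "l holomorphic_on cball 0 R" "\<And>z. norm z \<le> R \<Longrightarrow> v z = exp (l z)"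
proof -
  have "contractible (cball 0 R :: complex set)"
    by (intro convex_imp_contractible) auto
  from contractible_imp_holomorphic_log[OF entire_subset[OF v] this]
  show ?thesis using that nz by (metis mem_cball_0)
qed

text \<open>Dividing out Blaschke factors gives a zero-free \<open>v = exp l\<close> with
  \<open>|v| = |h|\<close> on the circle. Poisson's formula for \<open>Re l = ln |v|\<close> then
  has boundary values \<open>ln |h|\<close>, and \<open>|h z| \<le> |v z|\<close> discards the
  contribution of the zeros.\<close>

lemma poisson_jensen_inequality:
  assumes h: "h holomorphic_on UNIV" and nz: "\<And>w. norm w = R \<Longrightarrow> h w \<noteq> 0"
    and z: "norm z < R" and hz: "h z \<noteq> 0"
  shows "ln (norm (h z)) \<le> integral {0..1}
     (\<lambda>t. (R^2 - (norm z)^2) / (norm (circlepath 0 R t - z))^2 * ln (norm (h (circlepath 0 R t))))"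
proof -
  have R: "R > 0" using z norm_ge_zero[of z] by linarith
  have lt: "norm a < R" if "norm a \<le> R" "h a = 0" for a
    using nz that by force
  obtain as u v where v: "v holomorphic_on UNIV"
    "\<And>z. norm z \<le> R \<Longrightarrow> v z \<noteq> 0"
    "\<And>z. norm z = R \<Longrightarrow> norm (v z) = norm (h z)"
    "\<And>z. norm z \<le> R \<Longrightarrow> norm (h z) \<le> norm (v z)"
    using blaschke_decomposition[OF h hz R lt order_refl] by metis
  obtain l where l: "l holomorphic_on cball 0 R" "\<And>z. norm z \<le> R \<Longrightarrow> v z = exp (l z)"
    using nonzero_cball_extend[OF v(1,2) R] by metis
  have "((\<lambda>t. Re (of_real ((R^2 - (norm z)^2) / (norm (circlepath 0 R t - z))^2) * l (circlepath 0 R t)))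
           has_integral Re (l z)) {0..1}"
    using has_integral_linear[OF poisson_integral_formula[OF l(1) z] bounded_linear_Re] by (simp add: o_def)
  moreover have "Re (of_real ((R^2 - (norm z)^2) / (norm (circlepath 0 R t - z))^2) * l (circlepath 0 R t))
     = (R^2 - (norm z)^2) / (norm (circlepath 0 R t - z))^2 * ln (norm (h (circlepath 0 R t)))" for t
  proof -
    have "norm (h (circlepath 0 R t)) = exp (Re (l (circlepath 0 R t)))"
      using v(3)[of "circlepath 0 R t"] l(2)[of "circlepath 0 R t"] R by simp
    then show ?thesis by (simp del: times_divide_eq_left)
  qed
  ultimately have "((\<lambda>t. (R^2 - (norm z)^2) / (norm (circlepath 0 R t - z))^2 * ln (norm (h (circlepath 0 R t))))
      has_integral Re (l z)) {0..1}" by (simp only:)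
  then have "integral {0..1} (\<lambda>t. (R^2 - (norm z)^2) / (norm (circlepath 0 R t - z))^2 * ln (norm (h (circlepath 0 R t))))
     = Re (l z)" by (rule integral_unique)
  moreover have "norm (h z) \<le> exp (Re (l z))"
    using v(4)[of z] l(2)[of z] z by simp
  then have "ln (norm (h z)) \<le> Re (l z)"
    using hz by (metis exp_gt_zero ln_exp ln_le_cancel_iff zero_less_norm_iff)
  ultimately show ?thesis by simp
qed

section \<open>The lemma on the logarithmic derivative\<close>

text \<open>A form of the Borel-Caratheodory theorem. The Cayley transform \<open>q\<close> carries
  the left half-plane to the unit disc and \<open>p 0 = -k\<close> to 0, so the Schwarz lemma bounds
  \<open>q\<close>; solving for \<open>p\<close> gives the estimate.\<close>

lemma neg_real_part_growth:
  assumes p: "p holomorphic_on ball 0 R" and neg: "\<And>z. norm z < R \<Longrightarrow> Re (p z) < 0"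
    and p0: "p 0 = - of_real k" and z: "norm z < R"
  shows "norm (p z) * (R - norm z) \<le> k * (R + norm z)"
proof -
  have R: "R > 0" using z norm_ge_zero[of z] by linarith
  have k: "k > 0" using neg[of 0] p0 R by simp
  define q where "q x = (p (of_real R * x) + of_real k) / (p (of_real R * x) - of_real k)" for x
  have inb: "norm (of_real R * x) < R" if "norm x < 1" for x :: complex
    using that R by (simp add: norm_mult)
  have nz: "p (of_real R * x) - of_real k \<noteq> 0" if "norm x < 1" for x
    using neg[OF inb[OF that]] k by (auto simp: complex_eq_iff)
  have "(\<lambda>x. p (of_real R * x)) holomorphic_on ball 0 1"
    by (intro holomorphic_on_compose_gen[OF _ p, unfolded o_def] holomorphic_intros) (use inb in auto)
  then have hol: "q holomorphic_on ball 0 1"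
    unfolding q_def by (intro holomorphic_intros) (use nz in auto)
  have q0: "q 0 = 0" by (simp add: q_def p0)
  have q1: "norm (q x) < 1" if "norm x < 1" for x
  proof -
    let ?w = "p (of_real R * x)"
    have "(norm (?w + of_real k))^2 - (norm (?w - of_real k))^2 = 4 * k * Re ?w"
      unfolding cmod_power2 by (simp add: power2_eq_square algebra_simps)
    moreover have "4 * k * Re ?w < 0"
      using neg[OF inb[OF that]] k by (simp add: mult_pos_neg)
    ultimately have "(norm (?w + of_real k))^2 < (norm (?w - of_real k))^2" by linarith
    then have "norm (?w + of_real k) < norm (?w - of_real k)"
      by (rule power2_less_imp_less) auto
    then show ?thesis
      unfolding q_def norm_divide using nz[OF that] by (subst divide_less_eq_1_pos) auto
  qed
  define x where "x = z / of_real R"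
  have x: "norm x < 1" "of_real R * x = z" using z R by (auto simp: x_def norm_divide)
  have qx: "norm (q x) \<le> norm x"
    by (rule Schwarz_Lemma(1)[OF hol q0 q1 x(1)])
  have "p z * (1 - q x) = - of_real k * (1 + q x)"
    using nz[OF x(1)] unfolding q_def x(2) by (simp add: field_simps)
  then have "norm (p z) * norm (1 - q x) = k * norm (1 + q x)"
    using k by (metis norm_mult norm_minus_cancel norm_of_real abs_of_pos)
  moreover have "1 - norm x \<le> norm (1 - q x)"
    using qx norm_triangle_ineq2[of 1 "q x"] by simp
  moreover have "norm (1 + q x) \<le> 1 + norm x"
    using qx norm_triangle_ineq[of 1 "q x"] by simp
  ultimately have "norm (p z) * (1 - norm x) \<le> k * (1 + norm x)"
    using k by (smt (verit) mult_left_mono norm_ge_zero)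
  moreover have "norm x = norm z / R" using R by (simp add: x_def norm_divide)
  ultimately have "norm (p z) * (1 - norm z / R) * R \<le> k * (1 + norm z / R) * R"
    using R by (intro mult_right_mono) auto
  moreover have "(1 - norm z / R) * R = R - norm z" "(1 + norm z / R) * R = R + norm z"
    using R by (simp_all add: field_simps)
  ultimately show ?thesis by (simp only: mult.assoc)
qed

text \<open>Since \<open>v = exp l\<close>, the quotient is \<open>l'\<close>. The real part of
  \<open>l\<close> is bounded above, so the half-plane bound controls \<open>l\<close> up to a
  constant on a circle of radius \<open>(R - r) / 2\<close> about \<open>z\<close>, and Cauchy's
  estimate controls \<open>l'\<close>.\<close>

lemma log_deriv_zero_free_bound:
  assumes v: "v holomorphic_on UNIV" and nz: "\<And>z. norm z \<le> R \<Longrightarrow> v z \<noteq> 0"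
    and M: "\<And>z. norm z \<le> R \<Longrightarrow> norm (v z) \<le> exp B"
    and z: "norm z \<le> r" and r: "r < R"
  shows "norm (deriv v z / v z) \<le> 8 * (B + 1 - ln (norm (v 0))) * R / (R - r)^2"
proof -
  have R: "R > 0" using z r norm_ge_zero[of z] by linarith
  obtain l where l: "l holomorphic_on cball 0 R" "\<And>z. norm z \<le> R \<Longrightarrow> v z = exp (l z)"
    using nonzero_cball_extend[OF v nz R] by metis
  have lb: "l holomorphic_on ball 0 R"
    using l(1) ball_subset_cball by (rule holomorphic_on_subset)
  define k where "k = B + 1 - ln (norm (v 0))"
  \<comment> \<open>Subtracting the imaginary part at 0 makes \<open>p 0\<close> real;
    \<open>B + 1\<close> in place of \<open>B\<close> makes the real part strictly negative.\<close>
  define p where "p w = l w - \<i> * of_real (Im (l 0)) - of_real (B + 1)" for w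
  have ph: "p holomorphic_on ball 0 R"
    unfolding p_def by (intro holomorphic_intros lb)
  have lv: "ln (norm (v w)) = Re (l w)" if "norm w \<le> R" for w
    using l(2)[OF that] by simp
  have neg: "Re (p w) < 0" if "norm w < R" for w
  proof -
    have "exp (Re (l w)) \<le> exp B"
      using M[of w] l(2)[of w] that by simp
    then show ?thesis by (simp add: p_def)
  qed
  have p0: "p 0 = - of_real k"
    using lv[of 0] R by (simp add: p_def k_def complex_eq_iff)
  have k: "k > 0" using neg[of 0] p0 R by simp
  define d where "d = (R - r) / 2"
  have d: "d > 0" using r by (simp add: d_def)
  have pb: "norm (p w) \<le> 4 * k * R / (R - r)" if "norm (z - w) = d" for w
  proof -
    have "norm w \<le> norm z + norm (z - w)"
      using norm_triangle_ineq4[of z "z - w"] by simp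
    then have w: "norm w \<le> r + d" using z that by linarith
    have rd: "r + d < R" "R - (r + d) = (R - r) / 2" using r by (auto simp: d_def field_simps)
    have "norm (p w) * ((R - r) / 2) \<le> norm (p w) * (R - norm w)"
      using w rd by (intro mult_left_mono) auto
    also have "\<dots> \<le> k * (R + norm w)"
      using w rd by (intro neg_real_part_growth[OF ph neg p0]) auto
    also have "\<dots> \<le> k * (2 * R)"
      using w rd k by (intro mult_left_mono) auto
    finally show ?thesis using r by (simp add: field_simps)
  qed
  have cb: "cball z d \<subseteq> ball 0 R"
  proof
    fix w assume "w \<in> cball z d"
    then have "norm (z - w) \<le> d" by (simp add: dist_norm)
    moreover have "norm w \<le> norm z + norm (z - w)"
      using norm_triangle_ineq4[of z "z - w"] by simp
    ultimately show "w \<in> ball 0 R" using z r by (simp add: d_def field_simps)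
  qed
  have "norm ((deriv ^^ 1) p z) \<le> fact 1 * (4 * k * R / (R - r)) / d ^ 1"
  proof (rule Cauchy_inequality)
    show "p holomorphic_on ball z d"
      using ph cb ball_subset_cball by (meson holomorphic_on_subset order_trans)
    show "continuous_on (cball z d) p"
      using ph cb by (meson holomorphic_on_subset holomorphic_on_imp_continuous_on)
  qed (use d pb in auto)
  then have 1: "norm (deriv p z) \<le> 8 * k * R / (R - r)^2"
    using r by (simp add: d_def power2_eq_square)
  have zb: "z \<in> ball 0 R" using z r by auto
  have "(p has_field_derivative deriv p z) (at z)"
    using ph zb holomorphic_derivI open_ball by blast
  then have "((\<lambda>w. exp (p w + (\<i> * of_real (Im (l 0)) + of_real (B + 1)))) has_field_derivative
      exp (p z + (\<i> * of_real (Im (l 0)) + of_real (B + 1))) * deriv p z) (at z)"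
    by (auto intro!: derivative_eq_intros)
  moreover have "\<forall>\<^sub>F w in nhds z. exp (p w + (\<i> * of_real (Im (l 0)) + of_real (B + 1))) = v w"
  proof -
    have "\<forall>\<^sub>F w in nhds z. w \<in> ball 0 R"
      using zb by (intro eventually_nhds_in_open) auto
    then show ?thesis by eventually_elim (auto simp: p_def l(2))
  qed
  ultimately have "(v has_field_derivative v z * deriv p z) (at z)"
    using l(2)[of z] zb
    by (subst (asm) DERIV_cong_ev[OF refl _ refl, where g = v]) (auto simp: p_def)
  then have "deriv v z = v z * deriv p z"
    by (rule DERIV_imp_deriv)
  then have "deriv v z / v z = deriv p z"
    using nz[of z] z r by simp
  then show ?thesis using 1 by (simp add: k_def)
qed

text \<open>\<open>sqrt\<close> is odd on the reals here, \<open>sqrt (-x) = - sqrt x\<close>, so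
  \<open>2 * sqrt (t - b)\<close> is a single continuous antiderivative on both sides of
  \<open>b\<close>. This covers every position of \<open>b\<close>, also outside the
  interval.\<close>

lemma has_integral_inverse_sqrt_dist:
  "((\<lambda>t. 1 / sqrt \<bar>t - b\<bar>) has_integral (2 * sqrt (1 - b) - 2 * sqrt (0 - b))) {0..1}"
proof (rule fundamental_theorem_of_calculus_interior_strong[of "{b}"])
  fix x :: real assume x: "x \<in> {0<..<1} - {b}"
  then have "DERIV sqrt (x - b) :> 1 / (2 * sqrt \<bar>x - b\<bar>)"
    by (intro DERIV_real_sqrt_generic) (auto simp: field_simps real_sqrt_minus[symmetric])
  then have "((\<lambda>t. 2 * sqrt (t - b)) has_real_derivative 2 * (1 / (2 * sqrt \<bar>x - b\<bar>) * 1)) (at x)"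
    by (intro DERIV_cmult DERIV_chain2[where f = sqrt]) (auto intro!: derivative_eq_intros)
  then show "((\<lambda>t. 2 * sqrt (t - b)) has_vector_derivative 1 / sqrt \<bar>x - b\<bar>) (at x)"
    by (simp add: has_real_derivative_iff_has_vector_derivative)
qed (auto intro!: continuous_intros)

text \<open>Taylor's formula gives \<open>sin x \<ge> x - x^3 / 6\<close>, and
  \<open>x^2 \<le> 4\<close> on this range; this weak form of Jordan's inequality suffices.\<close>

lemma sin_ge_third:
  assumes "0 \<le> x" "x \<le> pi / 2"
  shows "x / 3 \<le> sin x"
proof -
  have "\<bar>sin x - (\<Sum>m<3. sin_coeff m * x ^ m)\<bar> \<le> inverse (fact 3) * \<bar>x\<bar> ^ 3"
    by (rule Maclaurin_sin_bound)
  then have "\<bar>sin x - x\<bar> \<le> x ^ 3 / 6"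
    using assms by (simp add: sin_coeff_def eval_nat_numeral)
  moreover have "x ^ 3 \<le> 4 * x"
  proof -
    have "x * x \<le> 2 * 2" using assms pi_less_4 by (intro mult_mono) auto
    then have "x * x * x \<le> 2 * 2 * x" using assms by (intro mult_right_mono) auto
    then show ?thesis by (simp add: power3_eq_cube)
  qed
  ultimately show ?thesis by linarith
qed

text \<open>Here \<open>s\<close> is an angle in turns. Up to a quarter turn the imaginary part
  alone is large enough; beyond it the cosine is nonpositive, so the distance is at least
  \<open>r\<close>, hence at least 1. The bound is uniform in \<open>\<rho>\<close>, as is needed
  for zeros at arbitrary distance from the circle.\<close>

lemma norm_circle_diff_ge:
  assumes r: "r \<ge> 1" and s: "\<bar>s\<bar> \<le> 1/2" and \<rho>: "\<rho> \<ge> 0"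
  shows "\<bar>s\<bar> \<le> norm (of_real r * exp (2 * of_real pi * \<i> * of_real s) - of_real \<rho>)" (is "_ \<le> norm ?w")
proof (cases "\<bar>s\<bar> \<le> 1/4")
  case True
  have "\<bar>s\<bar> \<le> 2 * pi * \<bar>s\<bar> / 3"
    using mult_right_mono[of 3 "2 * pi" "\<bar>s\<bar>"] pi_gt3 by simp
  also have "\<dots> \<le> sin (2 * pi * \<bar>s\<bar>)"
    using True pi_gt_zero by (intro sin_ge_third) (auto simp: field_simps)
  also have "\<dots> \<le> \<bar>sin (2 * pi * s)\<bar>"
    by (cases "s \<ge> 0") auto
  also have "\<dots> \<le> r * \<bar>sin (2 * pi * s)\<bar>"
    using r by (simp add: mult_le_cancel_right1)
  also have "\<dots> = \<bar>Im ?w\<bar>"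
    using r by (simp add: Im_exp abs_mult)
  also have "\<dots> \<le> norm ?w" by (rule abs_Im_le_cmod)
  finally show ?thesis .
next
  case False
  have "cos (2 * pi * \<bar>s\<bar>) \<le> 0"
  proof -
    have "cos (2 * pi * \<bar>s\<bar> - pi) \<ge> 0"
      using False s pi_gt_zero by (intro cos_ge_zero) (auto simp: field_simps)
    then show ?thesis by simp
  qed
  then have "cos (2 * pi * s) \<le> 0" by (cases "s \<ge> 0") auto
  then have c: "\<rho> * r * cos (2 * pi * s) \<le> 0"
    using \<rho> r by (simp add: mult_nonneg_nonpos)
  have "(norm ?w)^2 = (r * cos (2 * pi * s) - \<rho>)^2 + (r * sin (2 * pi * s))^2"
    unfolding cmod_power2 by (simp add: Re_exp Im_exp)
  also have "\<dots> = r^2 * ((sin (2 * pi * s))^2 + (cos (2 * pi * s))^2) + \<rho>^2 - 2 * (\<rho> * r * cos (2 * pi * s))"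
    by algebra
  also have "\<dots> = r^2 + \<rho>^2 - 2 * (\<rho> * r * cos (2 * pi * s))" by (simp only: sin_cos_squared_add mult_1_right)
  finally have "1^2 \<le> (norm ?w)^2"
    using c one_le_power[OF r, of 2] zero_le_power2[of \<rho>] unfolding one_power2 by linarith
  then have "1 \<le> norm ?w" by (rule power2_le_imp_le) auto
  then show ?thesis using s by simp
qed

text \<open>\<open>b\<close> is the argument of \<open>a\<close> in turns. The shifts
  \<open>b - 1\<close> and \<open>b + 1\<close> account for the wrap-around, since one of the three
  differences is at most 1/2 in absolute value. The three points are left out because there division
  by zero makes a term on the right 0.\<close>

lemma inverse_sqrt_circle_bound:
  fixes a :: complex
  assumes r: "r \<ge> 1"
  obtains b where "0 \<le> b" "b \<le> 1" "\<And>t. t \<in> {0..1} - {b, b - 1, b + 1} \<Longrightarrow>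
    1 / sqrt (norm (circlepath 0 r t - a)) \<le> 1 / sqrt \<bar>t - b\<bar> + 1 / sqrt \<bar>t - (b - 1)\<bar> + 1 / sqrt \<bar>t - (b + 1)\<bar>"
proof -
  define b where "b = Arg2pi a / (2 * pi)"
  have b: "0 \<le> b" "b \<le> 1"
    using Arg2pi_ge_0[of a] Arg2pi_lt_2pi[of a] by (auto simp: b_def field_simps)
  have a: "a = of_real (norm a) * exp (2 * of_real pi * \<i> * of_real b)"
    using Arg2pi_eq[of a] by (simp add: b_def mult.commute)
  have shift: "norm (circlepath 0 r t - a) = norm (of_real r * exp (2 * of_real pi * \<i> * of_real (t - b)) - of_real (norm a))" for t
  proof -
    have "circlepath 0 r t - a = exp (2 * of_real pi * \<i> * of_real b) *
       (of_real r * exp (2 * of_real pi * \<i> * of_real (t - b)) - of_real (norm a))"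
      by (subst a) (simp add: circlepath algebra_simps flip: exp_add)
    then show ?thesis by (simp add: norm_mult)
  qed
  have per: "exp (2 * of_real pi * \<i> * of_real (s + 1)) = exp (2 * of_real pi * \<i> * of_real s)" 
            "exp (2 * of_real pi * \<i> * of_real (s - 1)) = exp (2 * of_real pi * \<i> * of_real s)" for s
    by (simp_all add: ring_distribs exp_add exp_diff exp_two_pi_i exp_two_pi_i')
  show ?thesis
  proof (rule that[OF b])
    fix t assume t: "t \<in> {0..1} - {b, b - 1, b + 1}"
    have ge: "\<bar>s\<bar> \<le> norm (circlepath 0 r t - a)" 
      if "\<bar>s\<bar> \<le> 1/2" "s = t - b \<or> s = t - (b - 1) \<or> s = t - (b + 1)" for s
    proof -
      have "exp (2 * of_real pi * \<i> * of_real s) = exp (2 * of_real pi * \<i> * of_real (t - b))"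
        using that(2) per[of "t - b"] by (elim disjE) (auto simp: diff_diff_eq2 diff_add_eq diff_diff_eq)
      then show ?thesis
        using norm_circle_diff_ge[OF r that(1), of "norm a"] by (simp add: shift)
    qed
    have le: "1 / sqrt (norm (circlepath 0 r t - a)) \<le> 1 / sqrt \<bar>s\<bar>"
      if "\<bar>s\<bar> \<le> 1/2" "s = t - b \<or> s = t - (b - 1) \<or> s = t - (b + 1)" "s \<noteq> 0" for s
    proof -
      have "0 < \<bar>s\<bar>" using that(3) by simp
      then show ?thesis
        using ge[OF that(1,2)] by (intro divide_left_mono mult_pos_pos real_sqrt_le_mono) auto
    qed
    consider "\<bar>t - b\<bar> \<le> 1/2" | "\<bar>t - (b - 1)\<bar> \<le> 1/2" | "\<bar>t - (b + 1)\<bar> \<le> 1/2"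
      using t b unfolding abs_le_iff by (smt (verit) DiffD1 atLeastAtMost_iff field_sum_of_halves)
    then show "1 / sqrt (norm (circlepath 0 r t - a)) \<le> 1 / sqrt \<bar>t - b\<bar> + 1 / sqrt \<bar>t - (b - 1)\<bar> + 1 / sqrt \<bar>t - (b + 1)\<bar>"
    proof cases
      case 1
      then have "1 / sqrt (norm (circlepath 0 r t - a)) \<le> 1 / sqrt \<bar>t - b\<bar>" using t by (intro le) auto
      then show ?thesis by (smt (verit) divide_nonneg_nonneg real_sqrt_ge_zero abs_ge_zero)
    next
      case 2
      then have "1 / sqrt (norm (circlepath 0 r t - a)) \<le> 1 / sqrt \<bar>t - (b - 1)\<bar>" using t by (intro le) auto
      then show ?thesis by (smt (verit) divide_nonneg_nonneg real_sqrt_ge_zero abs_ge_zero)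
    next
      case 3
      then have "1 / sqrt (norm (circlepath 0 r t - a)) \<le> 1 / sqrt \<bar>t - (b + 1)\<bar>" using t by (intro le) auto
      then show ?thesis by (smt (verit) divide_nonneg_nonneg real_sqrt_ge_zero abs_ge_zero)
    qed
  qed
qed

lemma integral_inverse_sqrt_circle:
  fixes a :: complex
  assumes r: "r \<ge> 1" and a: "norm a \<noteq> r"
  shows "(\<lambda>t. 1 / sqrt (norm (circlepath 0 r t - a))) integrable_on {0..1}"
    and "integral {0..1} (\<lambda>t. 1 / sqrt (norm (circlepath 0 r t - a))) \<le> 24"
proof -
  let ?f = "\<lambda>t. 1 / sqrt (norm (circlepath 0 r t - a))"
  have "circlepath 0 r t - a \<noteq> 0" for t
    using a r norm_circlepath[of r t] by auto
  then have cont: "continuous_on {0..1} ?f"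
    by (intro continuous_intros continuous_on_circlepath_param) auto
  then show int: "?f integrable_on {0..1}" by (rule integrable_continuous_real)
  obtain b where b: "0 \<le> b" "b \<le> 1" and le: "\<And>t. t \<in> {0..1} - {b, b - 1, b + 1} \<Longrightarrow>
    ?f t \<le> 1 / sqrt \<bar>t - b\<bar> + 1 / sqrt \<bar>t - (b - 1)\<bar> + 1 / sqrt \<bar>t - (b + 1)\<bar>"
    using inverse_sqrt_circle_bound[OF r] by metis
  let ?I = "(2 * sqrt (1 - b) - 2 * sqrt (0 - b)) + (2 * sqrt (1 - (b - 1)) - 2 * sqrt (0 - (b - 1)))
     + (2 * sqrt (1 - (b + 1)) - 2 * sqrt (0 - (b + 1)))"
  have I: "((\<lambda>t. 1 / sqrt \<bar>t - b\<bar> + 1 / sqrt \<bar>t - (b - 1)\<bar> + 1 / sqrt \<bar>t - (b + 1)\<bar>)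
     has_integral ?I) {0..1}"
    by (intro has_integral_add has_integral_inverse_sqrt_dist)
  \<comment> \<open>Changing the integrand at the three exceptional points does not affect the
    integral and makes the pointwise bound valid on the whole interval.\<close>
  let ?g = "\<lambda>t. if t \<in> {b, b - 1, b + 1} then 0 else ?f t"
  have "(?g has_integral integral {0..1} ?f) {0..1}"
    by (rule has_integral_spike_finite[of "{b, b - 1, b + 1}" _ _ ?f]) (use int in auto)
  moreover have "?g t \<le> 1 / sqrt \<bar>t - b\<bar> + 1 / sqrt \<bar>t - (b - 1)\<bar> + 1 / sqrt \<bar>t - (b + 1)\<bar>" 
    if "t \<in> {0..1}" for t
    using le[of t] that by (auto intro!: add_nonneg_nonneg)
  ultimately have "integral {0..1} ?f \<le> ?I"
    using I has_integral_le by blast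
  \<comment> \<open>Six terms, each twice a root of modulus at most 2, give 24, independently of
    \<open>a\<close> and \<open>r\<close>.\<close>
  also have "\<dots> \<le> 24"
  proof -
    have "\<bar>sqrt x\<bar> \<le> 2" if "\<bar>x\<bar> \<le> 2" for x
    proof -
      have "\<bar>sqrt x\<bar> = sqrt \<bar>x\<bar>" by (metis real_sqrt_abs2 real_sqrt_mult real_sqrt_abs power2_eq_square abs_mult_self_eq abs_mult)
      also have "\<dots> \<le> sqrt (2^2)" using that by (subst real_sqrt_le_iff) simp
      finally show ?thesis by simp
    qed
    note s = this
    from s[of "1 - b"] s[of "0 - b"] s[of "1 - (b - 1)"] s[of "0 - (b - 1)"] s[of "1 - (b + 1)"] s[of "0 - (b + 1)"] b
    show ?thesis by (simp add: abs_le_iff)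
  qed
  finally show "integral {0..1} ?f \<le> 24" .
qed

section \<open>Logarithmic derivatives of products\<close>

lemma has_field_derivative_prod_list:
  fixes g :: "'b \<Rightarrow> complex \<Rightarrow> complex"
  assumes "\<And>a. a \<in> set as \<Longrightarrow> (g a has_field_derivative g' a) (at z) \<and> g a z \<noteq> 0"
  shows "((\<lambda>z. \<Prod>a\<leftarrow>as. g a z) has_field_derivative (\<Prod>a\<leftarrow>as. g a z) * (\<Sum>a\<leftarrow>as. g' a / g a z)) (at z)"
  using assms
proof (induction as)
  case (Cons a as)
  have "((\<lambda>z. g a z * (\<Prod>a\<leftarrow>as. g a z)) has_field_derivative
    g' a * (\<Prod>a\<leftarrow>as. g a z) + (\<Prod>a\<leftarrow>as. g a z) * (\<Sum>a\<leftarrow>as. g' a / g a z) * g a z) (at z)"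
    by (rule DERIV_mult) (use Cons in auto)
  moreover have "g' a * (\<Prod>a\<leftarrow>as. g a z) + (\<Prod>a\<leftarrow>as. g a z) * (\<Sum>a\<leftarrow>as. g' a / g a z) * g a z
     = (\<Prod>a\<leftarrow>a#as. g a z) * (\<Sum>a\<leftarrow>a#as. g' a / g a z)"
    using Cons.prems[of a] by (simp add: field_simps)
  ultimately show ?case by simp
qed auto

lemma log_deriv_prod_list:
  fixes g :: "'b \<Rightarrow> complex \<Rightarrow> complex"
  assumes g: "\<And>a. a \<in> set as \<Longrightarrow> (g a has_field_derivative g' a) (at z) \<and> g a z \<noteq> 0"
    and u: "u holomorphic_on UNIV" "u z \<noteq> 0"
    and h: "\<And>z. h z = (\<Prod>a\<leftarrow>as. g a z) * u z"
  shows "deriv h z / h z = (\<Sum>a\<leftarrow>as. g' a / g a z) + deriv u z / u z"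
proof -
  let ?P = "\<Prod>a\<leftarrow>as. g a z"
  have nz: "?P \<noteq> 0" using g by (auto simp: prod_list_zero_iff)
  have "(u has_field_derivative deriv u z) (at z)"
    using u(1) holomorphic_derivI open_UNIV by blast
  from DERIV_mult[OF has_field_derivative_prod_list[of as g g' z, OF g] this]
  have "(h has_field_derivative ?P * (\<Sum>a\<leftarrow>as. g' a / g a z) * u z + deriv u z * ?P) (at z)"
    by (simp add: h[abs_def])
  then have "deriv h z = ?P * (\<Sum>a\<leftarrow>as. g' a / g a z) * u z + deriv u z * ?P"
    by (rule DERIV_imp_deriv)
  then show ?thesis using nz u(2) by (simp add: h field_simps)
qed

lemma norm_sum_list_le:
  fixes f :: "'a \<Rightarrow> complex"
  assumes "\<And>a. a \<in> set as \<Longrightarrow> norm (f a) \<le> g a"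
  shows "norm (\<Sum>a\<leftarrow>as. f a) \<le> (\<Sum>a\<leftarrow>as. g a)"
  using assms by (induction as) (auto intro: order_trans[OF norm_triangle_ineq] add_mono)

lemma sqrt_sum_list_le:
  assumes "\<And>a. a \<in> set as \<Longrightarrow> 0 \<le> f a"
  shows "sqrt (\<Sum>a\<leftarrow>as. f a) \<le> (\<Sum>a\<leftarrow>as. sqrt (f a))"
  using assms
proof (induction as)
  case (Cons a as)
  have "sqrt (f a + (\<Sum>a\<leftarrow>as. f a)) \<le> sqrt (f a) + sqrt (\<Sum>a\<leftarrow>as. f a)"
    using Cons.prems by (intro sqrt_add_le_add_sqrt sum_list_nonneg) auto
  then show ?case using Cons by auto
qed auto

lemma sqrt_le_one_plus: "0 \<le> x \<Longrightarrow> sqrt x \<le> 1 + x"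
proof -
  assume "0 \<le> x"
  then have "sqrt x \<le> sqrt ((1 + x)^2)"
    by (intro real_sqrt_le_mono) (simp add: power2_eq_square algebra_simps)
  then show ?thesis using \<open>0 \<le> x\<close> by simp
qed

lemma integral_sum_list:
  fixes f :: "'a \<Rightarrow> real \<Rightarrow> real"
  assumes "\<And>a. a \<in> set as \<Longrightarrow> f a integrable_on {0..1} \<and> integral {0..1} (f a) \<le> K"
  shows "(\<lambda>t. \<Sum>a\<leftarrow>as. f a t) integrable_on {0..1} \<and>
     integral {0..1} (\<lambda>t. \<Sum>a\<leftarrow>as. f a t) \<le> real (length as) * K"
  using assms
proof (induction as)
  case (Cons a as)
  then show ?case
    by (auto simp: integral_add algebra_simps intro!: integrable_add add_mono)
qed auto

lemma prod_list_const_norm_le: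
  fixes f :: "'a \<Rightarrow> complex"
  assumes "\<And>a. a \<in> set as \<Longrightarrow> norm (f a) \<le> c" "0 \<le> c"
  shows "norm (\<Prod>a\<leftarrow>as. f a) \<le> c ^ length as"
  using assms by (induction as) (auto simp: norm_mult intro!: mult_mono)

text \<open>The mean of \<open>1 / |z - a|\<close> over a circle is not bounded uniformly in
  \<open>a\<close>, but that of \<open>1 / sqrt |z - a|\<close> is. The square root costs only a
  factor 2 once logarithms are taken.\<close>

definition sqrt_log_deriv :: "(complex \<Rightarrow> complex) \<Rightarrow> real \<Rightarrow> real \<Rightarrow> real" where
  "sqrt_log_deriv h r t = sqrt (norm (deriv h (circlepath 0 r t) / h (circlepath 0 r t)))"

lemma sqrt_log_deriv_continuous:
  assumes h: "h holomorphic_on UNIV" and nz: "\<And>z. norm z = r \<Longrightarrow> h z \<noteq> 0" and r: "r \<ge> 1"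
  shows "continuous_on {0..1} (sqrt_log_deriv h r)"
proof -
  have c: "continuous_on UNIV h" "continuous_on UNIV (deriv h)"
    using h holomorphic_deriv[OF h] by (auto intro: holomorphic_on_imp_continuous_on)
  show ?thesis
    unfolding sqrt_log_deriv_def using nz r
    by (intro continuous_intros continuous_on_circlepath_param continuous_on_compose2[OF c(1)]
         continuous_on_compose2[OF c(2)]) auto
qed

text \<open>Write \<open>h'/h\<close> as \<open>v'/v\<close> plus the poles at the zeros of
  \<open>h\<close>, minus the poles at their reflections. The first part is bounded because
  \<open>v\<close> is zero-free, the reflected poles keep distance \<open>s\<close> from the circle,
  and the genuine poles are integrable after a square root. Only the logarithm of the bound matters
  later, so any fixed power of \<open>B\<close>, \<open>r\<close> and \<open>1 / s\<close> is
  harmless.\<close>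

lemma log_derivative_lemma:
  assumes h: "h holomorphic_on UNIV" and h0: "h 0 \<noteq> 0"
  shows "\<exists>C\<ge>1. \<forall>r s B. r \<ge> 1 \<longrightarrow> 0 < s \<longrightarrow> s \<le> 1 \<longrightarrow> B \<ge> 1 \<longrightarrow>
        (\<forall>z. norm z \<le> r + s \<longrightarrow> norm (h z) \<le> exp B) \<longrightarrow> (\<forall>z. norm z = r \<longrightarrow> h z \<noteq> 0) \<longrightarrow>
        integral {0..1} (sqrt_log_deriv h r) \<le> C * B * (r + 1) / s^2"
proof -
  define C0 where "C0 = 2 + \<bar>ln (norm (h 0))\<bar>"
  \<comment> \<open>The summands correspond to the additive 1 in the pointwise bound, to 32 from the
    zero-free part \<open>V\<close> and to 52 from the zeros counted by \<open>N\<close>.\<close>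
  define C where "C = 1 + 84 * C0"
  have C0: "C0 \<ge> 2" by (simp add: C0_def)
  show ?thesis
  proof (intro exI[of _ C] conjI allI impI)
    show "C \<ge> 1" using C0 by (simp add: C_def)
    fix r s B :: real
    assume r: "r \<ge> 1" and s: "0 < s" "s \<le> 1" and B: "B \<ge> 1"
      and bd': "\<forall>z. norm z \<le> r + s \<longrightarrow> norm (h z) \<le> exp B"
      and nz': "\<forall>z. norm z = r \<longrightarrow> h z \<noteq> 0"
    note bd = bd'[rule_format] and nz = nz'[rule_format]
    have kB: "B + 1 - ln (norm (h 0)) \<le> C0 * B"
    proof -
      have "\<bar>ln (norm (h 0))\<bar> \<le> \<bar>ln (norm (h 0))\<bar> * B" using B by (simp add: mult_le_cancel_left1)
      moreover have "- ln (norm (h 0)) \<le> \<bar>ln (norm (h 0))\<bar>" by linarith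
      ultimately have "B + 1 - ln (norm (h 0)) \<le> 2 * B + \<bar>ln (norm (h 0))\<bar> * B" using B by linarith
      then show ?thesis by (simp add: C0_def algebra_simps)
    qed
    \<comment> \<open>Zeros up to \<open>R1\<close> are removed and reflected in \<open>R2\<close>:
      the gap between \<open>r\<close> and \<open>R1\<close> is needed for the zero-free bound on
      \<open>v\<close>, the gap between \<open>R1\<close> and \<open>R2\<close> for counting the
      removed zeros.\<close>
    define R1 where "R1 = r + s / 2"
    define R2 where "R2 = r + s"
    have R: "r < R1" "R1 < R2" "R2 > 0" "R1 > 0" "R2 \<le> r + 1" using r s by (auto simp: R1_def R2_def)
    obtain as u v where u: "u holomorphic_on UNIV" and v: "v holomorphic_on UNIV"
      and as: "\<And>a. a \<in> set as \<Longrightarrow> norm a \<le> R1 \<and> norm a < R2 \<and> h a = 0"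
      and vnz: "\<And>z. norm z \<le> R1 \<Longrightarrow> v z \<noteq> 0"
      and hu: "\<And>z. h z = (\<Prod>a\<leftarrow>as. z - a) * u z"
      and vu: "\<And>z. v z = (\<Prod>a\<leftarrow>as. (of_real R2 ^ 2 - cnj a * z) / of_real R2) * u z"
      and vs: "\<And>z. norm z = R2 \<Longrightarrow> norm (v z) = norm (h z)"
      and vh: "\<And>z. norm z \<le> R2 \<Longrightarrow> norm (h z) \<le> norm (v z)"
      by (rule blaschke_decomposition[OF h h0 R(3), of R1]) (use R in auto)
    have vb: "norm (v z) \<le> exp B" if "norm z \<le> R2" for z
    proof (rule maximum_modulus_frontier[of v "cball 0 R2"])
      show "v holomorphic_on interior (cball 0 R2)" using v by (rule entire_subset)
      show "continuous_on (closure (cball 0 R2)) v"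
        using entire_subset[OF v] by (rule holomorphic_on_imp_continuous_on)
      show "norm (v z) \<le> exp B" if "z \<in> frontier (cball 0 R2)" for z
      proof -
        have "norm z = R2" using that by (simp add: frontier_cball)
        then show ?thesis using vs[of z] bd[of z] by (simp add: R2_def)
      qed
    qed (use that in auto)
    have lv0: "ln (norm (h 0)) \<le> ln (norm (v 0))"
      using vh[of 0] R h0 by (simp add: ln_le_cancel_iff[of "norm (h 0)" "norm (v 0)"] vnz)
    \<comment> \<open>Jensen's count of zeros: at 0 each removed factor has modulus at most
      \<open>R1\<close>, while its replacement has modulus \<open>R2\<close>. Hence
      \<open>(R2 / R1)^N\<close> is at most \<open>|v 0| / |h 0|\<close>, and
      \<open>|v 0| \<le> exp B\<close>.\<close>
    define N where "N = length as"
    have N: "real N \<le> C0 * B * (2 * (r + 1) / s)"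
    proof -
      have "norm (h 0) \<le> R1 ^ N * norm (u 0)"
      proof -
        have "norm (\<Prod>a\<leftarrow>as. 0 - a) \<le> R1 ^ N"
          unfolding N_def by (rule prod_list_const_norm_le) (use as R in auto)
        then show ?thesis by (simp add: hu[of 0] norm_mult mult_right_mono)
      qed
      moreover have "norm (v 0) = R2 ^ N * norm (u 0)"
      proof -
        have "(\<Prod>a\<leftarrow>as. (of_real R2 ^ 2 - cnj a * 0) / of_real R2) = (of_real R2 :: complex) ^ N"
          unfolding N_def using R by (induction as) (auto simp: power2_eq_square)
        then show ?thesis using R by (simp add: vu[of 0] norm_mult norm_power)
      qed
      ultimately have "norm (h 0) * R2 ^ N \<le> R1 ^ N * norm (v 0)"
        using R by (simp add: mult_right_mono mult.assoc mult.left_commute mult.commute[of _ "R2 ^ N"])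
      also have "\<dots> \<le> R1 ^ N * exp B"
        using vb[of 0] R by (intro mult_left_mono) auto
      finally have "ln (norm (h 0) * R2 ^ N) \<le> ln (R1 ^ N * exp B)"
        using R h0 by (subst ln_le_cancel_iff) auto
      then have "ln (norm (h 0)) + N * ln R2 \<le> N * ln R1 + B"
        using R h0 by (simp add: ln_mult ln_realpow)
      then have 1: "N * ln (R2 / R1) \<le> C0 * B"
        using R kB by (simp add: ln_div algebra_simps)
      have "ln (R1 / R2) \<le> R1 / R2 - 1"
        using R by (intro ln_le_minus_one) auto
      then have "s / 2 / R2 \<le> ln (R2 / R1)"
        using R by (simp add: ln_div R1_def R2_def field_simps)
      moreover have "s / (2 * (r + 1)) \<le> s / 2 / R2"
        using R s by (simp add: frac_le)
      ultimately have "N * (s / (2 * (r + 1))) \<le> N * ln (R2 / R1)"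
        by (intro mult_left_mono) auto
      with 1 have "N * (s / (2 * (r + 1))) \<le> C0 * B" by linarith
      then show ?thesis using s r by (simp add: field_simps)
    qed
    define V where "V = 32 * C0 * B * (r + 1) / s^2"
    have V: "norm (deriv v z / v z) \<le> V" if "norm z = r" for z
    proof -
      have "norm (deriv v z / v z) \<le> 8 * (B + 1 - ln (norm (v 0))) * R1 / (R1 - r)^2"
        by (rule log_deriv_zero_free_bound[OF v vnz]) (use vb that R in auto)
      also have "\<dots> \<le> 8 * (C0 * B) * (r + 1) / (R1 - r)^2"
      proof (rule divide_right_mono)
        have "B + 1 - ln (norm (v 0)) \<le> C0 * B" using kB lv0 by linarith
        then have "8 * (B + 1 - ln (norm (v 0))) \<le> 8 * (C0 * B)" by simp
        then show "8 * (B + 1 - ln (norm (v 0))) * R1 \<le> 8 * (C0 * B) * (r + 1)"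
          using R C0 B by (intro mult_mono[of "8 * (B + 1 - ln (norm (v 0)))"]) auto
      qed auto
      also have "\<dots> = V" using s by (simp add: R1_def V_def field_simps power2_eq_square)
      finally show ?thesis .
    qed
    let ?c = "circlepath 0 r"
    have cn: "norm (?c t) = r" for t using r by simp
    have ptw: "sqrt_log_deriv h r t \<le>
       (1 + V) + (\<Sum>a\<leftarrow>as. 1 / sqrt (norm (?c t - a)) + (1 + 1 / s))" for t
    proof -
      define z where "z = ?c t"
      have z: "norm z = r" using cn by (simp add: z_def)
      have hz: "h z \<noteq> 0" using nz z by blast
      have za: "z - a \<noteq> 0" if "a \<in> set as" for a
        using as[OF that] hz by auto
      have uz: "u z \<noteq> 0" using hz hu[of z] by auto
      have da: "of_real R2 ^ 2 - cnj a * z \<noteq> 0" if "a \<in> set as" for a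
        using blaschke_denominator_nonzero[of a R2 z] as[OF that] z R by auto
      have h': "deriv h z / h z = (\<Sum>a\<leftarrow>as. 1 / (z - a)) + deriv u z / u z"
        by (rule log_deriv_prod_list[OF _ u uz hu]) (use za in \<open>auto intro!: derivative_eq_intros\<close>)
      have v': "deriv v z / v z = (\<Sum>a\<leftarrow>as. (- cnj a / of_real R2) / ((of_real R2 ^ 2 - cnj a * z) / of_real R2)) + deriv u z / u z"
        by (rule log_deriv_prod_list[OF _ u uz vu]) (use da R in \<open>auto intro!: derivative_eq_intros\<close>)
      have "norm (\<Sum>a\<leftarrow>as. 1 / (z - a)) \<le> (\<Sum>a\<leftarrow>as. 1 / norm (z - a))"
        by (rule norm_sum_list_le) (simp add: norm_divide)
      \<comment> \<open>For \<open>a\<close> other than 0 the term is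
        \<open>1 / (z - R2^2 / cnj a)\<close>, a pole at the reflected point, which lies outside the
        disc of radius \<open>R2\<close> and so at distance at least \<open>s\<close> from the
        circle.\<close>
      moreover have "norm (\<Sum>a\<leftarrow>as. (- cnj a / of_real R2) / ((of_real R2 ^ 2 - cnj a * z) / of_real R2)) \<le> (\<Sum>a\<leftarrow>as. 1 / s)"
      proof (rule norm_sum_list_le)
        fix a assume a: "a \<in> set as"
        have "norm (of_real R2 ^ 2 - cnj a * z) \<ge> R2^2 - norm a * r"
          using norm_triangle_ineq2[of "of_real R2 ^ 2" "cnj a * z"] z R by (simp add: norm_mult norm_power)
        moreover have "norm a * r \<le> R2 * r" using as[OF a] r by (intro mult_right_mono) auto
        ultimately have "R2 * s \<le> norm (of_real R2 ^ 2 - cnj a * z)"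
          by (simp add: R2_def power2_eq_square algebra_simps)
        moreover have "norm a * s \<le> R2 * s" using as[OF a] s by (intro mult_right_mono) auto
        ultimately have "norm a * s \<le> norm (of_real R2 ^ 2 - cnj a * z)" by linarith
        then show "norm ((- cnj a / of_real R2) / ((of_real R2 ^ 2 - cnj a * z) / of_real R2)) \<le> 1 / s"
          using da[OF a] s R by (simp add: norm_divide field_simps)
      qed
      moreover have "deriv h z / h z = deriv v z / v z + (\<Sum>a\<leftarrow>as. 1 / (z - a)) -
         (\<Sum>a\<leftarrow>as. (- cnj a / of_real R2) / ((of_real R2 ^ 2 - cnj a * z) / of_real R2))"
        using h' v' by simp
      ultimately have "norm (deriv h z / h z) \<le> V + (\<Sum>a\<leftarrow>as. 1 / norm (z - a)) + (\<Sum>a\<leftarrow>as. 1 / s)"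
        using V[OF z] norm_triangle_ineq4 norm_triangle_ineq by (smt (verit))
      also have "\<dots> = V + (\<Sum>a\<leftarrow>as. 1 / norm (z - a) + 1 / s)"
        by (simp add: sum_list_addf)
      finally have "sqrt (norm (deriv h z / h z)) \<le> sqrt (V + (\<Sum>a\<leftarrow>as. 1 / norm (z - a) + 1 / s))"
        by (rule real_sqrt_le_mono)
      also have "\<dots> \<le> sqrt V + sqrt (\<Sum>a\<leftarrow>as. 1 / norm (z - a) + 1 / s)"
        using C0 B r s by (intro sqrt_add_le_add_sqrt sum_list_nonneg) (auto simp: V_def)
      also have "sqrt V \<le> 1 + V"
        using C0 B r s by (intro sqrt_le_one_plus) (auto simp: V_def)
      also have "sqrt (\<Sum>a\<leftarrow>as. 1 / norm (z - a) + 1 / s) \<le> (\<Sum>a\<leftarrow>as. sqrt (1 / norm (z - a) + 1 / s))"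
        using s by (intro sqrt_sum_list_le) auto
      also have "\<dots> \<le> (\<Sum>a\<leftarrow>as. 1 / sqrt (norm (z - a)) + (1 + 1 / s))"
      proof (rule sum_list_mono)
        fix a
        have "sqrt (1 / norm (z - a) + 1 / s) \<le> sqrt (1 / norm (z - a)) + sqrt (1 / s)"
          using s by (intro sqrt_add_le_add_sqrt) auto
        also have "sqrt (1 / s) \<le> 1 + 1 / s" using s by (intro sqrt_le_one_plus) auto
        finally show "sqrt (1 / norm (z - a) + 1 / s) \<le> 1 / sqrt (norm (z - a)) + (1 + 1 / s)"
          by (simp add: real_sqrt_divide)
      qed
      finally show ?thesis by (simp add: z_def sqrt_log_deriv_def)
    qed
    have I: "(\<lambda>t. 1 / sqrt (norm (?c t - a)) + (1 + 1 / s)) integrable_on {0..1} \<and>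
        integral {0..1} (\<lambda>t. 1 / sqrt (norm (?c t - a)) + (1 + 1 / s)) \<le> 24 + (1 + 1 / s)"
      if "a \<in> set as" for a
    proof -
      have "norm a \<noteq> r" using as[OF that] nz by auto
      note J = integral_inverse_sqrt_circle[OF r this]
      show ?thesis
        using J by (auto simp: integral_add integrable_const_ivl intro!: integrable_add)
    qed
    have IL: "(\<lambda>t. \<Sum>a\<leftarrow>as. 1 / sqrt (norm (?c t - a)) + (1 + 1 / s)) integrable_on {0..1} \<and>
        integral {0..1} (\<lambda>t. \<Sum>a\<leftarrow>as. 1 / sqrt (norm (?c t - a)) + (1 + 1 / s)) \<le> real N * (24 + (1 + 1 / s))"
      unfolding N_def by (rule integral_sum_list) (rule I)
    have int: "sqrt_log_deriv h r integrable_on {0..1}"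
      using sqrt_log_deriv_continuous[OF h nz r] by (rule integrable_continuous_real)
    have "integral {0..1} (sqrt_log_deriv h r) \<le>
       integral {0..1} (\<lambda>t. (1 + V) + (\<Sum>a\<leftarrow>as. 1 / sqrt (norm (?c t - a)) + (1 + 1 / s)))"
      by (rule integral_le[OF int]) (use IL ptw in \<open>auto intro!: integrable_add integrable_const_ivl\<close>)
    also have "\<dots> = (1 + V) + integral {0..1} (\<lambda>t. \<Sum>a\<leftarrow>as. 1 / sqrt (norm (?c t - a)) + (1 + 1 / s))"
      using IL by (subst integral_add) (auto intro: integrable_const_ivl)
    also have "\<dots> \<le> (1 + V) + real N * (24 + (1 + 1 / s))" using IL by simp
    also have "\<dots> \<le> C * B * (r + 1) / s^2"
    proof -
      have "1 \<le> 1 / s" using s by simp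
      then have "real N * (24 + (1 + 1 / s)) \<le> real N * (26 / s)"
        by (intro mult_left_mono) (auto simp: field_simps)
      also have "\<dots> \<le> C0 * B * (2 * (r + 1) / s) * (26 / s)"
        using s by (intro mult_right_mono[OF N]) auto
      also have "\<dots> = 52 * C0 * B * (r + 1) / s^2" by (simp add: power2_eq_square)
      finally have 1: "real N * (24 + (1 + 1 / s)) \<le> 52 * C0 * B * (r + 1) / s^2" .
      have "s^2 \<le> 1" using s by (simp add: power_le_one)
      moreover have "1 * 1 \<le> B * (r + 1)" using B r by (intro mult_mono) auto
      ultimately have 2: "1 \<le> B * (r + 1) / s^2" using s by (simp add: field_simps)
      have "C * B * (r + 1) / s^2 = B * (r + 1) / s^2 + V + 52 * C0 * B * (r + 1) / s^2"
        by (simp add: C_def V_def add_divide_distrib algebra_simps)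
      then show ?thesis using 1 2 by linarith
    qed
    finally show "integral {0..1} (sqrt_log_deriv h r) \<le> C * B * (r + 1) / s^2" .
  qed
qed

section \<open>Growth of means over circles\<close>

lemma continuous_circle_mean:
  fixes \<phi> :: "complex \<Rightarrow> real"
  assumes "continuous_on UNIV \<phi>"
  shows "continuous_on UNIV (\<lambda>r. integral {0..1} (\<lambda>t. \<phi> (circlepath 0 r t)))"
proof -
  have "continuous_on (UNIV \<times> cbox 0 1) (\<lambda>(r, t). \<phi> (circlepath 0 r t))"
    unfolding case_prod_unfold
    by (rule continuous_on_compose2[OF assms]) (auto simp: circlepath intro!: continuous_intros)
  from integral_continuous_on_param[OF this] show ?thesis by simp
qed

lemma circle_integrable:
  fixes \<phi> :: "complex \<Rightarrow> real"
  assumes "continuous_on UNIV \<phi>"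
  shows "(\<lambda>t. \<phi> (circlepath 0 r t)) integrable_on {0..1}"
  by (intro integrable_continuous_real continuous_on_compose2[OF assms] continuous_on_circlepath_param) auto

text \<open>The moduli of the zeros form a countable set. On a radius outside it, circle integrals
  of logarithms and of logarithmic derivatives have continuous integrands.\<close>

lemma ex_radius_avoiding_zeros:
  fixes a b :: real
  assumes "a < b" and "finite H" and "\<And>h. h \<in> H \<Longrightarrow> h holomorphic_on UNIV \<and> (\<exists>w. h w \<noteq> 0)"
  obtains r where "a < r" "r < b" "\<And>h w. h \<in> H \<Longrightarrow> norm w = r \<Longrightarrow> h w \<noteq> (0::complex)"
proof -
  have "countable (\<Union>h\<in>H. norm ` {w. h w = 0})"
    using assms by (intro countable_UN countable_image countable_finite[of H]) (auto intro: countable_zeros_entire)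
  moreover have "uncountable {a<..<b}" using \<open>a < b\<close> by (simp add: uncountable_open_interval)
  ultimately have "\<not> {a<..<b} \<subseteq> (\<Union>h\<in>H. norm ` {w. h w = 0})"
    using countable_subset by blast
  then obtain r where "r \<in> {a<..<b}" "r \<notin> (\<Union>h\<in>H. norm ` {w. h w = 0})" by blast
  then show ?thesis using that by force
qed

text \<open>If the bound failed at \<open>R\<close>, continuity of the mean in the radius would make
  it fail at a slightly larger radius whose circle carries no zero of \<open>h\<close>. There
  Poisson-Jensen applies, with the kernel at most \<open>(r + |z|) / (r - |z|)\<close>;
  \<open>\<phi> \<ge> 0\<close> allows the kernel to be replaced by this maximum.\<close>

lemma poisson_majorant:
  fixes \<phi> :: "complex \<Rightarrow> real"
  assumes h: "h holomorphic_on UNIV" and \<phi>: "continuous_on UNIV \<phi>" "\<And>w. \<phi> w \<ge> 0"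
    and le: "\<And>w. norm (h w) \<le> exp (\<phi> w)" and z: "norm z < R"
  shows "ln (norm (h z)) \<le> (R + norm z) / (R - norm z) * integral {0..1} (\<lambda>t. \<phi> (circlepath 0 R t))"
proof (rule ccontr)
  define m where "m r = integral {0..1} (\<lambda>t. \<phi> (circlepath 0 r t))" for r
  have m0: "m r \<ge> 0" for r
    unfolding m_def using \<phi> by (intro integral_nonneg circle_integrable) auto
  assume "\<not> ?thesis"
  then have neg: "(R + norm z) / (R - norm z) * m R < ln (norm (h z))" by (simp add: m_def)
  moreover have "0 \<le> (R + norm z) / (R - norm z) * m R"
    using z m0[of R] norm_ge_zero[of z] by (intro mult_nonneg_nonneg divide_nonneg_nonneg) linarith+
  ultimately have hz: "h z \<noteq> 0" by auto
  have "isCont m R"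
    using continuous_circle_mean[OF \<phi>(1)] by (simp add: m_def[abs_def] continuous_on_eq_continuous_at)
  then have "isCont (\<lambda>r. (r + norm z) / (r - norm z) * m r) R"
    using z by (intro continuous_intros) auto
  then have "((\<lambda>r. (r + norm z) / (r - norm z) * m r) \<longlongrightarrow> (R + norm z) / (R - norm z) * m R) (nhds R)"
    by (simp add: isCont_def tendsto_nhds_iff)
  then have "\<forall>\<^sub>F r in nhds R. (r + norm z) / (r - norm z) * m r < ln (norm (h z))"
    using neg by (rule order_tendstoD(2))
  then obtain e where e: "e > 0" "\<And>r. dist r R < e \<Longrightarrow> (r + norm z) / (r - norm z) * m r < ln (norm (h z))"
    unfolding eventually_nhds_metric by blast
  obtain r where r: "R < r" "r < R + e" and nz: "\<And>w. norm w = r \<Longrightarrow> h w \<noteq> 0"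
    using ex_radius_avoiding_zeros[of R "R + e" "{h}"] e h hz by (metis finite.emptyI finite.insertI
        less_add_same_cancel1 singletonD singletonI)
  have zr: "norm z < r" using z r by simp
  let ?P = "\<lambda>t. (r^2 - (norm z)^2) / (norm (circlepath 0 r t - z))^2"
  have r0: "r > 0" using zr norm_ge_zero[of z] by linarith
  have cz: "circlepath 0 r t - z \<noteq> 0" for t
    using zr norm_circlepath[of r t] r0 by auto
  have ch: "continuous_on UNIV h" using h by (rule holomorphic_on_imp_continuous_on)
  have "ln (norm (h z)) \<le> integral {0..1} (\<lambda>t. ?P t * ln (norm (h (circlepath 0 r t))))"
    by (rule poisson_jensen_inequality[OF h nz zr hz])
  also have "\<dots> \<le> integral {0..1} (\<lambda>t. (r + norm z) / (r - norm z) * \<phi> (circlepath 0 r t))"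
  proof (rule integral_le)
    show "(\<lambda>t. ?P t * ln (norm (h (circlepath 0 r t)))) integrable_on {0..1}"
      using cz nz r0
      by (intro integrable_continuous_real continuous_intros continuous_on_circlepath_param
           continuous_on_compose2[OF ch]) auto
    show "(\<lambda>t. (r + norm z) / (r - norm z) * \<phi> (circlepath 0 r t)) integrable_on {0..1}"
      using circle_integrable[OF \<phi>(1)] by (rule integrable_on_mult_right)
    fix t :: real
    let ?c = "circlepath 0 r t"
    have "r - norm z \<le> norm (?c - z)"
      using norm_triangle_ineq2[of ?c z] r0 by simp
    then have d: "(r - norm z)^2 \<le> (norm (?c - z))^2" using zr by (intro power_mono) auto
    have rz: "0 \<le> r^2 - (norm z)^2" using zr by (simp add: power_mono)
    then have P0: "0 \<le> ?P t" by simp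
    have "?P t \<le> (r^2 - (norm z)^2) / (r - norm z)^2"
      using d rz zr by (intro divide_left_mono mult_pos_pos zero_less_power) (auto simp: cz zero_less_norm_iff simp del: right_minus_eq)
    also have "\<dots> = (r + norm z) / (r - norm z)"
      using zr by (simp add: power2_eq_square square_diff_square_factored)
    finally have P1: "?P t \<le> (r + norm z) / (r - norm z)" .
    have "norm (h ?c) > 0" using nz[of ?c] r0 by simp
    then have "ln (norm (h ?c)) \<le> \<phi> ?c"
      using le[of ?c] by (metis ln_exp ln_le_cancel_iff exp_gt_zero)
    then have "?P t * ln (norm (h ?c)) \<le> ?P t * \<phi> ?c" using P0 by (rule mult_left_mono)
    also have "\<dots> \<le> (r + norm z) / (r - norm z) * \<phi> ?c" using P1 \<phi>(2) by (rule mult_right_mono)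
    finally show "?P t * ln (norm (h ?c)) \<le> (r + norm z) / (r - norm z) * \<phi> ?c" .
  qed
  also have "\<dots> = (r + norm z) / (r - norm z) * m r" by (simp add: m_def)
  also have "\<dots> < ln (norm (h z))" using r e by (simp add: dist_real_def)
  finally show False by simp
qed

lemma unimodular_align: 
  fixes x :: complex
  obtains u where "norm u = 1" "norm (1 + u * x) = 1 + norm x"
proof (cases "x = 0")
  case True
  then show ?thesis using that[of 1] by simp
next
  case False
  define u where "u = cnj x / of_real (norm x)"
  have "u * x = of_real (norm x)"
    using False complex_norm_square[of x] by (simp add: u_def power2_eq_square mult.commute field_simps)
  then have "norm (1 + u * x) = norm (of_real (1 + norm x) :: complex)" by simp
  also have "\<dots> = 1 + norm x" by (simp only: norm_of_real abs_of_nonneg add_nonneg_nonneg zero_le_one norm_ge_zero)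
  finally show ?thesis using that[of u] False by (simp add: u_def norm_divide)
qed

text \<open>A continuous, nonnegative substitute for \<open>log^+ |f| + log^+ |g|\<close>, from
  which it differs by at most \<open>2 ln 2\<close>. Treating both functions in one quantity lets
  the growth lemma choose one radius for both.\<close>

definition log_height :: "(complex \<Rightarrow> complex) \<Rightarrow> (complex \<Rightarrow> complex) \<Rightarrow> complex \<Rightarrow> real" where
  "log_height f g z = ln ((1 + norm (f z)) * (1 + norm (g z)))"

lemma exp_log_height: "exp (log_height f g z) = (1 + norm (f z)) * (1 + norm (g z))"
  unfolding log_height_def by (rule exp_ln) (intro mult_pos_pos add_pos_nonneg; simp)

lemma log_height_nonneg: "log_height f g z \<ge> 0"
proof -
  have "1 * 1 \<le> (1 + norm (f z)) * (1 + norm (g z))" by (intro mult_mono) auto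
  then show ?thesis unfolding log_height_def by (intro ln_ge_zero) auto
qed

lemma continuous_on_log_height:
  assumes "f holomorphic_on UNIV" "g holomorphic_on UNIV"
  shows "continuous_on UNIV (log_height f g)"
proof -
  have "(1 + norm (f z)) * (1 + norm (g z)) \<noteq> 0" for z
    using exp_log_height[of f g z] by (metis exp_not_eq_zero)
  then show ?thesis
    unfolding log_height_def using assms
    by (intro continuous_intros holomorphic_on_imp_continuous_on) auto
qed

definition mean_log_height :: "(complex \<Rightarrow> complex) \<Rightarrow> (complex \<Rightarrow> complex) \<Rightarrow> real \<Rightarrow> real" where
  "mean_log_height f g r = integral {0..1} (\<lambda>t. log_height f g (circlepath 0 r t))"

lemma mean_log_height_nonneg:
  assumes "f holomorphic_on UNIV" "g holomorphic_on UNIV"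
  shows "mean_log_height f g r \<ge> 0"
  unfolding mean_log_height_def
  by (intro integral_nonneg circle_integrable continuous_on_log_height assms log_height_nonneg)

text \<open>For fixed \<open>z\<close>, unimodular \<open>u\<close> and \<open>v\<close> are chosen
  so that \<open>(1 + u f) (1 + v g)\<close> has modulus exactly
  \<open>exp (log_height f g z)\<close> at \<open>z\<close>. Everywhere else the triangle inequality
  keeps it below \<open>exp (log_height f g)\<close>, so the majorant principle applies to this
  entire function.\<close>

lemma log_height_le_mean:
  assumes f: "f holomorphic_on UNIV" and g: "g holomorphic_on UNIV" and z: "norm z < R"
  shows "log_height f g z \<le> (R + norm z) / (R - norm z) * mean_log_height f g R"
proof -
  obtain u where u: "norm u = 1" "norm (1 + u * f z) = 1 + norm (f z)" by (rule unimodular_align)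
  obtain v where v: "norm v = 1" "norm (1 + v * g z) = 1 + norm (g z)" by (rule unimodular_align)
  define h where "h w = (1 + u * f w) * (1 + v * g w)" for w
  have "ln (norm (h z)) \<le> (R + norm z) / (R - norm z) * integral {0..1} (\<lambda>t. log_height f g (circlepath 0 R t))"
  proof (rule poisson_majorant[OF _ continuous_on_log_height[OF f g] log_height_nonneg _ z])
    show "h holomorphic_on UNIV" unfolding h_def by (intro holomorphic_intros f g)
    show "norm (h w) \<le> exp (log_height f g w)" for w
    proof -
      have "norm (1 + u * f w) \<le> 1 + norm (f w)"
        using norm_triangle_ineq[of 1 "u * f w"] u by (simp add: norm_mult)
      moreover have "norm (1 + v * g w) \<le> 1 + norm (g w)"
        using norm_triangle_ineq[of 1 "v * g w"] v by (simp add: norm_mult)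
      ultimately show ?thesis unfolding exp_log_height h_def norm_mult by (intro mult_mono) auto
    qed
  qed
  moreover have "ln (norm (h z)) = log_height f g z"
    by (simp add: h_def norm_mult u v log_height_def)
  ultimately show ?thesis by (simp add: mean_log_height_def)
qed

text \<open>Otherwise iterating \<open>r \<mapsto> r + 1 / T r\<close> from \<open>r0 + 1\<close>
  would at least triple \<open>T\<close> each time. The steps are then dominated by a geometric
  series of sum below 2, so all iterates stay in a compact interval on which \<open>T\<close> is
  bounded.\<close>

lemma borel_growth:
  fixes T :: "real \<Rightarrow> real"
  assumes cont: "continuous_on UNIV T" and T1: "\<And>r. T r \<ge> 1"
  shows "\<exists>r>r0. T (r + 1 / T r) < 3 * T r"
proof (rule ccontr)
  assume "\<not> ?thesis"
  then have neg: "T (r + 1 / T r) \<ge> 3 * T r" if "r > r0" for r using that by force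
  define x where "x n = ((\<lambda>r. r + 1 / T r) ^^ n) (r0 + 1)" for n
  have xS: "x (Suc n) = x n + 1 / T (x n)" for n by (simp add: x_def)
  have Tp: "T r > 0" for r using T1[of r] by linarith
  have x0: "x 0 = r0 + 1" by (simp add: x_def)
  have *: "x n \<ge> r0 + 1 \<and> T (x n) \<ge> 3 ^ n \<and> x n \<le> r0 + 1 + (\<Sum>i<n. (1/3) ^ i)" for n
  proof (induction n)
    case 0
    then show ?case using T1 by (simp add: x0)
  next
    case (Suc n)
    have "3 * 3 ^ n \<le> 3 * T (x n)" using Suc by simp
    also have "\<dots> \<le> T (x (Suc n))" unfolding xS using Suc by (intro neg) auto
    finally have 1: "3 ^ Suc n \<le> T (x (Suc n))" by simp
    have "1 / T (x n) \<le> 1 / 3 ^ n" using Suc Tp by (intro divide_left_mono) auto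
    then have 2: "1 / T (x n) \<le> (1/3) ^ n" by (simp add: power_divide)
    show ?case using Suc 1 2 Tp[of "x n"] by (auto simp: xS intro: add_increasing2)
  qed
  have geo: "(\<Sum>i<n. (1/3 :: real) ^ i) \<le> 2" for n
    by (simp add: sum_gp_strict) (rule order_trans[of _ 0]; simp)
  have "compact (T ` {r0+1..r0+3})"
    by (intro compact_continuous_image continuous_on_subset[OF cont]) auto
  then obtain K where K: "\<And>r. r \<in> {r0+1..r0+3} \<Longrightarrow> T r \<le> K"
    by (meson bounded_imp_bdd_above compact_imp_bounded bdd_above.E image_eqI)
  obtain n where "K < 3 ^ n" using real_arch_pow[of 3 K] by auto
  moreover have "x n \<in> {r0+1..r0+3}" using *[of n] geo[of n] by auto
  ultimately show False using K[of "x n"] *[of n] by auto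
qed

text \<open>The strict inequality persists for nearby radii, and among these some circle avoids the
  zeros of all members of \<open>H\<close>.\<close>

lemma borel_growth_generic:
  fixes T :: "real \<Rightarrow> real"
  assumes cont: "continuous_on UNIV T" and T1: "\<And>r. T r \<ge> 1"
    and H: "finite H" "\<And>h. h \<in> H \<Longrightarrow> h holomorphic_on UNIV \<and> (\<exists>w. h w \<noteq> 0)"
  obtains r where "r > r0" "T (r + 1 / T r) < 3 * T r" "\<And>h w. h \<in> H \<Longrightarrow> norm w = r \<Longrightarrow> h w \<noteq> (0::complex)"
proof -
  obtain r1 where r1: "r1 > r0" "T (r1 + 1 / T r1) < 3 * T r1"
    using borel_growth[OF cont T1] by blast
  have Tp: "T r \<noteq> 0" for r using T1[of r] by linarith
  have "continuous_on UNIV (\<lambda>r. 3 * T r - T (r + 1 / T r))"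
    by (intro continuous_intros cont continuous_on_compose2[OF cont]) (use Tp in auto)
  then have "((\<lambda>r. 3 * T r - T (r + 1 / T r)) \<longlongrightarrow> 3 * T r1 - T (r1 + 1 / T r1)) (nhds r1)"
    by (simp add: continuous_on_eq_continuous_at isCont_def tendsto_nhds_iff)
  then have "\<forall>\<^sub>F r in nhds r1. 0 < 3 * T r - T (r + 1 / T r)"
    using r1(2) by (intro order_tendstoD(1)) auto
  then obtain e where e: "e > 0" "\<And>r. dist r r1 < e \<Longrightarrow> 0 < 3 * T r - T (r + 1 / T r)"
    unfolding eventually_nhds_metric by blast
  obtain r where "r1 < r" "r < r1 + e" "\<And>h w. h \<in> H \<Longrightarrow> norm w = r \<Longrightarrow> h w \<noteq> 0"
    using ex_radius_avoiding_zeros[of r1 "r1 + e" H] e H by auto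
  then show ?thesis using that[of r] r1 e(2)[of r] by (auto simp: dist_real_def)
qed

text \<open>Jensen's inequality for the concave logarithm, via its tangent at \<open>M\<close>.\<close>
lemma mean_ln_le:
  fixes y :: "real \<Rightarrow> real"
  assumes y: "continuous_on {0..1} y" "\<And>t. t \<in> {0..1} \<Longrightarrow> y t \<ge> 1" and M: "integral {0..1} y \<le> M"
  shows "integral {0..1} (\<lambda>t. ln (y t)) \<le> ln M"
proof -
  have yi: "y integrable_on {0..1}" using y(1) by (rule integrable_continuous_real)
  have "integral {0..1} (\<lambda>t::real. 1) \<le> integral {0..1} y"
    using y yi by (intro integral_le) (auto intro: integrable_const_ivl)
  then have M1: "M \<ge> 1" using M by simp
  have li: "(\<lambda>t. ln (y t)) integrable_on {0..1}"
    using y by (intro integrable_continuous_real continuous_intros) force+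
  have "integral {0..1} (\<lambda>t. ln (y t)) \<le> integral {0..1} (\<lambda>t. (ln M - 1) + y t / M)"
  proof (rule integral_le[OF li])
    show "(\<lambda>t. (ln M - 1) + y t / M) integrable_on {0..1}"
      using y(1) M1 by (intro integrable_continuous_real continuous_intros) auto
    fix t :: real assume t: "t \<in> {0..1}"
    have "ln (y t / M) \<le> y t / M - 1" using y(2)[OF t] M1 by (intro ln_le_minus_one) auto
    then show "ln (y t) \<le> (ln M - 1) + y t / M"
      using y(2)[OF t] M1 by (simp add: ln_div)
  qed
  also have "\<dots> = (ln M - 1) + integral {0..1} y / M"
    using y(1) M1 by (subst integral_add)
      (auto intro!: integrable_const_ivl integrable_continuous_real continuous_intros)
  also have "\<dots> \<le> ln M" using M M1 by simp
  finally show ?thesis .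
qed

text \<open>The factor \<open>1 / \<delta>\<close> leaves room for Cauchy's estimate of a derivative.\<close>
definition tame :: "(complex \<Rightarrow> complex) \<Rightarrow> (complex \<Rightarrow> complex) \<Rightarrow> (complex \<Rightarrow> complex) \<Rightarrow> bool" where
  "tame f g h \<longleftrightarrow> (\<exists>K\<ge>1. \<forall>\<rho> \<delta> B. 0 \<le> \<rho> \<longrightarrow> 0 < \<delta> \<longrightarrow> \<delta> \<le> 1 \<longrightarrow> 0 \<le> B \<longrightarrow>
     (\<forall>z. norm z \<le> \<rho> + \<delta> \<longrightarrow> log_height f g z \<le> B) \<longrightarrow>
     (\<forall>z. norm z \<le> \<rho> \<longrightarrow> norm (h z) \<le> K / \<delta> * exp (K * B)))"

text \<open>The gap \<open>s\<close> is spent in stages: the mean at \<open>r + s\<close> bounds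
  \<open>log_height\<close> up to \<open>r + s / 2\<close>, tameness with
  \<open>\<delta> = s / 4\<close> bounds \<open>h\<close> up to \<open>r + s / 4\<close>, and the
  lemma on the logarithmic derivative uses the remaining \<open>s / 4\<close>. The constant 128 is 8
  from \<open>B\<close> times 16 from \<open>(s / 4)^2\<close>.\<close>

lemma log_derivative_mean_tame:
  assumes f: "f holomorphic_on UNIV" and g: "g holomorphic_on UNIV"
    and h: "h holomorphic_on UNIV" "h 0 \<noteq> 0" "tame f g h"
  shows "\<exists>C\<ge>1. \<forall>r s. r \<ge> 1 \<longrightarrow> 0 < s \<longrightarrow> s \<le> 1 \<longrightarrow> (\<forall>z. norm z = r \<longrightarrow> h z \<noteq> 0) \<longrightarrow>
    integral {0..1} (sqrt_log_deriv h r) \<le> C * ((r + 1)^2 / s^3 * (1 + mean_log_height f g (r + s)))"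
proof -
  obtain K where K: "K \<ge> 1" and tame: "\<forall>\<rho> \<delta> B. 0 \<le> \<rho> \<longrightarrow> 0 < \<delta> \<longrightarrow> \<delta> \<le> 1 \<longrightarrow> 0 \<le> B \<longrightarrow>
     (\<forall>z. norm z \<le> \<rho> + \<delta> \<longrightarrow> log_height f g z \<le> B) \<longrightarrow>
     (\<forall>z. norm z \<le> \<rho> \<longrightarrow> norm (h z) \<le> K / \<delta> * exp (K * B))"
    using h(3) unfolding tame_def by blast
  obtain C where C: "C \<ge> 1" and ldl: "\<forall>r s B. r \<ge> 1 \<longrightarrow> 0 < s \<longrightarrow> s \<le> 1 \<longrightarrow> B \<ge> 1 \<longrightarrow>
        (\<forall>z. norm z \<le> r + s \<longrightarrow> norm (h z) \<le> exp B) \<longrightarrow> (\<forall>z. norm z = r \<longrightarrow> h z \<noteq> 0) \<longrightarrow>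
        integral {0..1} (sqrt_log_deriv h r) \<le> C * B * (r + 1) / s^2"
    using log_derivative_lemma[OF h(1,2)] by blast
  show ?thesis
  proof (intro exI[of _ "128 * K * C"] conjI allI impI)
    show "128 * K * C \<ge> 1" using K C mult_mono[of 1 K 1 C] by simp
    fix r s :: real
    assume r: "r \<ge> 1" and s: "0 < s" "s \<le> 1" and nz: "\<forall>z. norm z = r \<longrightarrow> h z \<noteq> 0"
    define T where "T = mean_log_height f g (r + s)"
    have T: "T \<ge> 0" unfolding T_def by (rule mean_log_height_nonneg[OF f g])
    define B0 where "B0 = 4 * (r + 1) / s * T"
    have B0: "B0 \<ge> 0" using T r s by (simp add: B0_def)
    have lh: "log_height f g z \<le> B0" if z: "norm z \<le> r + s / 2" for z
    proof -
      have "log_height f g z \<le> ((r + s) + norm z) / ((r + s) - norm z) * T"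
        unfolding T_def by (rule log_height_le_mean[OF f g]) (use z s in linarith)
      also have "\<dots> \<le> (2 * (r + 1)) / (s / 2) * T"
        using z s r T by (intro mult_right_mono frac_le) auto
      also have "\<dots> = B0" using s by (simp add: B0_def field_simps)
      finally show ?thesis .
    qed
    define B where "B = 8 * K * (r + 1) / s * (1 + T)"
    have hb: "norm (h z) \<le> exp B" if z: "norm z \<le> r + s / 4" for z
    proof -
      have "norm (h z) \<le> K / (s / 4) * exp (K * B0)"
        by (rule tame[rule_format, of "r + s / 4"]) (use s r B0 lh z in auto)
      also have "K / (s / 4) \<le> exp (4 * K / s)"
        using exp_ge_add_one_self[of "4 * K / s"] by (simp add: mult.commute order_trans[OF _ exp_ge_add_one_self])
      finally have "norm (h z) \<le> exp (4 * K / s) * exp (K * B0)" by (simp add: mult_right_mono)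
      also have "\<dots> = exp (4 * K / s + K * B0)" by (simp add: exp_add)
      also have "4 * K / s + K * B0 \<le> B"
      proof -
        have "4 * K / s * 1 \<le> 4 * K / s * (2 * (r + 1))" using K s r by (intro mult_left_mono) auto
        moreover have "K * B0 \<le> 8 * K * (r + 1) / s * T"
        proof -
          have "0 \<le> K * ((r + 1) / s * T)" using K s r T by simp
          moreover have "K * B0 = 4 * (K * ((r + 1) / s * T))" "8 * K * (r + 1) / s * T = 8 * (K * ((r + 1) / s * T))"
            by (simp_all add: B0_def)
          ultimately show ?thesis by linarith
        qed
        ultimately show ?thesis by (simp add: B_def algebra_simps add_divide_distrib)
      qed
      finally show ?thesis by simp
    qed
    have B1: "B \<ge> 1"
    proof -
      have "1 * 1 * 1 \<le> (8 * K) * ((r + 1) / s) * (1 + T)"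
        using K r s T by (intro mult_mono) (auto simp: field_simps)
      then show ?thesis by (simp add: B_def)
    qed
    have "integral {0..1} (sqrt_log_deriv h r) \<le> C * B * (r + 1) / (s/4)^2"
      by (rule ldl[rule_format]) (use r s B1 hb nz in auto)
    also have "\<dots> = 128 * K * C * ((r + 1)^2 / s^3 * (1 + T))"
      by (simp add: B_def power2_eq_square power3_eq_cube mult_ac)
    finally show "integral {0..1} (sqrt_log_deriv h r)
         \<le> 128 * K * C * ((r + 1)^2 / s^3 * (1 + mean_log_height f g (r + s)))"
      by (simp add: T_def)
  qed
qed

text \<open>Passes from logarithmic derivatives to their square roots, whose means are under
  control; the sixth power of the former becomes a twelfth power of the latter.\<close>

lemma one_plus_sum_le_square:
  fixes x :: "'a \<Rightarrow> real"
  assumes "finite H" "\<And>h. h \<in> H \<Longrightarrow> x h \<ge> 0"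
  shows "1 + (\<Sum>h\<in>H. x h) \<le> (1 + (\<Sum>h\<in>H. sqrt (x h)))^2"
  using assms
proof (induction H rule: finite_induct)
  case (insert a H)
  let ?S = "\<Sum>h\<in>H. sqrt (x h)"
  have S: "?S \<ge> 0" using insert by (intro sum_nonneg) auto
  have "1 + (\<Sum>h\<in>insert a H. x h) \<le> x a + (1 + ?S)^2" using insert by simp
  also have "\<dots> = (sqrt (x a))^2 + (1 + ?S)^2" using insert by simp
  also have "\<dots> \<le> (sqrt (x a) + (1 + ?S))^2"
    using S insert by (simp add: power2_sum)
  finally show ?case using insert by (simp add: algebra_simps)
qed auto

text \<open>Taking logarithms in the hypothesis and averaging over a circle bounds the mean height
  by a constant plus 12 times the mean of \<open>ln y\<close>. Concavity and the lemma on the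
  logarithmic derivative turn this into the logarithm of a polynomial expression in
  \<open>r\<close>, \<open>1 / s\<close> and the mean at \<open>r + s\<close>, which Borel's lemma
  compares with the mean at \<open>r\<close>.\<close>

lemma mean_log_height_slow:
  assumes f: "f holomorphic_on UNIV" and g: "g holomorphic_on UNIV"
    and W: "W holomorphic_on UNIV" "W 0 \<noteq> 0"
    and H: "finite H" "\<And>h. h \<in> H \<Longrightarrow> h holomorphic_on UNIV \<and> h 0 \<noteq> 0 \<and> tame f g h"
    and C: "\<And>z. \<lbrakk>\<And>h. h \<in> H \<Longrightarrow> h z \<noteq> 0; W z \<noteq> 0\<rbrakk> \<Longrightarrow>
      norm (W z) * exp (log_height f g z) \<le> C * (1 + (\<Sum>h\<in>H. norm (deriv h z / h z))) ^ 6"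
  obtains A where "\<And>r0. \<exists>r>r0. mean_log_height f g r \<le> A * (1 + ln (r + 1))"
proof -
  define T where "T r = 1 + mean_log_height f g r" for r
  have T1: "T r \<ge> 1" for r using mean_log_height_nonneg[OF f g] by (simp add: T_def)
  have Tc: "continuous_on UNIV T"
    unfolding T_def mean_log_height_def
    by (intro continuous_intros continuous_circle_mean continuous_on_log_height f g)
  have "\<forall>h\<in>H. \<exists>C\<ge>1. \<forall>r s. r \<ge> 1 \<longrightarrow> 0 < s \<longrightarrow> s \<le> 1 \<longrightarrow> (\<forall>z. norm z = r \<longrightarrow> h z \<noteq> 0) \<longrightarrow>
     integral {0..1} (sqrt_log_deriv h r) \<le> C * ((r + 1)^2 / s^3 * T (r + s))"
    unfolding T_def using log_derivative_mean_tame[OF f g] H(2) by blast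
  then obtain D where D: "\<And>h. h \<in> H \<Longrightarrow> D h \<ge> 1"
    "\<And>h r s. \<lbrakk>h \<in> H; r \<ge> 1; 0 < s; s \<le> 1; \<forall>z. norm z = r \<longrightarrow> h z \<noteq> 0\<rbrakk> \<Longrightarrow>
     integral {0..1} (sqrt_log_deriv h r) \<le> D h * ((r + 1)^2 / s^3 * T (r + s))"
    unfolding bchoice_iff by blast
  define D0 where "D0 = 1 + (\<Sum>h\<in>H. D h)"
  have D0: "D0 \<ge> 1" unfolding D0_def using D(1) by (smt (verit) sum_nonneg)
  define A0 where "A0 = ln (max C 1) - ln (norm (W 0))"
  have step: "T r \<le> 1 + A0 + 12 * ln (D0 * ((r + 1)^2 / s^3 * T (r + s)))"
    if r: "r \<ge> 1" and s: "0 < s" "s \<le> 1" and nz: "\<And>h w. h \<in> insert W H \<Longrightarrow> norm w = r \<Longrightarrow> h w \<noteq> 0" for r s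
  proof -
    let ?c = "circlepath 0 r"
    let ?x = "\<lambda>h t. norm (deriv h (?c t) / h (?c t))"
    have cn: "norm (?c t) = r" for t using r by simp
    define y where "y t = 1 + (\<Sum>h\<in>H. sqrt_log_deriv h r t)" for t
    have hc: "continuous_on {0..1} (sqrt_log_deriv h r)" if "h \<in> H" for h
      using H(2)[OF that] nz[of h] that r by (intro sqrt_log_deriv_continuous) auto
    have yc: "continuous_on {0..1} y" unfolding y_def by (intro continuous_intros hc)
    have y1: "y t \<ge> 1" for t unfolding y_def by (simp add: sum_nonneg sqrt_log_deriv_def)
    define X where "X = (r + 1)^2 / s^3 * T (r + s)"
    have X: "X \<ge> 1"
    proof -
      have "s ^ 3 \<le> 1" using s by (simp add: power_le_one)
      moreover have "1 \<le> (r + 1)^2" using r by (simp add: one_le_power)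
      ultimately have "1 \<le> (r + 1)^2 / s^3" using s by (simp add: field_simps)
      then show ?thesis unfolding X_def using T1[of "r + s"] mult_mono[of 1 "(r + 1)^2 / s^3" 1 "T (r + s)"] by simp
    qed
    have "integral {0..1} y = 1 + (\<Sum>h\<in>H. integral {0..1} (sqrt_log_deriv h r))"
    proof -
      have i: "sqrt_log_deriv h r integrable_on {0..1}" if "h \<in> H" for h
        using hc[OF that] by (rule integrable_continuous_real)
      have "integral {0..1} y = integral {0..1} (\<lambda>t::real. 1) + integral {0..1} (\<lambda>t. \<Sum>h\<in>H. sqrt_log_deriv h r t)"
        unfolding y_def using i H(1) by (intro integral_add integrable_const_ivl integrable_sum)
      also have "integral {0..1} (\<lambda>t. \<Sum>h\<in>H. sqrt_log_deriv h r t) = (\<Sum>h\<in>H. integral {0..1} (sqrt_log_deriv h r))"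
        using i H(1) by (intro integral_sum)
      finally show ?thesis by simp
    qed
    also have "\<dots> \<le> 1 + (\<Sum>h\<in>H. D h * X)"
      unfolding X_def using nz r s by (intro add_left_mono sum_mono D(2)) auto
    also have "\<dots> \<le> D0 * X" using X by (simp add: D0_def algebra_simps sum_distrib_left)
    finally have ln_y: "integral {0..1} (\<lambda>t. ln (y t)) \<le> ln (D0 * X)"
      using yc y1 by (intro mean_ln_le) auto
    have Wc: "continuous_on UNIV W" using W(1) by (rule holomorphic_on_imp_continuous_on)
    have Wi: "(\<lambda>t. ln (norm (W (?c t)))) integrable_on {0..1}"
      using nz[of W] cn by (intro integrable_continuous_real continuous_intros
         continuous_on_compose2[OF Wc] continuous_on_circlepath_param) auto
    have yi: "(\<lambda>t. ln (y t)) integrable_on {0..1}"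
    proof -
      have "y t \<noteq> 0" for t using y1[of t] by linarith
      then show ?thesis by (intro integrable_continuous_real continuous_intros yc) auto
    qed
    have lhi: "(\<lambda>t. log_height f g (?c t)) integrable_on {0..1}"
      by (rule circle_integrable[OF continuous_on_log_height[OF f g]])
    \<comment> \<open>At the centre the Poisson kernel is 1, so the mean of \<open>ln |W|\<close> is
      bounded below independently of \<open>r\<close>.\<close>
    have "ln (norm (W 0)) \<le> integral {0..1} (\<lambda>t. ln (norm (W (?c t))))"
    proof -
      have "ln (norm (W 0)) \<le> integral {0..1} (\<lambda>t. (r\<^sup>2 - (norm (0::complex))\<^sup>2) / (norm (?c t - 0))\<^sup>2 * ln (norm (W (?c t))))"
        by (rule poisson_jensen_inequality[OF W(1)]) (use nz r W in auto)
      then show ?thesis using r by simp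
    qed
    then have "ln (norm (W 0)) + mean_log_height f g r \<le>
        integral {0..1} (\<lambda>t. ln (norm (W (?c t))) + log_height f g (?c t))"
      using Wi lhi by (subst integral_add) (auto simp: mean_log_height_def)
    also have "\<dots> \<le> integral {0..1} (\<lambda>t. ln (max C 1) + 12 * ln (y t))"
    proof (rule integral_le)
      show "(\<lambda>t. ln (norm (W (?c t))) + log_height f g (?c t)) integrable_on {0..1}"
        by (intro integrable_add Wi lhi)
      show "(\<lambda>t. ln (max C 1) + 12 * ln (y t)) integrable_on {0..1}"
        using yi by (intro integrable_add integrable_const_ivl integrable_on_mult_right)
      fix t :: real
      have Wp: "norm (W (?c t)) > 0" using nz[of W] cn by auto
      have "norm (W (?c t)) * exp (log_height f g (?c t)) \<le> C * (1 + (\<Sum>h\<in>H. ?x h t)) ^ 6"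
        using nz cn by (intro C) auto
      also have "\<dots> \<le> max C 1 * (1 + (\<Sum>h\<in>H. ?x h t)) ^ 6"
        by (intro mult_right_mono zero_le_power add_nonneg_nonneg sum_nonneg) auto
      also have "\<dots> \<le> max C 1 * ((y t)^2) ^ 6"
        unfolding y_def sqrt_log_deriv_def using H(1)
        by (intro mult_left_mono power_mono one_plus_sum_le_square add_nonneg_nonneg sum_nonneg) auto
      also have "\<dots> = max C 1 * y t ^ 12" by (simp flip: power_mult)
      finally have "ln (norm (W (?c t)) * exp (log_height f g (?c t))) \<le> ln (max C 1 * y t ^ 12)"
        using Wp y1[of t] by (subst ln_le_cancel_iff) auto
      moreover have "ln (norm (W (?c t)) * exp (log_height f g (?c t))) = ln (norm (W (?c t))) + log_height f g (?c t)"
        using Wp by (simp add: ln_mult)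
      moreover have "ln (max C 1 * y t ^ 12) = ln (max C 1) + 12 * ln (y t)"
        using y1[of t] by (simp add: ln_mult ln_realpow)
      ultimately show "ln (norm (W (?c t))) + log_height f g (?c t) \<le> ln (max C 1) + 12 * ln (y t)" by simp
    qed
    also have "\<dots> = ln (max C 1) + 12 * integral {0..1} (\<lambda>t. ln (y t))"
      using yi by (subst integral_add) (auto intro: integrable_const_ivl integrable_on_mult_right)
    finally show ?thesis using ln_y by (simp add: T_def A0_def X_def)
  qed
  define A1 where "A1 = 1 + A0 + 12 * ln (3 * D0) + 48 * ln 96"
  show ?thesis
  proof (rule that[of "2 * \<bar>A1\<bar> + 48"])
    fix r0 :: real
    obtain r where r: "r > max r0 1" "T (r + 1 / T r) < 3 * T r"
      and nz: "\<And>h w. h \<in> insert W H \<Longrightarrow> norm w = r \<Longrightarrow> h w \<noteq> 0"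
      using borel_growth_generic[OF Tc T1, of "insert W H" "max r0 1"] W H by auto
    define x where "x = T r"
    have x: "x \<ge> 1" using T1 by (simp add: x_def)
    \<comment> \<open>With this gap Borel's lemma gives \<open>T (r + s) < 3 x\<close>, while
      \<open>1 / s^3\<close> is \<open>x^3\<close>; the argument of the logarithm is then of order
      \<open>x^4 (r + 1)^2\<close>.\<close>
    define s where "s = 1 / x"
    have s: "0 < s" "s \<le> 1" using x by (auto simp: s_def)
    have "x \<le> 1 + A0 + 12 * ln (D0 * ((r + 1)^2 / s^3 * T (r + s)))"
      unfolding x_def by (rule step) (use r s nz in auto)
    also have "ln (D0 * ((r + 1)^2 / s^3 * T (r + s))) \<le> ln (D0 * ((r + 1)^2 * x^3 * (3 * x)))"
    proof -
      have e: "(r + 1)^2 / s^3 = (r + 1)^2 * x^3" using x by (simp add: s_def power_divide)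
      have t: "T (r + s) \<le> 3 * x" using r by (simp add: s_def x_def)
      have "T (r + s) > 0" using T1[of "r + s"] by linarith
      then show ?thesis
        unfolding e using D0 r x t by (subst ln_le_cancel_iff) (auto intro!: mult_pos_pos)
    qed
    also have "D0 * ((r + 1)^2 * x^3 * (3 * x)) = 3 * D0 * ((r + 1)^2 * x^4)"
      by (simp add: power4_eq_xxxx power3_eq_cube)
    also have "ln (3 * D0 * ((r + 1)^2 * x^4)) = ln (3 * D0) + 2 * ln (r + 1) + 4 * ln x"
      using D0 r x by (simp add: ln_mult ln_realpow)
    finally have 1: "x \<le> 1 + A0 + 12 * (ln (3 * D0) + 2 * ln (r + 1) + 4 * ln x)" by simp
    \<comment> \<open>The tangent of \<open>ln\<close> at 96 is used because the coefficient of
      \<open>ln x\<close> is 48: the term is absorbed by \<open>x / 2\<close> and a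
      constant.\<close>
    have "ln (x / 96) \<le> x / 96 - 1" using x by (intro ln_le_minus_one) auto
    then have "ln x \<le> x / 96 + ln 96" using x by (simp add: ln_div)
    with 1 have "x \<le> A1 + 24 * ln (r + 1) + x / 2" by (simp add: A1_def)
    then have "x \<le> 2 * A1 + 48 * ln (r + 1)" by simp
    also have "\<dots> \<le> (2 * \<bar>A1\<bar> + 48) * (1 + ln (r + 1))"
    proof -
      have "ln (r + 1) \<ge> 0" using r by auto
      then have "0 \<le> \<bar>A1\<bar> * ln (r + 1)" by simp
      then show ?thesis by (simp add: algebra_simps)
    qed
    finally have "mean_log_height f g r \<le> (2 * \<bar>A1\<bar> + 48) * (1 + ln (r + 1))" by (simp add: x_def T_def)
    then show "\<exists>r>r0. mean_log_height f g r \<le> (2 * \<bar>A1\<bar> + 48) * (1 + ln (r + 1))"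
      using r by auto
  qed
qed

text \<open>On \<open>|z| = r / 2\<close> the Poisson factor is 3, so for arbitrarily large
  \<open>r\<close> the function is bounded there by a constant times \<open>(r + 1)^(3 |A|)\<close>.
  Cauchy's estimate then annihilates all Taylor coefficients of high index.\<close>

lemma polynomial_of_slow_growth:
  assumes f: "f holomorphic_on UNIV" and g: "g holomorphic_on UNIV"
    and A: "\<And>r0. \<exists>r>r0. mean_log_height f g r \<le> A * (1 + ln (r + 1))"
  shows "\<exists>p. \<forall>z. f z = poly p z"
proof -
  \<comment> \<open>For \<open>n \<ge> N\<close> the exponent \<open>3 |A|\<close> is at most
    \<open>n - 1\<close>, which leaves a factor \<open>1 / r\<close> in Cauchy's estimate.\<close>
  define N where "N = nat \<lceil>3 * \<bar>A\<bar>\<rceil> + 1"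
  have N: "real N \<ge> 3 * \<bar>A\<bar> + 1" unfolding N_def by linarith
  have zero: "(deriv ^^ n) f 0 = 0" if n: "n \<ge> N" for n
  proof (rule ccontr)
    assume nz: "(deriv ^^ n) f 0 \<noteq> 0"
    define K where "K = fact n * exp (3 * \<bar>A\<bar>) * 4 ^ n"
    define r0 where "r0 = max 1 (K / norm ((deriv ^^ n) f 0))"
    obtain r where r: "r > r0" "mean_log_height f g r \<le> A * (1 + ln (r + 1))" using A by blast
    have r1: "r > 1" using r by (simp add: r0_def)
    have ml: "mean_log_height f g r \<le> \<bar>A\<bar> * (1 + ln (r + 1))"
    proof -
      have "0 \<le> 1 + ln (r + 1)" using r1 by (simp add: add_nonneg_nonneg)
      then show ?thesis using r(2) mult_right_mono[of A "\<bar>A\<bar>" "1 + ln (r + 1)"] by linarith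
    qed
    have bd: "norm (f z) \<le> exp (3 * \<bar>A\<bar>) * (r + 1) powr (3 * \<bar>A\<bar>)" if z: "norm z = r / 2" for z
    proof -
      have "1 * norm (f z) \<le> (1 + norm (g z)) * (1 + norm (f z))"
        by (intro mult_mono) auto
      then have "norm (f z) \<le> exp (log_height f g z)"
        by (simp add: exp_log_height mult.commute)
      moreover have "log_height f g z \<le> (r + norm z) / (r - norm z) * mean_log_height f g r"
        by (rule log_height_le_mean[OF f g]) (use z r1 in auto)
      moreover have "(r + norm z) / (r - norm z) = 3" using z r1 by (simp add: field_simps)
      ultimately have "log_height f g z \<le> 3 * (\<bar>A\<bar> * (1 + ln (r + 1)))" "norm (f z) \<le> exp (log_height f g z)"
        using ml by simp_all
      then have "norm (f z) \<le> exp (3 * (\<bar>A\<bar> * (1 + ln (r + 1))))"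
        using exp_le_cancel_iff order_trans by blast
      also have "3 * (\<bar>A\<bar> * (1 + ln (r + 1))) = 3 * \<bar>A\<bar> + 3 * \<bar>A\<bar> * ln (r + 1)"
        by (simp add: algebra_simps)
      also have "exp \<dots> = exp (3 * \<bar>A\<bar>) * (r + 1) powr (3 * \<bar>A\<bar>)"
        using r1 by (simp add: exp_add powr_def)
      finally show ?thesis .
    qed
    have "norm ((deriv ^^ n) f 0) \<le> fact n * (exp (3 * \<bar>A\<bar>) * (r + 1) powr (3 * \<bar>A\<bar>)) / (r / 2) ^ n"
    proof (rule Cauchy_inequality)
      show "f holomorphic_on ball 0 (r / 2)" by (rule entire_subset[OF f])
      show "continuous_on (cball 0 (r / 2)) f" using entire_subset[OF f] by (rule holomorphic_on_imp_continuous_on)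
    qed (use bd r1 in auto)
    also have "\<dots> \<le> fact n * (exp (3 * \<bar>A\<bar>) * (2 ^ n * r ^ n / r)) / (r / 2) ^ n"
    proof (intro divide_right_mono mult_left_mono)
      have "(r + 1) powr (3 * \<bar>A\<bar>) \<le> (2 * r) powr (3 * \<bar>A\<bar>)" using r1 by (intro powr_mono2) auto
      also have "\<dots> \<le> (2 * r) powr (real n - 1)" using r1 N n by (intro powr_mono) auto
      also have "\<dots> = (2 * r) ^ n / (2 * r)" using r1 by (simp add: powr_diff powr_realpow)
      also have "\<dots> \<le> 2 ^ n * r ^ n / r" using r1 by (simp add: power_mult_distrib field_simps)
      finally show "(r + 1) powr (3 * \<bar>A\<bar>) \<le> 2 ^ n * r ^ n / r" .
    qed (use r1 in auto)
    also have "\<dots> = K / r"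
    proof -
      have "(4::real) ^ n = 2 ^ n * 2 ^ n" by (simp flip: power_mult_distrib)
      then show ?thesis using r1 by (simp add: K_def power_divide field_simps)
    qed
    finally have "norm ((deriv ^^ n) f 0) * r \<le> K" using r1 by (simp add: field_simps)
    moreover have "K / norm ((deriv ^^ n) f 0) < r" using r by (simp add: r0_def)
    then have "K < norm ((deriv ^^ n) f 0) * r" using nz by (simp add: field_simps)
    ultimately show False by linarith
  qed
  define p where "p = (\<Sum>n<N. monom ((deriv ^^ n) f 0 / fact n) n)"
  have "f z = poly p z" for z
  proof -
    have "(\<lambda>n. (deriv ^^ n) f 0 / fact n * (z - 0) ^ n) sums f z"
      by (rule holomorphic_power_series[of f 0 "norm z + 1"]) (auto intro: entire_subset[OF f])
    moreover have "(\<lambda>n. (deriv ^^ n) f 0 / fact n * (z - 0) ^ n) sums (\<Sum>n<N. (deriv ^^ n) f 0 / fact n * (z - 0) ^ n)"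
      by (rule sums_finite) (auto simp: zero)
    ultimately have "f z = (\<Sum>n<N. (deriv ^^ n) f 0 / fact n * (z - 0) ^ n)" by (rule sums_unique2)
    then show ?thesis by (simp add: p_def poly_sum poly_monom)
  qed
  then show ?thesis by blast
qed

section \<open>Root products\<close>

text \<open>\<open>P' / P\<close> is the sum of \<open>m a / (z - a)\<close>, with simple poles
  only, so the product over the distinct roots clears its denominators. Applied to
  \<open>Q'\<close>, this provides \<open>q\<close> with \<open>R Q'' = q Q'\<close>.\<close>

lemma radical_mult_pderiv_prod:
  fixes A :: "complex set"
  assumes "finite A"
  shows "\<exists>q. (\<Prod>a\<in>A. [:-a, 1:]) * pderiv (\<Prod>a\<in>A. [:-a, 1:] ^ m a) = q * (\<Prod>a\<in>A. [:-a, 1:] ^ m a)"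
  using assms
proof (induction A rule: finite_induct)
  case empty
  then show ?case by (intro exI[of _ 0]) simp
next
  case (insert b A)
  let ?R = "\<Prod>a\<in>A. [:-a, 1:]" and ?P = "\<Prod>a\<in>A. [:-a, 1:] ^ m a" and ?L = "[:-b, 1:] :: complex poly"
  obtain q where q: "?R * pderiv ?P = q * ?P" using insert by blast
  have d: "?L * pderiv (?L ^ k) = smult (of_nat k) (?L ^ k)" for k
    by (cases k) (simp_all add: pderiv_power_Suc pderiv_pCons del: mult_pCons_left power_Suc, simp)
  have "(?L * ?R) * pderiv (?L ^ m b * ?P) = ?L * ?L ^ m b * (?R * pderiv ?P) + ?R * ?P * (?L * pderiv (?L ^ m b))"
    unfolding pderiv_mult by (simp only: algebra_simps)
  also have "\<dots> = (?L * q + smult (of_nat (m b)) ?R) * (?L ^ m b * ?P)"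
    unfolding q d by (simp add: algebra_simps del: mult_pCons_left mult_pCons_right)
  finally show ?case unfolding prod.insert[OF insert.hyps(1,2)] by (rule exI)
qed

lemma radical_mult_pderiv:
  fixes P :: "complex poly"
  assumes "P \<noteq> 0"
  obtains q where "(\<Prod>a | poly P a = 0. [:-a, 1:]) * pderiv P = q * P"
proof -
  let ?A = "{a. poly P a = 0}"
  define D where "D = (\<Prod>a\<in>?A. [:-a, 1:] ^ order a P)"
  define L where "L = lead_coeff P"
  have "finite ?A" using assms poly_roots_finite by blast
  from radical_mult_pderiv_prod[OF this, of "\<lambda>a. order a P"]
  obtain q where q: "(\<Prod>a\<in>?A. [:-a, 1:]) * pderiv D = q * D" unfolding D_def by blast
  have P: "smult L D = P" unfolding D_def L_def by (rule complex_poly_decompose)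
  have "(\<Prod>a\<in>?A. [:-a, 1:]) * pderiv (smult L D) = smult L ((\<Prod>a\<in>?A. [:-a, 1:]) * pderiv D)"
    by (simp add: pderiv_smult)
  also have "\<dots> = q * smult L D" unfolding q by simp
  finally show ?thesis using that unfolding P by blast
qed

text \<open>Each root has order at least 1 and the orders sum to at most the degree, which is the
  number of roots.\<close>

lemma rsquarefree_card_roots:
  fixes Q :: "complex poly"
  assumes "Q \<noteq> 0" "card {a. poly Q a = 0} = degree Q"
  shows "rsquarefree Q"
  unfolding rsquarefree_def
proof (intro conjI allI \<open>Q \<noteq> 0\<close>)
  fix a
  let ?A = "{a. poly Q a = 0}"
  have fin: "finite ?A" using assms poly_roots_finite by blast
  have ge: "order x Q \<ge> 1" if "x \<in> ?A" for x
    using that assms(1) by (simp add: order_root Suc_le_eq)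
  show "order a Q = 0 \<or> order a Q = 1"
  proof (cases "poly Q a = 0")
    case False
    then show ?thesis by (simp add: order_0I)
  next
    case True
    have "(\<Sum>x\<in>?A. order x Q) \<le> card ?A" using sum_order_le_degree[OF assms(1)] assms(2) by simp
    moreover have "card ?A < (\<Sum>x\<in>?A. order x Q)" if "order a Q > 1"
    proof -
      have "(\<Sum>x\<in>?A. 1) < (\<Sum>x\<in>?A. order x Q)"
        by (rule sum_strict_mono_ex1[OF fin]) (use ge that True in auto)
      then show ?thesis by simp
    qed
    ultimately show ?thesis using ge[of a] True by force
  qed
qed

text \<open>Every point of \<open>A\<close> other than the one nearest to \<open>x\<close> is at
  distance at least \<open>\<sigma>\<close>, half the minimal separation. Together with
  \<open>|x| \<le> M + |x - b|\<close> this makes the distance comparable to \<open>1 + |x|\<close>,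
  both near \<open>A\<close> and near infinity.\<close>

lemma nearest_point_separation:
  fixes A :: "complex set"
  assumes fin: "finite A" and ne: "A \<noteq> {}"
  obtains \<delta> where "\<delta> > 0" "\<And>x. \<exists>a\<in>A. \<forall>b\<in>A - {a}. \<delta> * (1 + norm x) \<le> norm (x - b)"
proof -
  \<comment> \<open>Inserting 1 keeps \<open>D\<close> nonempty when \<open>A\<close> is a
    singleton.\<close>
  define D where "D = insert 1 ((\<lambda>(a, b). norm (a - b)) ` {(a, b). a \<in> A \<and> b \<in> A \<and> a \<noteq> b})"
  have "finite D"
    unfolding D_def by (intro finite.insertI finite_imageI finite_subset[OF _ finite_cartesian_product[OF fin fin]]) auto
  define \<sigma> where "\<sigma> = Min D / 2"
  have \<sigma>: "\<sigma> > 0" unfolding \<sigma>_def using \<open>finite D\<close> by (auto simp: D_def Min_gr_iff)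
  have sep: "norm (a - b) \<ge> 2 * \<sigma>" if "a \<in> A" "b \<in> A" "a \<noteq> b" for a b
  proof -
    have "norm (a - b) \<in> D" unfolding D_def using that by force
    then show ?thesis unfolding \<sigma>_def using Min_le[OF \<open>finite D\<close>] by simp
  qed
  obtain M where M: "\<And>a. a \<in> A \<Longrightarrow> norm a \<le> M"
    using finite_imp_bounded[OF fin] unfolding bounded_iff by blast
  have M0: "M \<ge> 0" using ne M norm_ge_zero by (metis all_not_in_conv order_trans)
  define \<kappa> where "\<kappa> = (1 + M) / \<sigma> + 1"
  have \<kappa>: "\<kappa> > 0" using \<sigma> M0 by (simp add: \<kappa>_def add_nonneg_pos)
  show ?thesis
  proof (rule that[of "1 / \<kappa>"])
    show "1 / \<kappa> > 0" using \<kappa> by simp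
    fix x
    obtain a where a: "a \<in> A" "\<And>b. b \<in> A \<Longrightarrow> norm (x - a) \<le> norm (x - b)"
      using ex_is_arg_min_if_finite[OF fin ne, of "\<lambda>a. norm (x - a)"] 
      by (auto simp: is_arg_min_linorder)
    show "\<exists>a\<in>A. \<forall>b\<in>A - {a}. 1 / \<kappa> * (1 + norm x) \<le> norm (x - b)"
    proof (intro bexI[OF _ a(1)] ballI)
      fix b assume b: "b \<in> A - {a}"
      have "norm (a - b) \<le> norm (x - a) + norm (x - b)"
        by (metis norm_minus_commute norm_triangle_ineq4 add_diff_cancel_left' diff_diff_eq2 diff_add_cancel)
      then have s: "\<sigma> \<le> norm (x - b)" using sep[of a b] a b by force
      have "norm x \<le> norm b + norm (x - b)" by (metis norm_triangle_sub)
      then have "1 + norm x \<le> (1 + M) + norm (x - b)" using M[of b] b by simp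
      also have "1 + M \<le> (1 + M) / \<sigma> * norm (x - b)"
        using s \<sigma> M0 mult_left_mono[OF s, of "(1 + M) / \<sigma>"] by simp
      finally have "1 + norm x \<le> \<kappa> * norm (x - b)" by (simp add: \<kappa>_def algebra_simps)
      then show "1 / \<kappa> * (1 + norm x) \<le> norm (x - b)" using \<kappa> by (simp add: field_simps)
    qed
  qed
qed

lemma norm_root_prod_upper:
  fixes A :: "complex set"
  assumes fin: "finite A"
  obtains c where "c \<ge> 1" "\<And>x. norm (\<Prod>a\<in>A. x - a) \<le> c * (1 + norm x) ^ card A"
proof -
  obtain M where M: "\<And>a. a \<in> A \<Longrightarrow> norm a \<le> M"
    using finite_imp_bounded[OF fin] unfolding bounded_iff by blast
  show ?thesis
  proof (rule that[of "(1 + \<bar>M\<bar>) ^ card A"])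
    show "(1 + \<bar>M\<bar>) ^ card A \<ge> 1" by (simp add: one_le_power)
    fix x
    have "norm (\<Prod>a\<in>A. x - a) = (\<Prod>a\<in>A. norm (x - a))" by (simp add: prod_norm)
    also have "\<dots> \<le> (\<Prod>a\<in>A. (1 + \<bar>M\<bar>) * (1 + norm x))"
    proof (rule prod_mono)
      fix a assume "a \<in> A"
      have "norm (x - a) \<le> norm x + norm a" by (rule norm_triangle_ineq4)
      also have "\<dots> \<le> (1 + \<bar>M\<bar>) * (1 + norm x)"
      proof -
        have "0 \<le> \<bar>M\<bar> * norm x" by simp
        moreover have "norm a \<le> \<bar>M\<bar>" using M[OF \<open>a \<in> A\<close>] by linarith
        ultimately show ?thesis unfolding distrib_left distrib_right mult_1_left mult_1_right by linarith
      qed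
      finally show "0 \<le> norm (x - a) \<and> norm (x - a) \<le> (1 + \<bar>M\<bar>) * (1 + norm x)" by simp
    qed
    also have "\<dots> = (1 + \<bar>M\<bar>) ^ card A * (1 + norm x) ^ card A" by (simp add: power_mult_distrib)
    finally show "norm (\<Prod>a\<in>A. x - a) \<le> (1 + \<bar>M\<bar>) ^ card A * (1 + norm x) ^ card A" .
  qed
qed

text \<open>For the point \<open>a\<close> nearest to \<open>x\<close>, all other factors of the
  product over \<open>S \<union> Z\<close> are of size at least \<open>\<delta> (1 + |x|)\<close>,
  which bounds \<open>|x - a|\<close> above by that product. Squaring yields one spare factor
  \<open>|\<Prod>b\<in>S. x - b|\<close>; the rest is estimated by powers of \<open>1 + |x|\<close>.
  For \<open>S\<close> the roots of \<open>Q\<close> and \<open>Z\<close> those of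
  \<open>Q'\<close>, this bounds \<open>|h'|^2 |R(h)|^2 (1 + |h|) / |Q(h)|\<close> by squares of
  logarithmic derivatives.\<close>

lemma root_product_inequality:
  fixes S Z :: "complex set"
  assumes S: "finite S" and Z: "finite Z" and disj: "S \<inter> Z = {}" and card: "2 * card Z + 3 \<le> card S"
  obtains C where "C > 0" "\<And>x. \<exists>a\<in>S \<union> Z. (norm (x - a))^2 * (norm (\<Prod>b\<in>Z. x - b))^2 * (1 + norm x)
     \<le> C * norm (\<Prod>b\<in>S. x - b)"
proof -
  let ?A = "S \<union> Z"
  define m where "m = card ?A - 1"
  have cA: "card ?A = card S + card Z" using S Z disj by (simp add: card_Un_disjoint)
  have fA: "finite ?A" using S Z by simp
  have "?A \<noteq> {}" using card by auto
  then obtain \<delta> where \<delta>: "\<delta> > 0" "\<And>x. \<exists>a\<in>?A. \<forall>b\<in>?A - {a}. \<delta> * (1 + norm x) \<le> norm (x - b)"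
    using nearest_point_separation[OF fA] by metis
  obtain c1 where c1: "c1 \<ge> 1" "\<And>x. norm (\<Prod>a\<in>S. x - a) \<le> c1 * (1 + norm x) ^ card S"
    using norm_root_prod_upper[OF S] by metis
  obtain c2 where c2: "c2 \<ge> 1" "\<And>x. norm (\<Prod>a\<in>Z. x - a) \<le> c2 * (1 + norm x) ^ card Z"
    using norm_root_prod_upper[OF Z] by metis
  show ?thesis
  proof (rule that[of "c1 * c2 ^ 4 / (\<delta> ^ m)^2"])
    show "c1 * c2 ^ 4 / (\<delta> ^ m)^2 > 0" using c1(1) c2(1) \<delta>(1) by simp
    fix x
    obtain a where a: "a \<in> ?A" and near: "\<And>b. b \<in> ?A - {a} \<Longrightarrow> \<delta> * (1 + norm x) \<le> norm (x - b)"
      using \<delta>(2) by blast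
    define q where "q = norm (\<Prod>b\<in>S. x - b)"
    define p where "p = norm (\<Prod>b\<in>Z. x - b)"
    define u where "u = 1 + norm x"
    have u: "u \<ge> 1" by (simp add: u_def)
    have qp: "q \<ge> 0" "p \<ge> 0" by (auto simp: q_def p_def)
    have "norm (x - a) * (\<delta> * u) ^ m \<le> norm (x - a) * (\<Prod>b\<in>?A - {a}. norm (x - b))"
    proof (rule mult_left_mono)
      have "(\<delta> * u) ^ m = (\<Prod>b\<in>?A - {a}. \<delta> * u)" using fA a by (simp add: m_def card_Diff_singleton)
      also have "\<dots> \<le> (\<Prod>b\<in>?A - {a}. norm (x - b))"
        using near \<delta>(1) u by (intro prod_mono) (auto simp: u_def)
      finally show "(\<delta> * u) ^ m \<le> (\<Prod>b\<in>?A - {a}. norm (x - b))" .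
    qed auto
    also have "\<dots> = (\<Prod>b\<in>?A. norm (x - b))" using fA a by (simp add: prod.remove[of ?A a])
    also have "\<dots> = q * p" unfolding q_def p_def using S Z disj by (simp add: prod.union_disjoint prod_norm norm_mult)
    finally have "(norm (x - a) * (\<delta> * u) ^ m)^2 \<le> (q * p)^2"
      using \<delta>(1) u by (intro power_mono) auto
    then have "(norm (x - a) * (\<delta> * u) ^ m)^2 * (p^2 * u) \<le> (q * p)^2 * (p^2 * u)"
      using u by (intro mult_right_mono) auto
    also have "\<dots> = q * (q * p^4 * u)" by (simp add: power2_eq_square power4_eq_xxxx)
    also have "\<dots> \<le> q * ((c1 * u ^ card S) * (c2 * u ^ card Z)^4 * u)"
      using c1 c2 u qp by (intro mult_left_mono mult_right_mono mult_mono power_mono) (auto simp: q_def p_def u_def)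
    also have "\<dots> = q * (c1 * c2 ^ 4) * u ^ (card S + 4 * card Z + 1)"
      by (simp add: power_mult_distrib power_add mult.commute[of 4] flip: power_mult)
    \<comment> \<open>The comparison of exponents
      \<open>card S + 4 card Z + 1 \<le> 2 (card S + card Z - 1)\<close> is equivalent to the
      hypothesis \<open>2 card Z + 3 \<le> card S\<close>.\<close>
    also have "\<dots> \<le> q * (c1 * c2 ^ 4) * u ^ (2 * m)"
      using card cA u qp c1(1) c2(1) by (intro mult_left_mono power_increasing) (auto simp: m_def)
    also have "u ^ (2 * m) = (u ^ m)^2" by (metis mult.commute power_mult)
    also have "(norm (x - a) * (\<delta> * u) ^ m)^2 * (p^2 * u) = (norm (x - a))^2 * p^2 * u * (\<delta> ^ m)^2 * (u ^ m)^2"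
      by (simp add: power_mult_distrib mult_ac)
    finally have "(norm (x - a))^2 * p^2 * u * (\<delta> ^ m)^2 * (u ^ m)^2 \<le> q * (c1 * c2 ^ 4) * (u ^ m)^2" .
    then have "(norm (x - a))^2 * p^2 * u * (\<delta> ^ m)^2 \<le> q * (c1 * c2 ^ 4)"
      by (rule mult_right_le_imp_le) (use u in auto)
    then have "(norm (x - a))^2 * p^2 * u \<le> c1 * c2 ^ 4 / (\<delta> ^ m)^2 * q"
      using \<delta>(1) by (simp add: field_simps)
    then show "\<exists>a\<in>?A. (norm (x - a))^2 * (norm (\<Prod>b\<in>Z. x - b))^2 * (1 + norm x)
       \<le> c1 * c2 ^ 4 / (\<delta> ^ m)^2 * norm (\<Prod>b\<in>S. x - b)"
      using a unfolding q_def p_def u_def by blast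
  qed
qed

lemma poly_norm_bound:
  fixes P :: "complex poly"
  shows "\<exists>c\<ge>1. \<exists>n. \<forall>x. norm (poly P x) \<le> c * (1 + norm x) ^ n"
proof (induction P)
  case 0
  then show ?case by (intro exI[of _ 1]) auto
next
  case (pCons a P)
  then obtain c n where c: "c \<ge> 1" "\<And>x. norm (poly P x) \<le> c * (1 + norm x) ^ n" by blast
  show ?case
  proof (intro exI[of _ "norm a + c"] exI[of _ "Suc n"] conjI allI)
    show "norm a + c \<ge> 1" using c(1) by (simp add: add_increasing)
    fix x
    have "norm (poly (pCons a P) x) \<le> norm a + norm x * norm (poly P x)"
      by (simp add: norm_triangle_ineq[THEN order_trans] norm_mult)
    also have "norm x * norm (poly P x) \<le> (1 + norm x) * (c * (1 + norm x) ^ n)"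
      using c by (intro mult_mono) auto
    finally have "norm (poly (pCons a P) x) \<le> norm a * 1 + c * (1 + norm x) ^ Suc n"
      by (simp add: mult.left_commute)
    also have "\<dots> \<le> norm a * (1 + norm x) ^ Suc n + c * (1 + norm x) ^ Suc n"
      by (intro add_right_mono mult_left_mono one_le_power) auto
    finally show "norm (poly (pCons a P) x) \<le> (norm a + c) * (1 + norm x) ^ Suc n"
      by (simp only: distrib_right)
  qed
qed

section \<open>The auxiliary function and its zeros\<close>

text \<open>Local divisibility at the zeros of \<open>M\<close> suffices: the local quotient
  supplies the value of \<open>W\<close> there, and \<open>N = M * W\<close> extends from the set
  where \<open>M\<close> is nonzero by continuation.\<close>

lemma entire_quotient:
  assumes N: "N holomorphic_on UNIV" and M: "M holomorphic_on UNIV" "M w0 \<noteq> 0"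
    and k: "\<And>z0. M z0 = 0 \<Longrightarrow> \<exists>r>0. \<exists>k. k holomorphic_on ball z0 r \<and> (\<forall>w\<in>ball z0 r - {z0}. N w = M w * k w)"
  obtains W where "W holomorphic_on UNIV" "\<And>z. N z = M z * W z"
proof -
  from k obtain r k where r: "\<And>z0. M z0 = 0 \<Longrightarrow> r z0 > 0"
    and k: "\<And>z0. M z0 = 0 \<Longrightarrow> k z0 holomorphic_on ball z0 (r z0)"
    and eq: "\<And>z0 w. M z0 = 0 \<Longrightarrow> w \<in> ball z0 (r z0) - {z0} \<Longrightarrow> N w = M w * k z0 w"
    by metis
  define W where "W z = (if M z = 0 then k z z else N z / M z)" for z
  have Mc: "continuous_on UNIV M" using M(1) by (rule holomorphic_on_imp_continuous_on)
  have op: "open {z. M z \<noteq> 0}"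
  proof -
    have "{z. M z \<noteq> 0} = M -` (- {0})" by auto
    then show ?thesis using continuous_on_open_vimage[OF open_UNIV] Mc by (metis open_Compl closed_singleton Int_UNIV_right)
  qed
  have "\<exists>e>0. W holomorphic_on ball z e" for z
  proof (cases "M z = 0")
    case True
    obtain e where e: "e > 0" "\<And>w. w \<in> ball z e - {z} \<Longrightarrow> M w \<noteq> 0"
      using isolated_zeros[OF M(1) open_UNIV connected_UNIV UNIV_I True UNIV_I M(2)] by metis
    have "W holomorphic_on ball z (min e (r z))"
    proof (rule holomorphic_transform[OF holomorphic_on_subset[OF k[OF True]]])
      fix w assume w: "w \<in> ball z (min e (r z))"
      show "k z w = W w"
      proof (cases "w = z")
        case False
        then have "M w \<noteq> 0" "N w = M w * k z w" using e(2)[of w] eq[OF True, of w] w by auto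
        then show ?thesis by (simp add: W_def)
      qed (simp add: W_def True)
    qed auto
    then show ?thesis using e r[OF True] by (intro exI[of _ "min e (r z)"]) auto
  next
    case False
    then obtain e where e: "e > 0" "ball z e \<subseteq> {z. M z \<noteq> 0}" using op by (auto simp: open_contains_ball)
    have "(\<lambda>w. N w / M w) holomorphic_on ball z e"
      using e by (intro holomorphic_intros entire_subset[OF N] entire_subset[OF M(1)]) auto
    then have "W holomorphic_on ball z e"
      by (rule holomorphic_transform) (use e in \<open>auto simp: W_def\<close>)
    then show ?thesis using e by blast
  qed
  then have "W analytic_on UNIV" by (simp add: analytic_on_def)
  then have W: "W holomorphic_on UNIV" by (rule analytic_imp_holomorphic)
  have "N z = M z * W z" for z
  proof (rule analytic_continuation_open[OF op open_UNIV _ connected_UNIV _ N])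
    show "(\<lambda>z. M z * W z) holomorphic_on UNIV" by (intro holomorphic_intros M W)
  qed (use M(2) in \<open>auto simp: W_def\<close>)
  with W show ?thesis using that by blast
qed

text \<open>
  With \<open>F = Q(f)\<close> and \<open>R Q'' = q Q'\<close>, the functions \<open>radB\<close> and \<open>radA\<close> are \<open>F'\<close> and \<open>F''\<close> multiplied by
  \<open>R(f) / Q'(f)\<close>, written without the denominator; \<open>auxE\<close> is the function \<open>E\<close> of the introduction.
\<close>
definition radB :: "complex poly \<Rightarrow> (complex \<Rightarrow> complex) \<Rightarrow> complex \<Rightarrow> complex" where
  "radB R f z = deriv f z * poly R (f z)"

definition radA :: "complex poly \<Rightarrow> complex poly \<Rightarrow> (complex \<Rightarrow> complex) \<Rightarrow> complex \<Rightarrow> complex" where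
  "radA R q f z = (deriv f z)\<^sup>2 * poly q (f z) + deriv (deriv f) z * poly R (f z)"

definition auxE :: "complex poly \<Rightarrow> complex poly \<Rightarrow> complex poly \<Rightarrow> (complex \<Rightarrow> complex) \<Rightarrow> (complex \<Rightarrow> complex) \<Rightarrow> complex \<Rightarrow> complex" where
  "auxE Q R q f g z = (radA R q f z * radB R g z - radA R q g z * radB R f z) * poly Q (f z) * poly Q (g z)
     - 2 * radB R f z * radB R g z *
       (deriv (\<lambda>w. poly Q (f w)) z * poly Q (g z) - deriv (\<lambda>w. poly Q (g w)) z * poly Q (f z))"

lemma auxE_swap: "auxE Q R q g f z = - auxE Q R q f g z"
  by (simp add: auxE_def algebra_simps)

lemma holomorphic_on_poly_comp [holomorphic_intros]:
  "f holomorphic_on A \<Longrightarrow> (\<lambda>z. poly P (f z)) holomorphic_on A"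
  by (induction P) (auto intro!: holomorphic_intros)

lemma entire_deriv: "f holomorphic_on UNIV \<Longrightarrow> deriv f holomorphic_on UNIV"
  by (rule holomorphic_deriv) auto

lemma entire_has_deriv: "f holomorphic_on UNIV \<Longrightarrow> (f has_field_derivative deriv f z) (at z)"
  using holomorphic_derivI open_UNIV by blast

lemma auxE_entire:
  assumes f: "f holomorphic_on UNIV" and g: "g holomorphic_on UNIV"
  shows "auxE Q R q f g holomorphic_on UNIV"
proof -
  note d = entire_deriv[OF f] entire_deriv[OF g] entire_deriv[OF entire_deriv[OF f]] entire_deriv[OF entire_deriv[OF g]]
    entire_deriv[OF holomorphic_on_poly_comp[OF f]] entire_deriv[OF holomorphic_on_poly_comp[OF g]]
  show ?thesis
    unfolding auxE_def[abs_def] radA_def radB_def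
    by (intro holomorphic_on_diff holomorphic_on_mult holomorphic_on_add holomorphic_on_power holomorphic_on_const
        holomorphic_on_poly_comp f g d)
qed

lemma deriv_poly_comp:
  assumes "f holomorphic_on UNIV"
  shows "deriv (\<lambda>w. poly Q (f w)) = (\<lambda>z. poly (pderiv Q) (f z) * deriv f z)"
proof
  fix z
  show "deriv (\<lambda>w. poly Q (f w)) z = poly (pderiv Q) (f z) * deriv f z"
    by (rule DERIV_imp_deriv) (rule DERIV_chain2[OF poly_DERIV entire_has_deriv[OF assms]])
qed

lemma deriv2_poly_comp:
  assumes "f holomorphic_on UNIV"
  shows "deriv (deriv (\<lambda>w. poly Q (f w))) z
    = poly (pderiv (pderiv Q)) (f z) * (deriv f z)\<^sup>2 + poly (pderiv Q) (f z) * deriv (deriv f) z"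
  unfolding deriv_poly_comp[OF assms]
proof (rule DERIV_imp_deriv)
  have "((\<lambda>z. poly (pderiv Q) (f z) * deriv f z) has_field_derivative
     poly (pderiv (pderiv Q)) (f z) * deriv f z * deriv f z + deriv (deriv f) z * poly (pderiv Q) (f z)) (at z)"
    by (intro DERIV_mult DERIV_chain2[OF poly_DERIV entire_has_deriv[OF assms]] entire_has_deriv[OF entire_deriv[OF assms]])
  then show "((\<lambda>z. poly (pderiv Q) (f z) * deriv f z) has_field_derivative
     poly (pderiv (pderiv Q)) (f z) * (deriv f z)\<^sup>2 + poly (pderiv Q) (f z) * deriv (deriv f) z) (at z)"
    by (simp add: power2_eq_square mult.commute mult.left_commute)
qed

lemma radB_mult:
  assumes "f holomorphic_on UNIV"
  shows "poly (pderiv Q) (f z) * radB R f z = poly R (f z) * deriv (\<lambda>w. poly Q (f w)) z"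
  by (simp add: radB_def deriv_poly_comp[OF assms] algebra_simps)

lemma radA_mult:
  assumes "f holomorphic_on UNIV" and R: "R * pderiv (pderiv Q) = q * pderiv Q"
  shows "poly (pderiv Q) (f z) * radA R q f z = poly R (f z) * deriv (deriv (\<lambda>w. poly Q (f w))) z"
proof -
  have "poly R (f z) * poly (pderiv (pderiv Q)) (f z) = poly q (f z) * poly (pderiv Q) (f z)"
    using R by (metis poly_mult)
  then show ?thesis
    unfolding deriv2_poly_comp[OF assms(1)] radA_def by algebra
qed

lemma deriv_eq_on_open:
  assumes "open A" "z \<in> A" "\<And>w. w \<in> A \<Longrightarrow> f w = g w" "(g has_field_derivative D) (at z)"
  shows "deriv f z = D"
  using assms by (intro DERIV_imp_deriv) (metis has_field_derivative_transform_within_open)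

text \<open>
  The shape of \<open>F\<close>, \<open>radB\<close> and \<open>radA\<close> at a zero of \<open>F\<close> of order \<open>p\<close>; the factors \<open>w - z0\<close> on the left
  avoid the exponents \<open>p - 1\<close> and \<open>p - 2\<close>.
\<close>
definition zero_chart where
  "zero_chart Q R q f z0 p r U m \<longleftrightarrow> p \<ge> 1 \<and> r > 0 \<and> U holomorphic_on ball z0 r \<and> m holomorphic_on ball z0 r \<and>
    (\<forall>w\<in>ball z0 r. U w \<noteq> 0 \<and> poly Q (f w) = (w - z0) ^ p * U w \<and>
      (w - z0) * deriv (\<lambda>w. poly Q (f w)) w = (w - z0) ^ p * (of_nat p * U w + (w - z0) * deriv U w) \<and>
      (w - z0) * radB R f w = m w * (w - z0) ^ p * (of_nat p * U w + (w - z0) * deriv U w) \<and>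
      (w - z0)^2 * radA R q f w = m w * (w - z0) ^ p *
       (of_nat (p - 1) * (of_nat p * U w + (w - z0) * deriv U w)
         + (w - z0) * (of_nat (p + 1) * deriv U w + (w - z0) * deriv (deriv U) w)))"

text \<open>As \<open>a = f z0\<close> is a simple root of \<open>Q\<close>, the order of
  \<open>Q(f)\<close> at \<open>z0\<close> is the multiplicity of the \<open>a\<close>-point. In the
  proof \<open>Q'\<close> denotes the cofactor of \<open>z - a\<close> in \<open>Q\<close>, not the
  derivative. The disc is shrunk until neither the cofactor nor \<open>pderiv Q\<close> vanishes on
  the values of \<open>f\<close>, so that \<open>m = R(f) / pderiv Q (f)\<close> is
  holomorphic.\<close>

lemma local_form:
  assumes f: "f holomorphic_on UNIV" and nc: "\<exists>w. f w \<noteq> f z0"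
    and Q0: "poly Q (f z0) = 0" and Q1: "poly (pderiv Q) (f z0) \<noteq> 0"
    and R: "R * pderiv (pderiv Q) = q * pderiv Q"
  shows "\<exists>r U m. zero_chart Q R q f z0 (apoint_mult f (f z0) z0) r U m"
proof -
  define a where "a = f z0"
  define p where "p = apoint_mult f a z0"
  define u where "u = zor_poly (\<lambda>w. f w - a) z0"
  have "(if f z0 - a = 0 then zorder (\<lambda>w. f w - a) z0 > 0 else zorder (\<lambda>w. f w - a) z0 = 0) \<and>
     (\<exists>r. r>0 \<and> cball z0 r \<subseteq> UNIV \<and> u holomorphic_on cball z0 r
        \<and> (\<forall>w\<in>cball z0 r. f w - a = u w * (w-z0) ^ p \<and> u w \<noteq> 0))"
    unfolding p_def u_def apoint_mult_def
    by (rule zorder_exist_zero) (use f nc in \<open>auto intro!: holomorphic_intros simp: a_def\<close>)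
  then obtain r1 where p1: "p \<ge> 1" and r1: "r1 > 0" "u holomorphic_on cball z0 r1"
      "\<And>w. w\<in>cball z0 r1 \<Longrightarrow> f w - a = u w * (w-z0) ^ p \<and> u w \<noteq> 0"
    by (auto simp: p_def apoint_mult_def a_def)
  have "poly Q a = 0" using Q0 by (simp add: a_def)
  then obtain Q' where Q': "Q = [:-a, 1:] * Q'" unfolding poly_eq_0_iff_dvd by (elim dvdE)
  have Q'a: "poly Q' a \<noteq> 0"
  proof -
    have "poly (pderiv Q) a = poly Q' a" unfolding Q' pderiv_mult by (simp add: pderiv_pCons)
    then show ?thesis using Q1 by (simp add: a_def)
  qed
  have "isCont (\<lambda>w. poly Q' (f w) * poly (pderiv Q) (f w)) z0"
    using f by (intro continuous_intros continuous_on_interior[of UNIV f]) (auto intro: holomorphic_on_imp_continuous_on)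
  then have "((\<lambda>w. poly Q' (f w) * poly (pderiv Q) (f w)) \<longlongrightarrow> poly Q' (f z0) * poly (pderiv Q) (f z0)) (nhds z0)"
    by (simp add: isCont_def tendsto_nhds_iff)
  then have "\<forall>\<^sub>F w in nhds z0. poly Q' (f w) * poly (pderiv Q) (f w) \<noteq> 0"
    by (rule tendsto_imp_eventually_ne) (use Q'a Q1 in \<open>auto simp: a_def\<close>)
  then obtain r2 where r2: "r2 > 0" "\<And>w. dist w z0 < r2 \<Longrightarrow> poly Q' (f w) * poly (pderiv Q) (f w) \<noteq> 0"
    unfolding eventually_nhds_metric by blast
  define r where "r = min r1 r2"
  define U where "U w = u w * poly Q' (f w)" for w
  define m where "m w = poly R (f w) / poly (pderiv Q) (f w)" for w
  let ?B = "ball z0 r"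
  let ?V = "\<lambda>w. of_nat p * U w + (w - z0) * deriv U w"
  let ?V' = "\<lambda>w. of_nat (p + 1) * deriv U w + (w - z0) * deriv (deriv U) w"
  have nz: "poly Q' (f w) \<noteq> 0" "poly (pderiv Q) (f w) \<noteq> 0" if "w \<in> ?B" for w
    using r2(2)[of w] that by (auto simp: r_def dist_commute)
  have fw: "f w - a = u w * (w-z0) ^ p" "u w \<noteq> 0" if "w \<in> ?B" for w
    using r1(3)[of w] that by (auto simp: r_def)
  have Uh: "U holomorphic_on ?B"
    unfolding U_def by (intro holomorphic_intros holomorphic_on_subset[OF r1(2)] entire_subset[OF f]) (auto simp: r_def)
  have mh: "m holomorphic_on ?B"
    unfolding m_def using nz by (intro holomorphic_intros entire_subset[OF f]) auto
  have FU: "poly Q (f w) = (w - z0) ^ p * U w" if "w \<in> ?B" for w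
  proof -
    have "poly Q (f w) = (f w - a) * poly Q' (f w)" by (simp add: Q' algebra_simps)
    then show ?thesis using fw(1)[OF that] by (simp add: U_def)
  qed
  have dU: "(U has_field_derivative deriv U w) (at w)" if "w \<in> ?B" for w
    using Uh that holomorphic_derivI open_ball by blast
  have dU2: "(deriv U has_field_derivative deriv (deriv U) w) (at w)" if "w \<in> ?B" for w
    using holomorphic_deriv[OF Uh] that holomorphic_derivI open_ball by blast
  \<comment> \<open>For \<open>k = 0\<close> truncated subtraction changes the exponent, but the
    coefficient is 0. This occurs with \<open>k = p - 1\<close> at a simple zero.\<close>
  have pw: "of_nat k * x ^ (k - 1) * x = of_nat k * x ^ k" for k and x :: complex
    by (cases k) auto
  have dF: "deriv (\<lambda>w. poly Q (f w)) w = (w - z0) ^ (p - 1) * ?V w" if "w \<in> ?B" for w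
  proof (rule deriv_eq_on_open[OF open_ball that])
    show "poly Q (f w) = (w - z0) ^ p * U w" if "w \<in> ball z0 r" for w by (rule FU[OF that])
    have "((\<lambda>w. (w - z0) ^ p * U w) has_field_derivative
        (of_nat p * (w - z0) ^ (p - 1)) * U w + deriv U w * (w - z0) ^ p) (at w)"
      by (rule DERIV_mult[OF _ dU[OF that]]) (auto intro!: derivative_eq_intros)
    moreover have "(w - z0) ^ p = (w - z0) ^ (p - 1) * (w - z0)" using p1 by (cases p) auto
    ultimately show "((\<lambda>w. (w - z0) ^ p * U w) has_field_derivative (w - z0) ^ (p - 1) * ?V w) (at w)"
      by (simp add: algebra_simps)
  qed
  have dF2: "deriv (deriv (\<lambda>w. poly Q (f w))) w
      = of_nat (p - 1) * (w - z0) ^ (p - 1 - 1) * ?V w + ?V' w * (w - z0) ^ (p - 1)" if "w \<in> ?B" for w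
  proof (rule deriv_eq_on_open[OF open_ball that])
    show "deriv (\<lambda>w. poly Q (f w)) w = (w - z0) ^ (p - 1) * ?V w" if "w \<in> ball z0 r" for w by (rule dF[OF that])
    have "(?V has_field_derivative ?V' w) (at w)"
      using dU[OF that] dU2[OF that] by (auto intro!: derivative_eq_intros simp: algebra_simps)
    then show "((\<lambda>w. (w - z0) ^ (p - 1) * ?V w) has_field_derivative
       of_nat (p - 1) * (w - z0) ^ (p - 1 - 1) * ?V w + ?V' w * (w - z0) ^ (p - 1)) (at w)"
      by (intro DERIV_mult) (auto intro!: derivative_eq_intros)
  qed
  have zp: "(w - z0) * (w - z0) ^ (p - 1) = (w - z0) ^ p" for w
    using p1 by (cases p) auto
  have F1: "(w - z0) * deriv (\<lambda>w. poly Q (f w)) w = (w - z0) ^ p * ?V w" if "w \<in> ?B" for w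
    unfolding dF[OF that] zp[symmetric] by (simp only: mult.assoc)
  have F2: "(w - z0)^2 * deriv (deriv (\<lambda>w. poly Q (f w))) w
      = (w - z0) ^ p * (of_nat (p - 1) * ?V w + (w - z0) * ?V' w)" if "w \<in> ?B" for w
  proof -
    have "(w - z0)^2 * deriv (deriv (\<lambda>w. poly Q (f w))) w
      = (w - z0) * ((of_nat (p - 1) * (w - z0) ^ (p - 1 - 1) * (w - z0)) * ?V w + ?V' w * ((w - z0) * (w - z0) ^ (p - 1)))"
      unfolding dF2[OF that] power2_eq_square by (simp only: algebra_simps)
    also have "\<dots> = of_nat (p - 1) * ((w - z0) * (w - z0) ^ (p - 1)) * ?V w + (w - z0) * ?V' w * ((w - z0) * (w - z0) ^ (p - 1))"
      unfolding pw by (simp only: algebra_simps)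
    finally show ?thesis unfolding zp by (simp only: algebra_simps)
  qed
  have mB: "radB R f w = m w * deriv (\<lambda>w. poly Q (f w)) w" if "w \<in> ?B" for w
    using radB_mult[OF f, of Q w R] nz[OF that] by (simp add: m_def field_simps)
  have mA: "radA R q f w = m w * deriv (deriv (\<lambda>w. poly Q (f w))) w" if "w \<in> ?B" for w
    using radA_mult[OF f R, of w] nz[OF that] by (simp add: m_def field_simps)
  have "zero_chart Q R q f z0 p r U m"
    unfolding zero_chart_def
  proof (intro conjI ballI)
    show "r > 0" using r1 r2 by (simp add: r_def)
    show "U w \<noteq> 0" if "w \<in> ?B" for w using fw[OF that] nz[OF that] by (simp add: U_def)
    show "(w - z0) * radB R f w = m w * (w - z0) ^ p * ?V w" if "w \<in> ?B" for w
      using mB[OF that] F1[OF that] by (simp only: mult.assoc mult.left_commute)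
    show "(w - z0)^2 * radA R q f w = m w * (w - z0) ^ p * (of_nat (p - 1) * ?V w + (w - z0) * ?V' w)" if "w \<in> ?B" for w
      using mA[OF that] F2[OF that] by (simp only: mult.assoc mult.left_commute)
  qed (use p1 Uh mh FU F1 in auto)
  then show ?thesis unfolding p_def a_def by blast
qed

section \<open>Orders of vanishing of the auxiliary function\<close>

text \<open>To be read with \<open>z\<close> for \<open>w - z0\<close>, \<open>t\<close> and
  \<open>t'\<close> for its powers \<open>p\<close> and \<open>s\<close>, and
  \<open>e = p - 1\<close>, \<open>e' = s - 1\<close>. It shows that \<open>E\<close> vanishes to
  order at least \<open>2 (p + s) - 3\<close> at a common zero, and isolates the bracket in which
  further cancellation may happen.\<close>

lemma auxE_local_identity:
  fixes z :: complex
  assumes "z^2 * Af = m * t * (e * V + z * V1)" "z * Bf = m * t * V" "z * dF = t * V" "F = t * U"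
    and "z^2 * Ag = m' * t' * (e' * V' + z * V1')" "z * Bg = m' * t' * V'" "z * dG = t' * V'" "G = t' * U'"
  shows "z^3 * ((Af * Bg - Ag * Bf) * F * G - 2 * Bf * Bg * (dF * G - dG * F))
    = m * m' * (t * t')^2 * (((e * V + z * V1) * V' - (e' * V' + z * V1') * V) * U * U' - 2 * V * V' * (V * U' - V' * U))"
proof -
  have "z^3 * ((Af * Bg - Ag * Bf) * F * G - 2 * Bf * Bg * (dF * G - dG * F))
     = ((z^2 * Af) * (z * Bg) - (z^2 * Ag) * (z * Bf)) * F * G - 2 * (z * Bf) * (z * Bg) * ((z * dF) * G - (z * dG) * F)"
    by algebra
  also have "\<dots> = m * m' * (t * t')^2 * (((e * V + z * V1) * V' - (e' * V' + z * V1') * V) * U * U' - 2 * V * V' * (V * U' - V' * U))"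
    unfolding assms by algebra
  finally show ?thesis .
qed

text \<open>The counterpart at a zero of \<open>F\<close> alone: with \<open>t = z^p\<close> the
  order of \<open>E\<close> is at least \<open>2 p - 2\<close>.\<close>

lemma auxE_local_identity_one:
  fixes z :: complex
  assumes "z^2 * Af = m * t * (e * V + z * V1)" "z * Bf = m * t * V" "z * dF = t * V" "F = t * U"
  shows "z^2 * ((Af * Bg - Ag * Bf) * F * G - 2 * Bf * Bg * (dF * G - dG * F))
    = m * t^2 * (((e * V + z * V1) * Bg - z * Ag * V) * U * G - 2 * V * Bg * (V * G - z * dG * U))"
proof -
  have "z^2 * ((Af * Bg - Ag * Bf) * F * G - 2 * Bf * Bg * (dF * G - dG * F))
     = ((z^2 * Af) * Bg - z * Ag * (z * Bf)) * F * G - 2 * (z * Bf) * Bg * ((z * dF) * G - z * dG * F)"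
    by algebra
  also have "\<dots> = m * t^2 * (((e * V + z * V1) * Bg - z * Ag * V) * U * G - 2 * V * Bg * (V * G - z * dG * U))"
    unfolding assms by algebra
  finally show ?thesis .
qed

text \<open>With \<open>j\<close> extra factors split off from the bracket,
  \<open>E^2 / (F G)^3\<close> has order at least \<open>2 (2 (p + s) - 3 + j) - 3 (p + s)\<close>,
  which is \<open>p + s + 2 j - 6\<close>.\<close>

lemma common_zero_quotient_aux:
  fixes z E :: complex
  assumes z: "z \<noteq> 0" and U: "U \<noteq> 0" "U' \<noteq> 0" and le: "6 \<le> p + s + 2 * j"
    and E: "z^3 * E = m * m' * (z^p * z^s)^2 * (z^j * Y)"
  shows "E^2 = (z^p * U * (z^s * U'))^3 * (z^(p + s + 2 * j - 6) * (m * m' * Y)^2 / (U * U')^3)"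
proof -
  obtain d where d: "p + s + 2 * j = 6 + d" using le le_Suc_ex by blast
  have "z^6 * E^2 = (z^3 * E)^2" by (simp add: power_mult_distrib flip: power_mult)
  also have "\<dots> = (m * m' * Y)^2 * ((z^p * z^s)^3 * (z^(p + s + 2 * j)))"
    unfolding E by (simp add: power_mult_distrib power_add power2_eq_square power3_eq_cube mult_2)
  also have "z^(p + s + 2 * j) = z^6 * z^d" unfolding d by (rule power_add)
  finally have "z^6 * E^2 = z^6 * ((m * m' * Y)^2 * ((z^p * z^s)^3 * z^d))" by (simp add: mult_ac)
  then have "E^2 = (m * m' * Y)^2 * ((z^p * z^s)^3 * z^d)" using z by simp
  also have "\<dots> = (z^p * U * (z^s * U'))^3 * (z^d * (m * m' * Y)^2 / (U * U')^3)"
  proof -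
    have "(z^p * U * (z^s * U'))^3 = (z^p * z^s)^3 * (U * U')^3" by (simp add: power_mult_distrib)
    then show ?thesis using U by simp
  qed
  also have "d = p + s + 2 * j - 6" using d by simp
  finally show ?thesis .
qed

text \<open>The order count is \<open>2 (2 p - 2) - 3 p = p - 4\<close>.\<close>

lemma single_zero_quotient_aux:
  fixes z E :: complex
  assumes z: "z \<noteq> 0" and U: "U \<noteq> 0" "G \<noteq> 0" and le: "4 \<le> p"
    and E: "z^2 * E = m * (z^p)^2 * X"
  shows "E^2 = (z^p * U * G)^3 * (z^(p - 4) * (m * X)^2 / (U * G)^3)"
proof -
  obtain d where d: "p = 4 + d" using le le_Suc_ex by blast
  have "z^4 * E^2 = (z^2 * E)^2" by (simp add: power_mult_distrib flip: power_mult)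
  also have "\<dots> = (m * X)^2 * ((z^p)^3 * z^p)"
    unfolding E by (simp add: power_mult_distrib power2_eq_square power3_eq_cube)
  also have "z^p = z^4 * z^d" unfolding d by (rule power_add)
  finally have "z^4 * E^2 = z^4 * ((m * X)^2 * ((z^p)^3 * z^d))" unfolding d power_add by (simp add: mult_ac)
  then have "E^2 = (m * X)^2 * ((z^p)^3 * z^d)" using z by simp
  also have "\<dots> = (z^p * U * G)^3 * (z^d * (m * X)^2 / (U * G)^3)"
  proof -
    have "(z^p * U * G)^3 = (z^p)^3 * (U * G)^3" by (simp add: power_mult_distrib)
    then show ?thesis using U by simp
  qed
  also have "d = p - 4" using d by simp
  finally show ?thesis .
qed

text \<open>The requirement \<open>p + s + 2 j \<ge> 6\<close> holds with \<open>j = 0\<close> for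
  large orders. For equal orders the simple pole of \<open>H\<close> cancels, giving
  \<open>j = 1\<close>, which suffices from \<open>p = 2\<close> on; at common simple zeros
  \<open>H\<close> even vanishes, giving \<open>j = 2\<close>.\<close>

lemma auxE_quotient_common_zero:
  assumes f: "f holomorphic_on UNIV" "\<exists>w. f w \<noteq> f z0" and g: "g holomorphic_on UNIV" "\<exists>w. g w \<noteq> g z0"
    and Qf: "poly Q (f z0) = 0" "poly (pderiv Q) (f z0) \<noteq> 0"
    and Qg: "poly Q (g z0) = 0" "poly (pderiv Q) (g z0) \<noteq> 0"
    and R: "R * pderiv (pderiv Q) = q * pderiv Q"
    and mult: "apoint_mult f (f z0) z0 = apoint_mult g (g z0) z0 \<or>
      6 \<le> apoint_mult f (f z0) z0 + apoint_mult g (g z0) z0"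
  shows "\<exists>r>0. \<exists>k. k holomorphic_on ball z0 r \<and>
    (\<forall>w\<in>ball z0 r - {z0}. (auxE Q R q f g w)^2 = (poly Q (f w) * poly Q (g w))^3 * k w)"
proof -
  define p where "p = apoint_mult f (f z0) z0"
  obtain r U m where "zero_chart Q R q f z0 p r U m" using local_form[OF f Qf R] unfolding p_def by blast
  note cf = this[unfolded zero_chart_def]
  from cf have p: "p \<ge> 1" and r: "r > 0" and hol: "U holomorphic_on ball z0 r" "m holomorphic_on ball z0 r"
    and U: "\<And>w. w \<in> ball z0 r \<Longrightarrow> U w \<noteq> 0" and fF: "\<And>w. w \<in> ball z0 r \<Longrightarrow> poly Q (f w) = (w - z0) ^ p * U w"
    by blast+
  define s where "s = apoint_mult g (g z0) z0"
  obtain r' U' m' where "zero_chart Q R q g z0 s r' U' m'" using local_form[OF g Qg R] unfolding s_def by blast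
  note cg = this[unfolded zero_chart_def]
  from cg have r': "r' > 0" and hol': "U' holomorphic_on ball z0 r'" "m' holomorphic_on ball z0 r'"
    and U': "\<And>w. w \<in> ball z0 r' \<Longrightarrow> U' w \<noteq> 0" and gF: "\<And>w. w \<in> ball z0 r' \<Longrightarrow> poly Q (g w) = (w - z0) ^ s * U' w"
    by blast+
  let ?B = "ball z0 (min r r')"
  have sub: "?B \<subseteq> ball z0 r" "?B \<subseteq> ball z0 r'" by auto
  note d = holomorphic_deriv[OF hol(1) open_ball] holomorphic_deriv[OF hol'(1) open_ball]
  note d2 = holomorphic_deriv[OF d(1) open_ball] holomorphic_deriv[OF d(2) open_ball]
  have hh: "U holomorphic_on ?B" "m holomorphic_on ?B" "U' holomorphic_on ?B" "m' holomorphic_on ?B"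
    "deriv U holomorphic_on ?B" "deriv U' holomorphic_on ?B"
    "deriv (deriv U) holomorphic_on ?B" "deriv (deriv U') holomorphic_on ?B"
    using hol hol' d d2 sub by (blast intro: holomorphic_on_subset)+
  define V where "V w = of_nat p * U w + (w - z0) * deriv U w" for w
  define V1 where "V1 w = of_nat (p + 1) * deriv U w + (w - z0) * deriv (deriv U) w" for w
  define V' where "V' w = of_nat s * U' w + (w - z0) * deriv U' w" for w
  define V1' where "V1' w = of_nat (s + 1) * deriv U' w + (w - z0) * deriv (deriv U') w" for w
  define X where "X w = ((of_nat (p - 1) * V w + (w - z0) * V1 w) * V' w - (of_nat (s - 1) * V' w + (w - z0) * V1' w) * V w) * U w * U' w
     - 2 * V w * V' w * (V w * U' w - V' w * U w)" for w
  have Vh: "V holomorphic_on ?B" "V1 holomorphic_on ?B" "V' holomorphic_on ?B" "V1' holomorphic_on ?B"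
    unfolding V_def V1_def V'_def V1'_def by (intro holomorphic_intros hh)+
  have E: "(w - z0)^3 * auxE Q R q f g w = m w * m' w * ((w - z0)^p * (w - z0)^s)^2 * X w" if "w \<in> ?B" for w
  proof -
    have w: "w \<in> ball z0 r" "w \<in> ball z0 r'" using that by auto
    show ?thesis
      unfolding auxE_def X_def
      by (rule auxE_local_identity) (use cf cg w in \<open>simp_all only: V_def V1_def V'_def V1'_def\<close>)
  qed
  have "\<exists>j Y. Y holomorphic_on ?B \<and> 6 \<le> p + s + 2 * j \<and> (\<forall>w\<in>?B. X w = (w - z0)^j * Y w)"
  proof (cases "6 \<le> p + s")
    case True
    have "X holomorphic_on ?B" unfolding X_def by (intro holomorphic_intros hh Vh)
    then show ?thesis using True by (intro exI[of _ 0] exI[of _ X]) auto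
  next
    case False
    then have sp: "s = p" using mult by (simp add: p_def s_def)
    show ?thesis
    proof (cases "p \<ge> 2")
      case True
      \<comment> \<open>For \<open>s = p\<close> the terms with coefficient \<open>p - 1\<close>
        cancel, and both the remainder and \<open>V * U' - V' * U\<close> carry a factor
        \<open>w - z0\<close>.\<close>
      define Y where "Y w = U w * U' w * (V1 w * V' w - V1' w * V w) - 2 * V w * V' w * (deriv U w * U' w - deriv U' w * U w)" for w
      have "Y holomorphic_on ?B" unfolding Y_def by (intro holomorphic_intros hh Vh)
      moreover have "X w = (w - z0)^1 * Y w" for w
      proof -
        have eq: "V w * U' w - V' w * U w = (w - z0) * (deriv U w * U' w - deriv U' w * U w)"
          unfolding V_def V'_def sp by algebra
        show ?thesis unfolding X_def Y_def sp eq by (simp add: algebra_simps)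
      qed
      ultimately show ?thesis using True sp by (intro exI[of _ 1] exI[of _ Y]) auto
    next
      case False
      then have p1: "p = 1" using p by simp
      \<comment> \<open>At \<open>z0\<close> the quotient of the preceding case is
        \<open>p (1 - p)\<close> times \<open>U * U' * (deriv U * U' - deriv U' * U)\<close>, so for
        \<open>p = 1\<close> a second factor \<open>w - z0\<close> splits off.\<close>
      define Y where "Y w = U w * U' w * (deriv (deriv U) w * U' w - deriv (deriv U') w * U w
          + (w - z0) * (deriv (deriv U) w * deriv U' w - deriv (deriv U') w * deriv U w))
        - 2 * (deriv U w * U' w - deriv U' w * U w) * (U w * deriv U' w + deriv U w * U' w + (w - z0) * deriv U w * deriv U' w)" for w
      have "Y holomorphic_on ?B" unfolding Y_def by (intro holomorphic_intros hh)
      moreover have "X w = (w - z0)^2 * Y w" for w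
        unfolding X_def Y_def V_def V'_def V1_def V1'_def sp p1 by (simp add: power2_eq_square) algebra
      ultimately show ?thesis using p1 sp by (intro exI[of _ 2] exI[of _ Y]) auto
    qed
  qed
  then obtain j Y where Y: "Y holomorphic_on ?B" "6 \<le> p + s + 2 * j" "\<And>w. w \<in> ?B \<Longrightarrow> X w = (w - z0)^j * Y w" by blast
  define k where "k w = (w - z0)^(p + s + 2 * j - 6) * (m w * m' w * Y w)^2 / (U w * U' w)^3" for w
  have "k holomorphic_on ?B"
    unfolding k_def using U U' by (intro holomorphic_intros hh Y) auto
  moreover have "(auxE Q R q f g w)^2 = (poly Q (f w) * poly Q (g w))^3 * k w" if "w \<in> ?B - {z0}" for w
  proof -
    have w: "w \<in> ball z0 r" "w \<in> ball z0 r'" "w \<in> ?B" "w - z0 \<noteq> 0" using that by auto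
    show ?thesis
      unfolding k_def fF[OF w(1)] gF[OF w(2)]
      by (rule common_zero_quotient_aux[OF w(4) U[OF w(1)] U'[OF w(2)] Y(2)])
         (use E[OF w(3)] Y(3)[OF w(3)] in simp)
  qed
  ultimately show ?thesis using r r' by (intro exI[of _ "min r r'"]) auto
qed

lemma auxE_quotient_single_zero:
  assumes f: "f holomorphic_on UNIV" "\<exists>w. f w \<noteq> f z0" and g: "g holomorphic_on UNIV"
    and Qf: "poly Q (f z0) = 0" "poly (pderiv Q) (f z0) \<noteq> 0" and Qg: "poly Q (g z0) \<noteq> 0"
    and R: "R * pderiv (pderiv Q) = q * pderiv Q"
    and mult: "4 \<le> apoint_mult f (f z0) z0"
  shows "\<exists>r>0. \<exists>k. k holomorphic_on ball z0 r \<and>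
    (\<forall>w\<in>ball z0 r - {z0}. (auxE Q R q f g w)^2 = (poly Q (f w) * poly Q (g w))^3 * k w)"
proof -
  define p where "p = apoint_mult f (f z0) z0"
  obtain r U m where "zero_chart Q R q f z0 p r U m" using local_form[OF f Qf R] unfolding p_def by blast
  note cf = this[unfolded zero_chart_def]
  from cf have p: "p \<ge> 1" and r: "r > 0" and hol: "U holomorphic_on ball z0 r" "m holomorphic_on ball z0 r"
    and U: "\<And>w. w \<in> ball z0 r \<Longrightarrow> U w \<noteq> 0" and fF: "\<And>w. w \<in> ball z0 r \<Longrightarrow> poly Q (f w) = (w - z0) ^ p * U w"
    by blast+
  have Gh: "(\<lambda>w. poly Q (g w)) holomorphic_on UNIV" by (rule holomorphic_on_poly_comp[OF g])
  have "open ((\<lambda>w. poly Q (g w)) -` (- {0}))"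
    using Gh by (intro open_vimage) (auto intro: holomorphic_on_imp_continuous_on)
  then obtain r' where r': "r' > 0" "\<And>w. w \<in> ball z0 r' \<Longrightarrow> poly Q (g w) \<noteq> 0"
    using Qg by (force simp: open_contains_ball)
  let ?B = "ball z0 (min r r')"
  note d = holomorphic_deriv[OF hol(1) open_ball]
  note d2 = holomorphic_deriv[OF d open_ball]
  have hh: "U holomorphic_on ?B" "m holomorphic_on ?B" "deriv U holomorphic_on ?B" "deriv (deriv U) holomorphic_on ?B"
    using hol d d2 by (auto intro: holomorphic_on_subset)
  have gh: "g holomorphic_on ?B" "deriv g holomorphic_on ?B" "deriv (deriv g) holomorphic_on ?B"
    "deriv (\<lambda>w. poly Q (g w)) holomorphic_on ?B"
    using g Gh by (auto intro!: entire_subset entire_deriv)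
  have rh: "radB R g holomorphic_on ?B" "radA R q g holomorphic_on ?B"
    unfolding radA_def[abs_def] radB_def[abs_def]
    by (intro holomorphic_on_mult holomorphic_on_add holomorphic_on_power holomorphic_on_poly_comp gh)+
  define V where "V w = of_nat p * U w + (w - z0) * deriv U w" for w
  define V1 where "V1 w = of_nat (p + 1) * deriv U w + (w - z0) * deriv (deriv U) w" for w
  define X where "X w = ((of_nat (p - 1) * V w + (w - z0) * V1 w) * radB R g w - (w - z0) * radA R q g w * V w) * U w * poly Q (g w)
     - 2 * V w * radB R g w * (V w * poly Q (g w) - (w - z0) * deriv (\<lambda>w. poly Q (g w)) w * U w)" for w
  have Vh: "V holomorphic_on ?B" "V1 holomorphic_on ?B"
    unfolding V_def V1_def by (intro holomorphic_intros hh)+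
  have Xh: "X holomorphic_on ?B"
    unfolding X_def by (intro holomorphic_on_mult holomorphic_on_add holomorphic_on_diff holomorphic_on_const
      holomorphic_on_ident holomorphic_on_poly_comp hh gh rh Vh)
  have E: "(w - z0)^2 * auxE Q R q f g w = m w * ((w - z0)^p)^2 * X w" if "w \<in> ?B" for w
  proof -
    have w: "w \<in> ball z0 r" using that by auto
    show ?thesis
      unfolding auxE_def X_def
      by (rule auxE_local_identity_one) (use cf w in \<open>simp_all only: V_def V1_def\<close>)
  qed
  define k where "k w = (w - z0)^(p - 4) * (m w * X w)^2 / (U w * poly Q (g w))^3" for w
  have "k holomorphic_on ?B"
    unfolding k_def using U r'(2) by (intro holomorphic_on_divide holomorphic_on_mult holomorphic_on_power holomorphic_on_diff
      holomorphic_on_const holomorphic_on_ident holomorphic_on_poly_comp hh gh Xh) auto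
  moreover have "(auxE Q R q f g w)^2 = (poly Q (f w) * poly Q (g w))^3 * k w" if "w \<in> ?B - {z0}" for w
  proof -
    have w: "w \<in> ball z0 r" "w \<in> ball z0 r'" "w \<in> ?B" "w - z0 \<noteq> 0" using that by auto
    have p4: "4 \<le> p" using mult by (simp add: p_def)
    show ?thesis
      unfolding k_def fF[OF w(1)]
      by (rule single_zero_quotient_aux[OF w(4) U[OF w(1)] r'(2)[OF w(2)] p4 E[OF w(3)]])
  qed
  ultimately show ?thesis using r r' by (intro exI[of _ "min r r'"]) auto
qed

lemma E_weak_eq:
  assumes "finite S"
  shows "E_weak l S f z = (if f z \<in> S \<and> apoint_mult f (f z) z \<le> l then apoint_mult f (f z) z else 0)"
proof -
  have "E_weak l S f z = (\<Sum>a\<in>S. if f z = a then (if apoint_mult f (f z) z \<le> l then apoint_mult f (f z) z else 0) else 0)"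
    unfolding E_weak_def by (intro sum.cong) auto
  also have "\<dots> = (if f z \<in> S then (if apoint_mult f (f z) z \<le> l then apoint_mult f (f z) z else 0) else 0)"
    using assms by (rule sum.delta')
  finally show ?thesis by simp
qed

lemma apoint_mult_pos:
  assumes "f holomorphic_on UNIV" "\<exists>w. f w \<noteq> f z"
  shows "apoint_mult f (f z) z \<ge> 1"
proof -
  have "(if f z - f z = 0 then zorder (\<lambda>w. f w - f z) z > 0 else zorder (\<lambda>w. f w - f z) z = 0) \<and>
     (\<exists>r. r>0 \<and> cball z r \<subseteq> UNIV \<and> zor_poly (\<lambda>w. f w - f z) z holomorphic_on cball z r
        \<and> (\<forall>w\<in>cball z r. f w - f z = zor_poly (\<lambda>w. f w - f z) z w * (w-z) ^ nat (zorder (\<lambda>w. f w - f z) z)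
          \<and> zor_poly (\<lambda>w. f w - f z) z w \<noteq> 0))"
    by (rule zorder_exist_zero) (use assms in \<open>auto intro!: holomorphic_intros\<close>)
  then show ?thesis by (auto simp: apoint_mult_def)
qed

text \<open>Weight 3 yields exactly the local alternatives needed: at a common zero the
  multiplicities agree or both are at least 4, and a zero of only one of \<open>Q(f)\<close>,
  \<open>Q(g)\<close> has multiplicity at least 4.\<close>

lemma auxE_quotient:
  assumes f: "f holomorphic_on UNIV" "\<And>z. \<exists>w. f w \<noteq> f z" and g: "g holomorphic_on UNIV" "\<And>z. \<exists>w. g w \<noteq> g z"
    and Q: "rsquarefree Q" and R: "R * pderiv (pderiv Q) = q * pderiv Q"
    and w0: "poly Q (f w0) \<noteq> 0" "poly Q (g w0) \<noteq> 0"
    and share: "E_weak 3 {a. poly Q a = 0} f = E_weak 3 {a. poly Q a = 0} g"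
  shows "\<exists>W. W holomorphic_on UNIV \<and> (\<forall>z. (auxE Q R q f g z)^2 = (poly Q (f z) * poly Q (g z))^3 * W z)"
proof -
  let ?S = "{a. poly Q a = 0}"
  have fin: "finite ?S" using Q poly_roots_finite by (auto simp: rsquarefree_def)
  have Q': "poly (pderiv Q) a \<noteq> 0" if "poly Q a = 0" for a
    using Q that by (simp add: rsquarefree_roots)
  have sh: "(if f z \<in> ?S \<and> apoint_mult f (f z) z \<le> 3 then apoint_mult f (f z) z else 0)
     = (if g z \<in> ?S \<and> apoint_mult g (g z) z \<le> 3 then apoint_mult g (g z) z else 0)" for z
    using share unfolding E_weak_eq[OF fin, symmetric] by metis
  have N: "(\<lambda>z. (auxE Q R q f g z)^2) holomorphic_on UNIV"
    by (intro holomorphic_on_power auxE_entire f g)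
  have M: "(\<lambda>z. (poly Q (f z) * poly Q (g z))^3) holomorphic_on UNIV"
    by (intro holomorphic_on_power holomorphic_on_mult holomorphic_on_poly_comp f g)
  have M0: "(poly Q (f w0) * poly Q (g w0))^3 \<noteq> 0" using w0 by simp
  have loc: "\<exists>r>0. \<exists>k. k holomorphic_on ball z0 r \<and>
    (\<forall>w\<in>ball z0 r - {z0}. (auxE Q R q f g w)^2 = (poly Q (f w) * poly Q (g w))^3 * k w)"
    if z0: "(poly Q (f z0) * poly Q (g z0))^3 = 0" for z0
  proof -
    have pf: "apoint_mult f (f z0) z0 \<ge> 1" and pg: "apoint_mult g (g z0) z0 \<ge> 1"
      using apoint_mult_pos f g by blast+
    consider "poly Q (f z0) = 0" "poly Q (g z0) = 0" | "poly Q (f z0) = 0" "poly Q (g z0) \<noteq> 0"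
      | "poly Q (f z0) \<noteq> 0" "poly Q (g z0) = 0" using z0 by auto
    then show ?thesis
    proof cases
      case 1
      have "apoint_mult f (f z0) z0 = apoint_mult g (g z0) z0 \<or>
         6 \<le> apoint_mult f (f z0) z0 + apoint_mult g (g z0) z0"
        using sh[of z0] 1 pf pg by (auto split: if_splits)
      then show ?thesis
        using 1 Q' by (intro auxE_quotient_common_zero f g R) auto
    next
      case 2
      have "4 \<le> apoint_mult f (f z0) z0" using sh[of z0] 2 pf by (auto split: if_splits)
      then show ?thesis using 2 Q' by (intro auxE_quotient_single_zero f g R) auto
    next
      case 3
      have "4 \<le> apoint_mult g (g z0) z0" using sh[of z0] 3 pg by (auto split: if_splits)
      \<comment> \<open>The roles of \<open>f\<close> and \<open>g\<close> are exchanged; this only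
        changes the sign of \<open>E\<close>, which the square removes.\<close>
      then have "\<exists>r>0. \<exists>k. k holomorphic_on ball z0 r \<and>
         (\<forall>w\<in>ball z0 r - {z0}. (auxE Q R q g f w)^2 = (poly Q (g w) * poly Q (f w))^3 * k w)"
        using 3 Q' by (intro auxE_quotient_single_zero f g R) auto
      then show ?thesis by (simp add: auxE_swap[of Q R q g f] mult.commute[of "poly Q (g _)"])
    qed
  qed
  show ?thesis by (rule entire_quotient[OF N M M0 loc]) (assumption, blast)
qed

section \<open>Uniqueness\<close>

text \<open>Near \<open>w0\<close> the factors \<open>R(f)\<close>, \<open>R(g)\<close> and the four
  functions \<open>F\<close>, \<open>G\<close>, \<open>F'\<close>, \<open>G'\<close> are nonzero, so
  \<open>E = 0\<close> becomes \<open>H = 0\<close>. Two integrations on a disc give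
  \<open>1/F = A/G + B\<close>; cleared of denominators, the relation extends to the plane.\<close>

lemma auxE_vanishing:
  assumes f: "f holomorphic_on UNIV" and g: "g holomorphic_on UNIV"
    and R: "R * pderiv (pderiv Q) = q * pderiv Q" and Rz: "\<And>x. poly R x = 0 \<Longrightarrow> poly (pderiv Q) x = 0"
    and w0: "poly Q (f w0) \<noteq> 0" "poly Q (g w0) \<noteq> 0"
      "deriv (\<lambda>z. poly Q (f z)) w0 \<noteq> 0" "deriv (\<lambda>z. poly Q (g z)) w0 \<noteq> 0"
    and E: "\<And>z. auxE Q R q f g z = 0"
  shows "\<exists>A B. A \<noteq> 0 \<and> (\<forall>z. poly Q (g z) - A * poly Q (f z) = B * poly Q (f z) * poly Q (g z))"
proof -
  define F where "F = (\<lambda>z. poly Q (f z))"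
  define G where "G = (\<lambda>z. poly Q (g z))"
  have hF: "F holomorphic_on UNIV" "deriv F holomorphic_on UNIV"
    and hG: "G holomorphic_on UNIV" "deriv G holomorphic_on UNIV"
    unfolding F_def G_def by (intro entire_deriv holomorphic_on_poly_comp f g)+
  have "open ((\<lambda>z. F z * G z * deriv F z * deriv G z) -` (- {0}))"
    by (intro open_vimage holomorphic_on_imp_continuous_on holomorphic_on_mult hF hG) auto
  moreover have "w0 \<in> (\<lambda>z. F z * G z * deriv F z * deriv G z) -` (- {0})"
    using w0 by (simp add: F_def G_def)
  ultimately obtain r where r: "r > 0" "ball w0 r \<subseteq> (\<lambda>z. F z * G z * deriv F z * deriv G z) -` (- {0})"
    unfolding open_contains_ball by blast
  let ?B = "ball w0 r"
  have nz: "F z \<noteq> 0" "G z \<noteq> 0" "deriv F z \<noteq> 0" "deriv G z \<noteq> 0" if "z \<in> ?B" for z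
    using r(2) that by auto
  have br: "(deriv (deriv F) z * deriv G z - deriv (deriv G) z * deriv F z) * F z * G z
     - 2 * deriv F z * deriv G z * (deriv F z * G z - deriv G z * F z) = 0" (is "?br = 0") if z: "z \<in> ?B" for z
  proof -
    have q: "poly (pderiv Q) (f z) \<noteq> 0" "poly (pderiv Q) (g z) \<noteq> 0"
      using nz(3,4)[OF z] by (auto simp: F_def G_def deriv_poly_comp[OF f] deriv_poly_comp[OF g])
    then have Rn: "poly R (f z) \<noteq> 0" "poly R (g z) \<noteq> 0" using Rz by blast+
    note Af = radA_mult[OF f R, of z, folded F_def] and Bf = radB_mult[OF f, of Q z R, folded F_def]
      and Ag = radA_mult[OF g R, of z, folded G_def] and Bg = radB_mult[OF g, of Q z R, folded G_def]
    have "poly (pderiv Q) (f z) * poly (pderiv Q) (g z) * auxE Q R q f g z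
      = ((poly (pderiv Q) (f z) * radA R q f z) * (poly (pderiv Q) (g z) * radB R g z)
        - (poly (pderiv Q) (g z) * radA R q g z) * (poly (pderiv Q) (f z) * radB R f z)) * F z * G z
       - 2 * (poly (pderiv Q) (f z) * radB R f z) * (poly (pderiv Q) (g z) * radB R g z) * (deriv F z * G z - deriv G z * F z)"
      unfolding auxE_def F_def G_def by algebra
    also have "\<dots> = poly R (f z) * poly R (g z) * ?br"
      unfolding Af Bf Ag Bg by algebra
    finally show ?thesis using E Rn by simp
  qed
  have dF: "(F has_field_derivative deriv F z) (at z)" "(deriv F has_field_derivative deriv (deriv F) z) (at z)"
    and dG: "(G has_field_derivative deriv G z) (at z)" "(deriv G has_field_derivative deriv (deriv G) z) (at z)" for z
    by (intro entire_has_deriv hF hG)+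
  \<comment> \<open>First integration: the function is \<open>(1/F)' / (1/G)'\<close>, whose
    logarithmic derivative is \<open>H\<close>.\<close>
  have "\<exists>A. \<forall>z\<in>?B. deriv F z * (G z * G z) / (deriv G z * (F z * F z)) = A"
  proof (rule has_field_derivative_zero_constant)
    fix z assume z: "z \<in> ?B"
    have "((\<lambda>z. deriv F z * (G z * G z) / (deriv G z * (F z * F z))) has_field_derivative
      ((deriv (deriv F) z * (G z * G z) + (deriv G z * G z + deriv G z * G z) * deriv F z) * (deriv G z * (F z * F z))
       - deriv F z * (G z * G z) * (deriv (deriv G) z * (F z * F z) + (deriv F z * F z + deriv F z * F z) * deriv G z))
       / ((deriv G z * (F z * F z)) * (deriv G z * (F z * F z)))) (at z)"
      by (intro DERIV_divide DERIV_mult dF dG) (use nz[OF z] in auto)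
    moreover have "(deriv (deriv F) z * (G z * G z) + (deriv G z * G z + deriv G z * G z) * deriv F z) * (deriv G z * (F z * F z))
       - deriv F z * (G z * G z) * (deriv (deriv G) z * (F z * F z) + (deriv F z * F z + deriv F z * F z) * deriv G z) = 0"
      using br[OF z] by algebra
    ultimately show "((\<lambda>z. deriv F z * (G z * G z) / (deriv G z * (F z * F z))) has_field_derivative 0) (at z within ?B)"
      by (auto intro: has_field_derivative_at_within)
  qed auto
  then obtain A where A: "\<And>z. z \<in> ?B \<Longrightarrow> deriv F z * (G z * G z) / (deriv G z * (F z * F z)) = A" by blast
  have w0B: "w0 \<in> ?B" using r by simp
  have A0: "A \<noteq> 0" using A[OF w0B] nz[OF w0B] by auto
  \<comment> \<open>Second integration: \<open>(1/F)' = A (1/G)'\<close>.\<close>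
  have "\<exists>B. \<forall>z\<in>?B. 1 / F z - A / G z = B"
  proof (rule has_field_derivative_zero_constant)
    fix z assume z: "z \<in> ?B"
    have "((\<lambda>z. 1 / F z - A / G z) has_field_derivative
       ((0 * F z - 1 * deriv F z) / (F z * F z) - (0 * G z - A * deriv G z) / (G z * G z))) (at z)"
      by (intro DERIV_diff DERIV_divide DERIV_const dF dG) (use nz[OF z] in auto)
    moreover have "(0 * F z - 1 * deriv F z) / (F z * F z) - (0 * G z - A * deriv G z) / (G z * G z) = 0"
      unfolding A[OF z, symmetric] using nz[OF z] by (simp add: field_simps)
    ultimately show "((\<lambda>z. 1 / F z - A / G z) has_field_derivative 0) (at z within ?B)"
      by (auto intro: has_field_derivative_at_within)
  qed auto
  then obtain B where B: "\<And>z. z \<in> ?B \<Longrightarrow> 1 / F z - A / G z = B" by blast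
  have "G z - A * F z = B * F z * G z" for z
  proof (rule analytic_continuation_open[of ?B UNIV "\<lambda>z. G z - A * F z" "\<lambda>z. B * F z * G z"])
    show "G z - A * F z = B * F z * G z" if "z \<in> ?B" for z
      unfolding B[OF that, symmetric] using nz[OF that] by (simp add: field_simps)
    show "(\<lambda>z. G z - A * F z) holomorphic_on UNIV" "(\<lambda>z. B * F z * G z) holomorphic_on UNIV"
      by (intro holomorphic_on_diff holomorphic_on_mult holomorphic_on_const hF hG)+
  qed (use r in auto)
  then show ?thesis using A0 unfolding F_def G_def by blast
qed

text \<open>If \<open>Q\<close> takes the value \<open>\<beta>\<close> at one point only, then
  \<open>Q - \<beta>\<close> is a constant multiple of a power of \<open>z - b\<close>, and its
  derivative vanishes at most at \<open>b\<close>.\<close>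

lemma card_pderiv_roots_le_1:
  fixes Q :: "complex poly"
  assumes "degree Q \<ge> 1" and b: "\<And>x. poly Q x = \<beta> \<Longrightarrow> x = b"
  shows "card {z. poly (pderiv Q) z = 0} \<le> 1"
proof -
  define P where "P = Q - [:\<beta>:]"
  have degP: "degree P \<ge> 1"
  proof (rule ccontr)
    assume "\<not> degree P \<ge> 1"
    then have "degree P = 0" by simp
    then obtain c where "P = [:c:]" by (rule degree_eq_zeroE)
    then have "Q = [:c + \<beta>:]" by (simp add: P_def diff_eq_eq)
    then show False using assms(1) by simp
  qed
  have sub: "{z. poly P z = 0} \<subseteq> {b}" using b by (auto simp: P_def)
  have "\<not> constant (poly P)" using degP constant_degree[of P] by simp
  then obtain z where "poly P z = 0" using fundamental_theorem_of_algebra by blast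
  then have rt: "{z. poly P z = 0} = {b}" using sub by auto
  define n where "n = order b P"
  define L where "L = lead_coeff P"
  have P: "P = smult L ([:-b, 1:] ^ n)"
    using complex_poly_decompose[of P] unfolding rt L_def n_def by simp
  have L: "L \<noteq> 0" using degP by (auto simp: L_def)
  have n: "n \<ge> 1"
  proof (rule ccontr)
    assume "\<not> n \<ge> 1"
    then have n0: "n = 0" by simp
    have "P = [:L:]" using P unfolding n0 by simp
    then show False using degP by simp
  qed
  have "pderiv Q = pderiv P" by (simp add: P_def pderiv_diff pderiv_pCons)
  also have "\<dots> = smult L (smult (of_nat n) ([:-b, 1:] ^ (n - 1) * pderiv [:-b, 1:]))"
    unfolding P pderiv_smult pderiv_power ..
  finally have "poly (pderiv Q) z = L * (of_nat n * (z - b) ^ (n - 1))" for z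
    by (simp add: pderiv_pCons poly_power)
  then have "{z. poly (pderiv Q) z = 0} \<subseteq> {b}" using L n by auto
  then show ?thesis by (metis card.empty card_mono finite.emptyI finite.insertI card_1_singleton_iff One_nat_def is_singletonI is_singleton_altdef)
qed

text \<open>A cosparse set contains a punctured neighbourhood of every point, so the two continuous
  functions have the same limit there.\<close>

lemma eq_everywhere_of_cosparse:
  fixes f g :: "complex \<Rightarrow> complex"
  assumes "f holomorphic_on UNIV" "g holomorphic_on UNIV" "\<forall>\<^sub>\<approx>z. f z = g z"
  shows "f z = g z"
proof -
  have "\<forall>\<^sub>F w in at z. f w = g w"
    using assms(3) by (rule eventually_cosparse_imp_eventually_at) auto
  moreover have "(f \<longlongrightarrow> f z) (at z)" "(g \<longlongrightarrow> g z) (at z)"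
    using assms(1,2) holomorphic_on_imp_continuous_on[of _ UNIV]
    by (auto simp: continuous_on_eq_continuous_at isCont_def)
  ultimately show ?thesis
    by (metis tendsto_cong tendsto_unique trivial_limit_at)
qed

lemma strong_uniqueness_entire:
  assumes "strong_uniqueness_poly P" "f holomorphic_on UNIV" "g holomorphic_on UNIV"
    and nc: "\<And>a. \<exists>w. f w \<noteq> a" "\<And>a. \<exists>w. g w \<noteq> a" and "\<alpha> \<noteq> 0"
    and eq: "\<And>z. poly P (f z) = \<alpha> * poly P (g z)"
  shows "f z = g z"
proof -
  have ncs: "\<not> (\<exists>a. \<forall>\<^sub>\<approx>z. h z = a)" if h: "h holomorphic_on UNIV" "\<And>a. \<exists>w. h w \<noteq> a" for h :: "complex \<Rightarrow> complex"
  proof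
    assume "\<exists>a. \<forall>\<^sub>\<approx>z. h z = a"
    then obtain a where "\<forall>\<^sub>\<approx>z. h z = a" by blast
    then have "h z = a" for z
      using eq_everywhere_of_cosparse[of h "\<lambda>_. a"] h(1) by (simp add: holomorphic_on_const)
    then show False using h(2) by blast
  qed
  have "f meromorphic_on UNIV" "g meromorphic_on UNIV"
    using assms(2,3) by (auto intro!: analytic_on_imp_meromorphic_on simp: analytic_on_open)
  moreover have "\<forall>\<^sub>\<approx>z. poly P (f z) = \<alpha> * poly P (g z)" using eq by (simp add: always_eventually)
  ultimately have "\<forall>\<^sub>\<approx>z. f z = g z"
    using assms(1) ncs[OF assms(2) nc(1)] ncs[OF assms(3) nc(2)] \<open>\<alpha> \<noteq> 0\<close>
    unfolding strong_uniqueness_poly_def by blast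
  then show ?thesis using assms(2,3) eq_everywhere_of_cosparse by blast
qed

text \<open>Dividing \<open>E = F G Bf Bg K\<close>, with \<open>K\<close> the function
  \<open>H\<close> of the overview, into the definition of \<open>W\<close> leaves
  \<open>W F G = (Bf Bg K)^2\<close>. The squares of \<open>Bf\<close> and \<open>Bg\<close>
  contribute \<open>L^2\<close> each and absorb \<open>F\<close>, \<open>G\<close> and the growth
  factors; \<open>K^2\<close> contributes \<open>36 L^2\<close>.\<close>

lemma auxE_pointwise_bound:
  assumes f: "f holomorphic_on UNIV" and g: "g holomorphic_on UNIV"
    and R: "R * pderiv (pderiv Q) = q * pderiv Q"
    and C: "C > 0" "\<And>x. \<exists>a\<in>A. (norm (x - a))^2 * (norm (poly R x))^2 * (1 + norm x) \<le> C * norm (poly Q x)"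
    and nz: "poly Q (f z) \<noteq> 0" "poly Q (g z) \<noteq> 0" "deriv (\<lambda>z. poly Q (f z)) z \<noteq> 0" "deriv (\<lambda>z. poly Q (g z)) z \<noteq> 0"
    and A: "f z \<notin> A" "g z \<notin> A"
    and L: "norm (deriv (\<lambda>z. poly Q (f z)) z / poly Q (f z)) \<le> L"
      "norm (deriv (\<lambda>z. poly Q (g z)) z / poly Q (g z)) \<le> L"
      "norm (deriv (deriv (\<lambda>z. poly Q (f z))) z / deriv (\<lambda>z. poly Q (f z)) z) \<le> L"
      "norm (deriv (deriv (\<lambda>z. poly Q (g z))) z / deriv (\<lambda>z. poly Q (g z)) z) \<le> L"
      "\<And>a. a \<in> A \<Longrightarrow> norm (deriv f z / (f z - a)) \<le> L" "\<And>a. a \<in> A \<Longrightarrow> norm (deriv g z / (g z - a)) \<le> L"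
    and W: "(auxE Q R q f g z)^2 = (poly Q (f z) * poly Q (g z))^3 * W"
  shows "norm W * ((1 + norm (f z)) * (1 + norm (g z))) \<le> 36 * C^2 * L^6"
proof -
  define F where "F = (\<lambda>z. poly Q (f z))"
  define G where "G = (\<lambda>z. poly Q (g z))"
  have nz: "F z \<noteq> 0" "G z \<noteq> 0" "deriv F z \<noteq> 0" "deriv G z \<noteq> 0"
    using nz unfolding F_def G_def by auto
  have FG: "poly Q (f z) = F z" "poly Q (g z) = G z" by (simp_all add: F_def G_def)
  \<comment> \<open>The point \<open>a\<close> of the root inequality depends on the value
    \<open>h z\<close>; \<open>L\<close> bounds \<open>h' / (h - a)\<close> for all candidates, so
    \<open>|h'| \<le> L |h - a|\<close> can be inserted for that \<open>a\<close>.\<close>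
  have Bb: "(norm (radB R h z))^2 * (1 + norm (h z)) \<le> C * L^2 * norm (poly Q (h z))"
    if "h z \<notin> A" "\<And>a. a \<in> A \<Longrightarrow> norm (deriv h z / (h z - a)) \<le> L" for h
  proof -
    obtain a where a: "a \<in> A" "(norm (h z - a))^2 * (norm (poly R (h z)))^2 * (1 + norm (h z)) \<le> C * norm (poly Q (h z))"
      using C(2) by blast
    have "h z - a \<noteq> 0" using that(1) a(1) by auto
    then have "norm (deriv h z) \<le> L * norm (h z - a)"
      using that(2)[OF a(1)] by (simp add: norm_divide field_simps)
    then have "(norm (deriv h z))^2 \<le> (L * norm (h z - a))^2" by (intro power_mono) auto
    then have "(norm (deriv h z))^2 * ((norm (poly R (h z)))^2 * (1 + norm (h z)))
       \<le> (L * norm (h z - a))^2 * ((norm (poly R (h z)))^2 * (1 + norm (h z)))"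
      by (rule mult_right_mono) auto
    also have "\<dots> = L^2 * ((norm (h z - a))^2 * (norm (poly R (h z)))^2 * (1 + norm (h z)))"
      by (simp add: power_mult_distrib mult_ac)
    also have "\<dots> \<le> L^2 * (C * norm (poly Q (h z)))" using a(2) by (intro mult_left_mono) auto
    finally show ?thesis by (simp add: radB_def norm_mult power_mult_distrib mult_ac)
  qed
  have A_eq: "radA R q h z = radB R h z * (deriv (deriv (\<lambda>z. poly Q (h z))) z / deriv (\<lambda>z. poly Q (h z)) z)"
    if h: "h holomorphic_on UNIV" "deriv (\<lambda>z. poly Q (h z)) z \<noteq> 0" for h
  proof -
    have q: "poly (pderiv Q) (h z) \<noteq> 0" using h(2) by (auto simp: deriv_poly_comp[OF h(1)])
    have "poly (pderiv Q) (h z) * (radA R q h z * deriv (\<lambda>z. poly Q (h z)) z)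
       = poly (pderiv Q) (h z) * (radB R h z * deriv (deriv (\<lambda>z. poly Q (h z))) z)"
      using radA_mult[OF h(1) R, of z] radB_mult[OF h(1), of Q z R] by algebra
    then have "radA R q h z * deriv (\<lambda>z. poly Q (h z)) z = radB R h z * deriv (deriv (\<lambda>z. poly Q (h z))) z"
      using q by simp
    then show ?thesis using h(2) by (simp add: field_simps)
  qed
  \<comment> \<open>The coefficients 1, 1, 2, 2 sum to the 6 in \<open>(6 * L)^2\<close>.\<close>
  define K where "K = deriv (deriv F) z / deriv F z - deriv (deriv G) z / deriv G z - 2 * (deriv F z / F z) + 2 * (deriv G z / G z)"
  define Bf where "Bf = radB R f z"
  define Bg where "Bg = radB R g z"
  have "norm (2 * (deriv F z / F z)) \<le> 2 * L" "norm (2 * (deriv G z / G z)) \<le> 2 * L"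
    using L(1,2) by (simp_all add: F_def G_def norm_mult norm_divide)
  then have "norm K \<le> L + L + 2 * L + 2 * L"
    unfolding K_def using L(3,4)[folded F_def G_def]
    by (intro order_trans[OF norm_triangle_ineq] order_trans[OF norm_triangle_ineq4] add_mono)
  then have K: "(norm K)^2 \<le> (6 * L)^2" by (intro power_mono) auto
  have E: "auxE Q R q f g z = F z * G z * (Bf * Bg * K)"
  proof -
    have a: "radA R q f z = Bf * (deriv (deriv F) z / deriv F z)" "radA R q g z = Bg * (deriv (deriv G) z / deriv G z)"
      using A_eq[OF f] A_eq[OF g] nz(3,4) unfolding Bf_def Bg_def F_def G_def by blast+
    have b: "deriv F z = (deriv F z / F z) * F z" "deriv G z = (deriv G z / G z) * G z" using nz by auto
    have "auxE Q R q f g z = (Bf * (deriv (deriv F) z / deriv F z) * Bg - Bg * (deriv (deriv G) z / deriv G z) * Bf) * F z * G z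
        - 2 * Bf * Bg * ((deriv F z / F z) * F z * G z - (deriv G z / G z) * G z * F z)"
      unfolding auxE_def F_def[symmetric] G_def[symmetric] FG Bf_def[symmetric] Bg_def[symmetric] a
      using b by simp
    also have "\<dots> = F z * G z * (Bf * Bg * K)"
      unfolding K_def by (simp only: algebra_simps)
    finally show ?thesis .
  qed
  have "(F z * G z)^2 * (Bf * Bg * K)^2 = (F z * G z)^2 * (F z * G z * W)"
    using W unfolding E FG by (simp add: power_mult_distrib power2_eq_square power3_eq_cube mult_ac)
  moreover have "(F z * G z)^2 \<noteq> 0" using nz by simp
  ultimately have "(Bf * Bg * K)^2 = F z * G z * W" by (metis mult_left_cancel)
  then have nW: "norm (F z) * norm (G z) * norm W = (norm Bf)^2 * (norm Bg)^2 * (norm K)^2"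
    by (metis norm_mult norm_power power_mult_distrib)
  let ?u = "1 + norm (f z)" and ?v = "1 + norm (g z)"
  have "(norm (F z) * norm (G z)) * (norm W * (?u * ?v)) = ((norm Bf)^2 * ?u) * ((norm Bg)^2 * ?v) * (norm K)^2"
    using nW by (simp add: mult_ac)
  also have "\<dots> \<le> (C * L^2 * norm (F z)) * (C * L^2 * norm (G z)) * (6 * L)^2"
    using Bb[OF A(1) L(5)] Bb[OF A(2) L(6)] C(1) unfolding Bf_def[symmetric] Bg_def[symmetric] FG
    by (intro mult_mono[OF mult_mono K]) auto
  also have "\<dots> = (norm (F z) * norm (G z)) * (36 * C^2 * L^6)"
    by (simp add: power2_eq_square eval_nat_numeral mult_ac)
  finally show ?thesis
    by (rule mult_left_le_imp_le) (use nz in auto)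
qed

section \<open>Tame functions built from \<open>f\<close> and \<open>g\<close>\<close>

lemma log_height_swap: "log_height f g = log_height g f"
  by (simp add: log_height_def mult.commute fun_eq_iff)

lemma tame_swap: "tame f g h \<longleftrightarrow> tame g f h"
  unfolding tame_def log_height_swap[of f g] ..

lemma poly_comp_log_height_bound:
  "\<exists>K\<ge>1. \<forall>z B. 0 \<le> B \<longrightarrow> log_height f g z \<le> B \<longrightarrow> norm (poly P (f z)) \<le> K * exp (K * B)"
proof -
  obtain c n where c: "c \<ge> 1" "\<And>x. norm (poly P x) \<le> c * (1 + norm x) ^ n"
    using poly_norm_bound[of P] by blast
  define K where "K = max c (real n)"
  have K: "K \<ge> 1" "K \<ge> c" "K \<ge> n" using c(1) by (auto simp: K_def)
  show ?thesis
  proof (intro exI[of _ K] conjI allI impI K(1))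
    fix z B assume B: "0 \<le> B" and bd: "log_height f g z \<le> B"
    have "(1 + norm (f z)) * 1 \<le> exp (log_height f g z)"
      unfolding exp_log_height by (intro mult_left_mono) auto
    also have "\<dots> \<le> exp B" using bd by simp
    finally have "(1 + norm (f z)) ^ n \<le> exp B ^ n" by (intro power_mono) auto
    also have "\<dots> = exp (n * B)" by (simp add: exp_of_nat_mult)
    also have "\<dots> \<le> exp (K * B)" using K B by (simp add: mult_right_mono)
    finally have "(1 + norm (f z)) ^ n \<le> exp (K * B)" .
    then have "c * (1 + norm (f z)) ^ n \<le> K * exp (K * B)" using K by (intro mult_mono) auto
    then show "norm (poly P (f z)) \<le> K * exp (K * B)" using c(2)[of "f z"] by linarith
  qed
qed

lemma tame_poly_comp: "tame f g (\<lambda>z. poly P (f z))"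
proof -
  obtain K where K: "K \<ge> 1" "\<And>z B. 0 \<le> B \<Longrightarrow> log_height f g z \<le> B \<Longrightarrow> norm (poly P (f z)) \<le> K * exp (K * B)"
    using poly_comp_log_height_bound by blast
  show ?thesis
    unfolding tame_def
  proof (intro exI[of _ K] conjI allI impI K(1))
    fix \<rho> \<delta> B :: real and z :: complex
    assume \<delta>: "0 < \<delta>" "\<delta> \<le> 1" and B: "0 \<le> B" and bd: "\<forall>z. norm z \<le> \<rho> + \<delta> \<longrightarrow> log_height f g z \<le> B"
      and z: "norm z \<le> \<rho>"
    have "norm (poly P (f z)) \<le> K * exp (K * B)" using bd z \<delta> by (intro K(2) B) auto
    also have "\<dots> \<le> K / \<delta> * exp (K * B)"
    proof (rule mult_right_mono)
      have "K * \<delta> \<le> K * 1" using K \<delta> by (intro mult_left_mono) auto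
      then show "K \<le> K / \<delta>" using \<delta> by (simp add: field_simps)
    qed auto
    finally show "norm (poly P (f z)) \<le> K / \<delta> * exp (K * B)" .
  qed
qed

lemma tame_deriv_poly_comp:
  assumes f: "f holomorphic_on UNIV"
  shows "tame f g (deriv (\<lambda>z. poly P (f z)))"
proof -
  obtain K where K: "K \<ge> 1" "\<And>z B. 0 \<le> B \<Longrightarrow> log_height f g z \<le> B \<Longrightarrow> norm (poly P (f z)) \<le> K * exp (K * B)"
    using poly_comp_log_height_bound by blast
  let ?h = "\<lambda>z. poly P (f z)"
  have h: "?h holomorphic_on A" for A by (rule entire_subset[OF holomorphic_on_poly_comp[OF f]])
  show ?thesis
    unfolding tame_def
  proof (intro exI[of _ K] conjI allI impI K(1))
    fix \<rho> \<delta> B :: real and z :: complex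
    assume \<delta>: "0 < \<delta>" "\<delta> \<le> 1" and B: "0 \<le> B" and bd: "\<forall>z. norm z \<le> \<rho> + \<delta> \<longrightarrow> log_height f g z \<le> B"
      and z: "norm z \<le> \<rho>"
    have "norm ((deriv ^^ 1) ?h z) \<le> fact 1 * (K * exp (K * B)) / \<delta> ^ 1"
    proof (rule Cauchy_inequality)
      show "norm (?h w) \<le> K * exp (K * B)" if "norm (z - w) = \<delta>" for w
      proof (rule K(2)[OF B])
        have "norm w \<le> norm z + norm (z - w)" using norm_triangle_ineq4[of z "z - w"] by simp
        then show "log_height f g w \<le> B" using bd z that by simp
      qed
    qed (use h \<delta> in \<open>auto intro: holomorphic_on_imp_continuous_on\<close>)
    then show "norm (deriv ?h z) \<le> K / \<delta> * exp (K * B)" by simp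
  qed
qed

section \<open>Generic points and translations\<close>

lemma ex_common_nonzero:
  assumes "finite H" and "\<And>h. h \<in> H \<Longrightarrow> h holomorphic_on UNIV \<and> (\<exists>w. h w \<noteq> (0::complex))"
  shows "\<exists>w. \<forall>h\<in>H. h w \<noteq> 0"
proof -
  have "countable (\<Union>h\<in>H. {w. h w = 0})"
    using assms by (intro countable_UN countable_finite[of H]) (auto intro: countable_zeros_entire)
  then have "(\<Union>h\<in>H. {w. h w = 0}) \<noteq> UNIV" using uncountable_UNIV_complex by metis
  then show ?thesis by blast
qed

lemma deriv_shift:
  assumes "f holomorphic_on UNIV"
  shows "deriv (\<lambda>z. f (z + w)) = (\<lambda>z. deriv f (z + w))"
proof
  fix z
  have "((\<lambda>z. f (z + w)) has_field_derivative deriv f (z + w)) (at z)"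
    using entire_has_deriv[OF assms, of "z + w"] by (simp add: DERIV_shift)
  then show "deriv (\<lambda>z. f (z + w)) z = deriv f (z + w)" by (rule DERIV_imp_deriv)
qed

lemma entire_shift:
  assumes "f holomorphic_on UNIV"
  shows "(\<lambda>z. f (z + w)) holomorphic_on UNIV"
proof -
  have "(f \<circ> (\<lambda>z. z + w)) holomorphic_on UNIV"
    by (rule holomorphic_on_compose_gen[of _ _ _ UNIV]) (intro holomorphic_intros assms subset_UNIV)+
  then show ?thesis by (simp add: o_def)
qed

lemma deriv_nonzero_somewhere:
  assumes f: "f holomorphic_on UNIV" and nc: "\<And>a. \<exists>w. f w \<noteq> a"
  shows "\<exists>w. deriv f w \<noteq> 0"
proof (rule ccontr)
  assume "\<not> ?thesis"
  then have "(f has_field_derivative 0) (at z within UNIV)" for z using entire_has_deriv[OF f, of z] by simp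
  then have "\<exists>c. \<forall>x\<in>UNIV. f x = c" by (intro has_field_derivative_zero_constant) auto
  then show False using nc by blast
qed

text \<open>Both Jensen's inequality for \<open>W\<close> and the lemma on the logarithmic
  derivative are centred at 0 and need nonzero values there. Hence all functions are translated so
  that the generic point \<open>w\<close> becomes the origin, and the polynomial is translated back
  at the end.\<close>

lemma polynomial_of_auxE_quotient:
  assumes f: "f holomorphic_on UNIV" and g: "g holomorphic_on UNIV"
    and R: "R * pderiv (pderiv Q) = q * pderiv Q" and A: "finite A" "\<And>x. x \<notin> A \<Longrightarrow> poly Q x \<noteq> 0 \<and> poly (pderiv Q) x \<noteq> 0"
    and C: "C > 0" "\<And>x. \<exists>a\<in>A. (norm (x - a))^2 * (norm (poly R x))^2 * (1 + norm x) \<le> C * norm (poly Q x)"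
    and W: "W holomorphic_on UNIV" "\<And>z. (auxE Q R q f g z)^2 = (poly Q (f z) * poly Q (g z))^3 * W z"
    and w: "auxE Q R q f g w \<noteq> 0" "f w \<notin> A" "g w \<notin> A" "deriv f w \<noteq> 0" "deriv g w \<noteq> 0"
  shows "\<exists>p. \<forall>z. f z = poly p z"
proof -
  define f1 where "f1 = (\<lambda>z. f (z + w))"
  define g1 where "g1 = (\<lambda>z. g (z + w))"
  define W1 where "W1 = (\<lambda>z. W (z + w))"
  have e: "f1 holomorphic_on UNIV" "g1 holomorphic_on UNIV" "W1 holomorphic_on UNIV"
    unfolding f1_def g1_def W1_def by (intro entire_shift f g W)+
  define F1 where "F1 = (\<lambda>z. poly Q (f1 z))"
  define G1 where "G1 = (\<lambda>z. poly Q (g1 z))"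
  \<comment> \<open>These are the functions whose logarithmic derivatives enter the pointwise bound.
    With the first two families the nearest point \<open>a\<close> may vary along the
    circle.\<close>
  define H where "H = (\<lambda>a z. f1 z - a) ` A \<union> (\<lambda>a z. g1 z - a) ` A \<union> {F1, deriv F1, G1, deriv G1}"
  have fin: "finite H" using A by (simp add: H_def)
  have e1: "F1 holomorphic_on UNIV" "G1 holomorphic_on UNIV"
    unfolding F1_def G1_def by (intro holomorphic_on_poly_comp e)+
  have lin: "(\<lambda>z. h z - a) = (\<lambda>z. poly [:-a, 1:] (h z))" for h :: "complex \<Rightarrow> complex" and a
    by (simp add: fun_eq_iff)
  have d1: "deriv F1 = (\<lambda>z. deriv (\<lambda>z. poly Q (f z)) (z + w))" "deriv G1 = (\<lambda>z. deriv (\<lambda>z. poly Q (g z)) (z + w))"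
    unfolding F1_def G1_def f1_def g1_def
    by (intro deriv_shift[of "\<lambda>z. poly Q (f z)"] deriv_shift[of "\<lambda>z. poly Q (g z)"] holomorphic_on_poly_comp f g)+
  have d2: "deriv (deriv F1) = (\<lambda>z. deriv (deriv (\<lambda>z. poly Q (f z))) (z + w))"
      "deriv (deriv G1) = (\<lambda>z. deriv (deriv (\<lambda>z. poly Q (g z))) (z + w))"
    unfolding d1
    by (intro deriv_shift entire_deriv holomorphic_on_poly_comp f g)+
  have Hp: "h holomorphic_on UNIV \<and> h 0 \<noteq> 0 \<and> tame f1 g1 h" if "h \<in> H" for h
  proof -
    from that consider (a) a where "a \<in> A" "h = (\<lambda>z. f1 z - a)" | (b) a where "a \<in> A" "h = (\<lambda>z. g1 z - a)"
      | (c) "h = F1" | (d) "h = deriv F1" | (e) "h = G1" | (f) "h = deriv G1"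
      by (auto simp: H_def)
    then show ?thesis
    proof cases
      case a
      have "tame f1 g1 h" unfolding a(2) lin by (rule tame_poly_comp)
      moreover have "h holomorphic_on UNIV" unfolding a(2) by (intro holomorphic_intros e)
      ultimately show ?thesis using a w by (auto simp: f1_def)
    next
      case b
      have "tame f1 g1 h" unfolding b(2) lin tame_swap[of f1 g1] by (rule tame_poly_comp)
      moreover have "h holomorphic_on UNIV" unfolding b(2) by (intro holomorphic_intros e)
      ultimately show ?thesis using b w by (auto simp: g1_def)
    next
      case c
      then show ?thesis using e1 A(2)[OF w(2)] tame_poly_comp[of f1 g1 Q] by (auto simp: F1_def f1_def)
    next
      case d
      have "tame f1 g1 h" unfolding d F1_def by (rule tame_deriv_poly_comp[OF e(1)])
      moreover have "h 0 \<noteq> 0" unfolding d d1 using A(2)[OF w(2)] w by (simp add: deriv_poly_comp[OF f])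
      ultimately show ?thesis using d e1 entire_deriv by blast
    next
      case e
      have "tame f1 g1 h" unfolding e G1_def tame_swap[of f1 g1] by (rule tame_poly_comp)
      then show ?thesis using e e1 A(2)[OF w(3)] by (auto simp: G1_def g1_def)
    next
      case f
      have "tame f1 g1 h" unfolding f G1_def tame_swap[of f1 g1] by (rule tame_deriv_poly_comp[OF e(2)])
      moreover have "h 0 \<noteq> 0" unfolding f d1 using A(2)[OF w(3)] w by (simp add: deriv_poly_comp[OF g])
      ultimately show ?thesis using f e1 entire_deriv by blast
    qed
  qed
  have W0: "W1 0 \<noteq> 0" using W(2)[of w] w(1) by (auto simp: W1_def)
  have bound: "norm (W1 z) * exp (log_height f1 g1 z) \<le> 36 * C^2 * (1 + (\<Sum>h\<in>H. norm (deriv h z / h z))) ^ 6"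
    if nz: "\<And>h. h \<in> H \<Longrightarrow> h z \<noteq> 0" for z
  proof -
    define L where "L = 1 + (\<Sum>h\<in>H. norm (deriv h z / h z))"
    have L: "norm (deriv h z / h z) \<le> L" if "h \<in> H" for h
    proof -
      have "norm (deriv h z / h z) \<le> (\<Sum>h\<in>H. norm (deriv h z / h z))"
        using fin that by (intro member_le_sum) auto
      then show ?thesis by (simp add: L_def)
    qed
    have dlin: "deriv (\<lambda>z. h (z + w) - a) z = deriv h (z + w)" if "h holomorphic_on UNIV" for h a
      by (rule DERIV_imp_deriv)
         (use entire_has_deriv[OF entire_shift[OF that, of w], of z] in \<open>auto intro!: derivative_eq_intros simp: deriv_shift[OF that]\<close>)
    have inH: "F1 \<in> H" "G1 \<in> H" "deriv F1 \<in> H" "deriv G1 \<in> H" by (auto simp: H_def)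
    have inH': "(\<lambda>z. f1 z - a) \<in> H" "(\<lambda>z. g1 z - a) \<in> H" if "a \<in> A" for a using that by (auto simp: H_def)
    have "norm (W (z + w)) * ((1 + norm (f (z + w))) * (1 + norm (g (z + w)))) \<le> 36 * C^2 * L^6"
    proof (rule auxE_pointwise_bound[OF f g R C])
      show "poly Q (f (z + w)) \<noteq> 0" using nz[OF inH(1)] by (simp add: F1_def f1_def)
      show "poly Q (g (z + w)) \<noteq> 0" using nz[OF inH(2)] by (simp add: G1_def g1_def)
      show "deriv (\<lambda>z. poly Q (f z)) (z + w) \<noteq> 0" using nz[OF inH(3)] by (simp add: d1)
      show "deriv (\<lambda>z. poly Q (g z)) (z + w) \<noteq> 0" using nz[OF inH(4)] by (simp add: d1)
      show "f (z + w) \<notin> A" using nz[OF inH'(1)] by (auto simp: f1_def)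
      show "g (z + w) \<notin> A" using nz[OF inH'(2)] by (auto simp: g1_def)
      show "norm (deriv (\<lambda>z. poly Q (f z)) (z + w) / poly Q (f (z + w))) \<le> L"
        using L[OF inH(1)] unfolding d1 by (simp add: F1_def f1_def)
      show "norm (deriv (\<lambda>z. poly Q (g z)) (z + w) / poly Q (g (z + w))) \<le> L"
        using L[OF inH(2)] unfolding d1 by (simp add: G1_def g1_def)
      show "norm (deriv (deriv (\<lambda>z. poly Q (f z))) (z + w) / deriv (\<lambda>z. poly Q (f z)) (z + w)) \<le> L"
        using L[OF inH(3)] unfolding d2 by (simp add: d1)
      show "norm (deriv (deriv (\<lambda>z. poly Q (g z))) (z + w) / deriv (\<lambda>z. poly Q (g z)) (z + w)) \<le> L"
        using L[OF inH(4)] unfolding d2 by (simp add: d1)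
      show "norm (deriv f (z + w) / (f (z + w) - a)) \<le> L" if "a \<in> A" for a
        using L[OF inH'(1)[OF that]] by (simp add: f1_def dlin[OF f])
      show "norm (deriv g (z + w) / (g (z + w) - a)) \<le> L" if "a \<in> A" for a
        using L[OF inH'(2)[OF that]] by (simp add: g1_def dlin[OF g])
    qed (rule W(2))
    then show ?thesis by (simp add: exp_log_height W1_def f1_def g1_def L_def)
  qed
  obtain K where "\<And>r0. \<exists>r>r0. mean_log_height f1 g1 r \<le> K * (1 + ln (r + 1))"
    using mean_log_height_slow[OF e(1,2,3) W0 fin Hp bound] by blast
  from polynomial_of_slow_growth[OF e(1,2) this]
  obtain p where p: "\<And>z. f1 z = poly p z" by blast
  have "f z = poly (pcompose p [:-w, 1:]) z" for z
    using p[of "z - w"] by (simp add: f1_def poly_pcompose)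
  then show ?thesis by blast
qed

lemma weak_sharing_uniqueness:
  fixes Q :: "complex poly"
  assumes su: "strong_uniqueness_poly Q" and card: "card {a. poly Q a = 0} = degree Q"
    and deg: "2 * card {z. poly (pderiv Q) z = 0} + 3 \<le> degree Q"
    and k: "card {z. poly (pderiv Q) z = 0} \<ge> 2"
    and f: "f holomorphic_on UNIV" "\<not> (\<exists>p. \<forall>z. f z = poly p z)"
    and g: "g holomorphic_on UNIV" "\<And>a. \<exists>w. g w \<noteq> a"
    and share: "E_weak 3 {a. poly Q a = 0} f = E_weak 3 {a. poly Q a = 0} g"
  shows "f z = g z"
proof -
  let ?S = "{a. poly Q a = 0}" and ?Z = "{z. poly (pderiv Q) z = 0}"
  have Q0: "Q \<noteq> 0" and dQ: "degree Q \<ge> 1" and lead: "lead_coeff Q = 1" using deg su by (auto simp: strong_uniqueness_poly_def)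
  have dQ0: "pderiv Q \<noteq> 0" using dQ by (simp add: pderiv_eq_0_iff)
  have fin: "finite ?S" "finite ?Z" using Q0 dQ0 poly_roots_finite by blast+
  have sq: "rsquarefree Q" by (rule rsquarefree_card_roots[OF Q0 card])
  define R where "R = (\<Prod>a\<in>?Z. [:-a, 1:])"
  obtain q where R: "R * pderiv (pderiv Q) = q * pderiv Q"
    using radical_mult_pderiv[OF dQ0] unfolding R_def by blast
  have Rp: "poly R x = (\<Prod>b\<in>?Z. x - b)" for x by (simp add: R_def poly_prod)
  have Qp: "poly Q x = (\<Prod>b\<in>?S. x - b)" for x
    using arg_cong[OF complex_poly_decompose_rsquarefree[OF sq], of "\<lambda>p. poly p x"] lead by (simp add: poly_prod)
  have Rz: "poly (pderiv Q) x = 0" if "poly R x = 0" for x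
    using that fin by (simp add: Rp)
  have disj: "?S \<inter> ?Z = {}" using sq by (auto simp: rsquarefree_roots)
  obtain C where C: "C > 0" "\<And>x. \<exists>a\<in>?S \<union> ?Z. (norm (x - a))^2 * (norm (poly R x))^2 * (1 + norm x) \<le> C * norm (poly Q x)"
    using root_product_inequality[OF fin disj] deg card unfolding Rp[symmetric] Qp[symmetric] by metis
  have fnc: "\<exists>w. f w \<noteq> a" for a
  proof (rule ccontr)
    assume "\<not> ?thesis"
    then have "\<forall>z. f z = poly [:a:] z" by simp
    then show False using f(2) by blast
  qed
  \<comment> \<open>A point at which no member of \<open>H\<close> vanishes is generic: the values
    of \<open>f\<close> and \<open>g\<close> avoid the zeros of \<open>Q\<close> and
    \<open>Q'\<close>, and both derivatives are nonzero. It exists because the zero sets are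
    countable.\<close>
  define H where "H = (\<lambda>a z. f z - a) ` (?S \<union> ?Z) \<union> (\<lambda>a z. g z - a) ` (?S \<union> ?Z) \<union> {deriv f, deriv g}"
  have Hfin: "finite H" using fin by (simp add: H_def)
  have Hh: "h holomorphic_on UNIV \<and> (\<exists>w. h w \<noteq> 0)" if "h \<in> H" for h
    using that fnc g(2) deriv_nonzero_somewhere[OF f(1) fnc] deriv_nonzero_somewhere[OF g] f(1) g(1)
    by (auto simp: H_def intro!: holomorphic_intros entire_deriv)
  have Hn: "f w \<notin> ?S \<union> ?Z" "g w \<notin> ?S \<union> ?Z" "deriv f w \<noteq> 0" "deriv g w \<noteq> 0" if w: "\<forall>h\<in>H. h w \<noteq> 0" for w
    using w by (auto simp: H_def ball_Un)
  show ?thesis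
  proof (cases "\<forall>z. auxE Q R q f g z = 0")
    case True
    obtain w where "\<forall>h\<in>H. h w \<noteq> 0" using ex_common_nonzero[OF Hfin Hh] ..
    note w = Hn[OF this]
    have "poly Q (f w) \<noteq> 0" "poly Q (g w) \<noteq> 0" "deriv (\<lambda>z. poly Q (f z)) w \<noteq> 0" "deriv (\<lambda>z. poly Q (g z)) w \<noteq> 0"
      using w by (auto simp: deriv_poly_comp[OF f(1)] deriv_poly_comp[OF g(1)])
    then have "\<exists>A B. A \<noteq> 0 \<and> (\<forall>z. poly Q (g z) - A * poly Q (f z) = B * poly Q (f z) * poly Q (g z))"
      using True by (intro auxE_vanishing[OF f(1) g(1) R Rz, of w]) auto
    then obtain A B where A: "A \<noteq> 0" and AB: "\<And>z. poly Q (g z) - A * poly Q (f z) = B * poly Q (f z) * poly Q (g z)"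
      by blast
    show ?thesis
    proof (cases "B = 0")
      case True
      then have "poly Q (g z) = A * poly Q (f z)" for z using AB[of z] by simp
      then have "g z = f z" by (intro strong_uniqueness_entire[OF su g(1) f(1) g(2) fnc A])
      then show ?thesis by simp
    next
      case False
      \<comment> \<open>At such a point \<open>A + B Q(g)\<close> would be 0, and the relation in
        the form \<open>Q(g) = Q(f) (A + B Q(g))\<close> would give \<open>Q(g) = 0\<close>,
        contrary to \<open>A \<noteq> 0\<close>.\<close>
      have omit: "poly Q (g z) \<noteq> - A / B" for z
      proof
        assume eq: "poly Q (g z) = - A / B"
        then have "B * poly Q (g z) = - A" using False by simp
        moreover have "poly Q (g z) = poly Q (f z) * (A + B * poly Q (g z))" using AB[of z] by (simp add: algebra_simps)
        ultimately have "poly Q (g z) = 0" by simp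
        then show False using eq A False by simp
      qed
      have "\<exists>b1 b2. b1 \<noteq> b2 \<and> poly Q b1 = - A / B \<and> poly Q b2 = - A / B"
      proof (rule ccontr)
        assume no: "\<not> ?thesis"
        obtain b where "\<And>x. poly Q x = - A / B \<Longrightarrow> x = b" using no by metis
        then have "card ?Z \<le> 1" by (rule card_pderiv_roots_le_1[OF dQ])
        then show False using k by simp
      qed
      then obtain b1 b2 where b: "b1 \<noteq> b2" "poly Q b1 = - A / B" "poly Q b2 = - A / B" by blast
      have "range g \<inter> {b1, b2} = {}" using omit b by auto
      then obtain c where "g = (\<lambda>x. c)" using little_Picard[OF g(1) b(1)] by metis
      then show ?thesis using g(2)[of c] by simp
    qed
  next
    case False
    have Eh: "auxE Q R q f g holomorphic_on UNIV" by (rule auxE_entire[OF f(1) g(1)])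
    have "h holomorphic_on UNIV \<and> (\<exists>w. h w \<noteq> 0)" if "h \<in> insert (auxE Q R q f g) H" for h
      using that Hh Eh False by auto
    then have "\<exists>w. \<forall>h\<in>insert (auxE Q R q f g) H. h w \<noteq> 0"
      by (rule ex_common_nonzero[OF finite.insertI[OF Hfin]])
    then obtain w where w: "auxE Q R q f g w \<noteq> 0" "\<forall>h\<in>H. h w \<noteq> 0" by auto
    note wn = Hn[OF w(2)]
    have wq: "poly Q (f w) \<noteq> 0" "poly Q (g w) \<noteq> 0" using wn by auto
    obtain W where W: "W holomorphic_on UNIV" "\<And>z. (auxE Q R q f g z)^2 = (poly Q (f z) * poly Q (g z))^3 * W z"
      using auxE_quotient[OF f(1) fnc g(1) g(2) sq R wq share] by blast
    have "\<exists>p. \<forall>z. f z = poly p z"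
      by (rule polynomial_of_auxE_quotient[OF f(1) g(1) R _ _ C W w(1) wn]) (use fin in auto)
    then show ?thesis using f(2) by blast
  qed
qed

theorem theorem2p2:
  fixes Q :: "complex poly" and S :: "complex set" and n m1 m2 k :: nat
    and f :: "complex \<Rightarrow> complex" and c :: complex
  assumes "n \<ge> 1"
    and "strong_uniqueness_poly Q"
    and "degree Q = n"
    and "S = {a. poly Q a = 0}"
    and "card S = n"
    and "m1 = card {z. poly (Q - [:poly Q 0:]) z = 0 \<and> order z (Q - [:poly Q 0:]) = 1}"
    and "m2 = card {z. poly (Q - [:poly Q 0:]) z = 0 \<and> order z (Q - [:poly Q 0:]) \<ge> 2}"
    and "k = card {z. poly (pderiv Q) z = 0}"
    and "n > max (2 * k + 2) (m1 + m2)"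
    and "m1 + m2 > 2"
    and "k \<ge> 2"
    and "transcendental_entire f"
    and "hyper_order f < 1"
    and "c \<noteq> 0"
    and "E_weak 3 S f = E_weak 3 S (\<lambda>z. f (z + c))"
  shows "\<forall>z. f z = f (z + c)"
proof
  fix z
  have f: "f holomorphic_on UNIV" "\<not> (\<exists>p. \<forall>z. f z = poly p z)"
    using assms(12) by (auto simp: transcendental_entire_def)
  show "f z = f (z + c)"
  proof (rule weak_sharing_uniqueness[OF assms(2) _ _ _ f, where g = "\<lambda>z. f (z + c)"])
    show "(\<lambda>z. f (z + c)) holomorphic_on UNIV" by (rule entire_shift[OF f(1)])
    show "\<exists>w. f (w + c) \<noteq> a" for a
    proof (rule ccontr)
      assume "\<not> ?thesis"
      then have "f (w - c + c) = a" for w by blast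
      then have "\<forall>z. f z = poly [:a:] z" by simp
      then show False using f(2) by blast
    qed
  qed (use assms in auto)
qed

end
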